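(* The Mellin–Barnes type integral representation of the extended Lauricella function $\mathbf{F}_{D,(\kappa_l)}^{(r)}$ is $$ \mathbf{F}_{D,(\kappa_l)}^{(r)}(\alpha,\beta_1,\dots,\beta_r;\gamma;x_1,\dots,x_r;b,d)=\frac1{(2\pi i)^r}\int_{L_1}\cdots\int_{L_r}\prod_{j=1}^r\frac{\Gamma(\beta_j-s_j)\Gamma(s_j)}{\Gamma(\beta_j)}\;\frac{\mathcal{B}^{(\kappa_l)}_{b,d}(\alpha-s_1-\cdots-s_r,\gamma-\alpha)}{B(\alpha,\gamma-\alpha)}\,(-x_1)^{-s_1}\cdots(-x_r)^{-s_r}\,ds_1\cdots ds_r , $$ where $L_1,\dots,L_r$ are Barnes paths of integration.
   Context: Here $(a)_m=\Gamma(a+m)/\Gamma(a)$ is the Pochhammer symbol and $B(\cdot,\cdot)$ is Euler's beta function. A Barnes path of integration in the $s_j$-plane starts at $-i\infty$ and runs to $+i\infty$, curving if necessary so as to separate the poles of $\Gamma(s_j)$ from those of $\Gamma(\beta_j-s_j)$. Let $\Theta(\kappa_l;z)$ be a function analytic in a disk $|z|<R$ ($0<R<\infty$), with $\Theta(\kappa_l;z)=\sum_{l\ge0}\kappa_l z^l/l!$ there ($\kappa_0=1$), which can be continued analytically in the right half-plane $\Re(z)>0$ with $\Theta(\kappa_l;z)=M_0z^{\omega}e^{z}[1+O(1/z)]$ as $\Re(z)\to\infty$, for suitable constants $M_0>0$, $\omega\in\mathbb{C}$ depending on the sequence $\{\kappa_l\}$. For $\min\{\Re(\alpha),\Re(\beta)\}>0$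 and $\min\{\Re(b),\Re(d)\}\ge0$, $$\mathcal{B}^{(\kappa_l)}_{b,d}(\alpha,\beta)=\int_0^1t^{\alpha-1}(1-t)^{\beta-1}\Theta\left(\kappa_l;-\frac bt-\frac d{1-t}\right)dt .$$ The extended Lauricella function $\mathbf{F}_{D,(\kappa_l)}^{(r)}$ is, for $\max\{|x_1|,\dots,|x_r|\}<1$ and $\min\{\Re(b),\Re(d)\}\ge0$, $$\mathbf{F}_{D,(\kappa_l)}^{(r)}(\alpha,\beta_1,\dots,\beta_r;\gamma;x_1,\dots,x_r;b,d)=\sum_{m_1,\dots,m_r=0}^\infty(\beta_1)_{m_1}\cdots(\beta_r)_{m_r}\frac{\mathcal{B}^{(\kappa_l)}_{b,d}(\alpha+m_1+\cdots+m_r,\gamma-\alpha)}{B(\alpha,\gamma-\alpha)}\frac{x_1^{m_1}}{m_1!}\cdots\frac{x_r^{m_r}}{m_r!}.$$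
   Formalization: Adds x_j ≠ 0 and |arg(-x_j)| < π (principal branch; otherwise the power is undefined or the integral may diverge), and that the sum of the suprema of Re s_j on the L_j is below Re α, so the extended beta factor is defined on the paths; its integral is assumed to converge. *)

theory Defs
  imports "HOL-Complex_Analysis.Complex_Analysis" "HOL-Library.Landau_Symbols"
begin

text \<open>
  The kernel \<open>\<Theta>(\<kappa>\<^sub>l; z)\<close>: the power series on the disk of radius \<open>R\<close>, its analytic
  continuation to the right half-plane (disk and half-plane together are connected, so it is
  unique), and the behaviour as \<open>Re z \<rightarrow> \<infinity>\<close>.  The error term is uniform in every closed sector
  \<open>\<bar>Im z\<bar> \<le> c Re z\<close>; uniformity in all of \<open>Im z\<close> would exclude the confluent hypergeometric function
  \<open>\<^sub>1F\<^sub>1\<close>.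
\<close>

definition theta_kernel :: "(nat \<Rightarrow> complex) \<Rightarrow> real \<Rightarrow> (complex \<Rightarrow> complex) \<Rightarrow> bool" where
  "theta_kernel \<kappa> R \<Theta> \<longleftrightarrow>
     0 < R \<and> \<kappa> 0 = 1 \<and>
     (\<forall>z. norm z < R \<longrightarrow> (\<lambda>l. \<kappa> l * z ^ l / fact l) sums \<Theta> z) \<and>
     \<Theta> holomorphic_on (ball 0 R \<union> {z. 0 < Re z}) \<and>
     (\<exists>M0 > (0::real). \<exists>\<omega>::complex. \<forall>c>0.
        (\<lambda>z. \<Theta> z / (of_real M0 * z powr \<omega> * exp z) - 1)
          \<in> O[inf (filtercomap Re at_top) (principal {z. \<bar>Im z\<bar> \<le> c * Re z})](\<lambda>z. 1 / z))"

definition ext_beta_integrand ::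
  "(complex \<Rightarrow> complex) \<Rightarrow> complex \<Rightarrow> complex \<Rightarrow> complex \<Rightarrow> complex \<Rightarrow> real \<Rightarrow> complex" where
  "ext_beta_integrand \<Theta> b d \<alpha> \<beta> t =
     of_real t powr (\<alpha> - 1) * of_real (1 - t) powr (\<beta> - 1) *
     \<Theta> (- b / of_real t - d / of_real (1 - t))"

definition ext_beta ::
  "(complex \<Rightarrow> complex) \<Rightarrow> complex \<Rightarrow> complex \<Rightarrow> complex \<Rightarrow> complex \<Rightarrow> complex" where
  "ext_beta \<Theta> b d \<alpha> \<beta> = (LINT t:{0<..<1}|lborel. ext_beta_integrand \<Theta> b d \<alpha> \<beta> t)"

text \<open>
  The properties of \<open>\<Theta>\<close> above say nothing about its values at \<open>-b/t - d/(1-t)\<close>, which has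
  nonpositive real part and is unbounded near the endpoints unless \<open>b = d = 0\<close>.  That the integral
  exists on the whole domain on which the extended beta function is defined is therefore a
  separate condition.
\<close>

definition ext_beta_defined :: "(complex \<Rightarrow> complex) \<Rightarrow> complex \<Rightarrow> complex \<Rightarrow> bool" where
  "ext_beta_defined \<Theta> b d \<longleftrightarrow>
     (\<forall>\<alpha> \<beta>. 0 < Re \<alpha> \<longrightarrow> 0 < Re \<beta> \<longrightarrow>
        set_integrable lborel {0<..<1} (ext_beta_integrand \<Theta> b d \<alpha> \<beta>))"

text \<open>
  The variables are indexed by a finite type \<open>'r\<close>, whose cardinality is the number \<open>r\<close> of
  variables, and a multi-index is a function \<open>m :: 'r \<Rightarrow> nat\<close>.
\<close>

definition ext_lauricella_FD_term ::
  "(complex \<Rightarrow> complex) \<Rightarrow> complex \<Rightarrow> ('r::finite \<Rightarrow> complex) \<Rightarrow> complex \<Rightarrow>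
   ('r \<Rightarrow> complex) \<Rightarrow> complex \<Rightarrow> complex \<Rightarrow> ('r \<Rightarrow> nat) \<Rightarrow> complex" where
  "ext_lauricella_FD_term \<Theta> \<alpha> \<beta> \<gamma> x b d m =
     (\<Prod>j\<in>UNIV. pochhammer (\<beta> j) (m j)) *
     (ext_beta \<Theta> b d (\<alpha> + of_nat (\<Sum>j\<in>UNIV. m j)) (\<gamma> - \<alpha>) / Beta \<alpha> (\<gamma> - \<alpha>)) *
     (\<Prod>j\<in>UNIV. x j ^ m j / fact (m j))"

definition ext_lauricella_FD ::
  "(complex \<Rightarrow> complex) \<Rightarrow> complex \<Rightarrow> ('r::finite \<Rightarrow> complex) \<Rightarrow> complex \<Rightarrow>
   ('r \<Rightarrow> complex) \<Rightarrow> complex \<Rightarrow> complex \<Rightarrow> complex" where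
  "ext_lauricella_FD \<Theta> \<alpha> \<beta> \<gamma> x b d =
     (\<Sum>\<^sub>\<infinity>m\<in>UNIV. ext_lauricella_FD_term \<Theta> \<alpha> \<beta> \<gamma> x b d m)"

text \<open>
  A point lies to the left (right) of a path running upwards in a vertical strip if it can be
  joined, without meeting the path, to a point with smaller (larger) real part than every point of
  the path.  No point lies on both sides, so a Barnes path exists only if \<open>\<beta>\<close> is not one of
  \<open>0, -1, -2, \<dots>\<close>, i.e. only if the two families of poles are disjoint.
\<close>

definition left_of_path :: "(real \<Rightarrow> complex) \<Rightarrow> complex \<Rightarrow> bool" where
  "left_of_path g p \<longleftrightarrow>
     (\<exists>q. (\<forall>t. Re q < Re (g t)) \<and> connected_component (- range g) p q)"

definition right_of_path :: "(real \<Rightarrow> complex) \<Rightarrow> complex \<Rightarrow> bool" where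
  "right_of_path g p \<longleftrightarrow>
     (\<exists>q. (\<forall>t. Re (g t) < Re q) \<and> connected_component (- range g) p q)"

text \<open>
  A Barnes path is parametrised over the whole real line.  The integrability clause excludes only
  paths that oscillate so much that their length, damped exponentially in \<open>\<bar>Im s\<bar>\<close>, is infinite;
  it holds for every path that is a vertical line outside a bounded set.
\<close>

definition barnes_path :: "complex \<Rightarrow> (real \<Rightarrow> complex) \<Rightarrow> bool" where
  "barnes_path \<beta> g \<longleftrightarrow>
     (\<forall>T>0. g piecewise_C1_differentiable_on {-T..T}) \<and>
     filterlim (\<lambda>t. Im (g t)) at_bot at_bot \<and>
     filterlim (\<lambda>t. Im (g t)) at_top at_top \<and>
     bounded (range (\<lambda>t. Re (g t))) \<and>
     (\<forall>\<epsilon>>0. integrable lborel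
        (\<lambda>t. exp (- \<epsilon> * \<bar>Im (g t)\<bar>) * norm (vector_derivative g (at t)))) \<and>
     (\<forall>s. s \<in> \<int>\<^sub>\<le>\<^sub>0 \<longrightarrow> left_of_path g s) \<and>
     (\<forall>s. \<beta> - s \<in> \<int>\<^sub>\<le>\<^sub>0 \<longrightarrow> right_of_path g s)"

text \<open>
  The multiple contour integral over \<open>L\<^sub>1 \<times> \<dots> \<times> L\<^sub>r\<close>, as a Lebesgue integral over the
  parameter space.  Where it converges absolutely it is, by Fubini, the iterated integral in any
  order.
\<close>

definition paths_integrand ::
  "('r::finite \<Rightarrow> real \<Rightarrow> complex) \<Rightarrow> (('r \<Rightarrow> complex) \<Rightarrow> complex) \<Rightarrow> ('r \<Rightarrow> real) \<Rightarrow> complex" where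
  "paths_integrand L f t =
     f (\<lambda>j. L j (t j)) * (\<Prod>j\<in>UNIV. vector_derivative (L j) (at (t j)))"

definition paths_integrable ::
  "('r::finite \<Rightarrow> real \<Rightarrow> complex) \<Rightarrow> (('r \<Rightarrow> complex) \<Rightarrow> complex) \<Rightarrow> bool" where
  "paths_integrable L f \<longleftrightarrow> integrable (\<Pi>\<^sub>M j\<in>UNIV. lborel) (paths_integrand L f)"

definition paths_integral ::
  "('r::finite \<Rightarrow> real \<Rightarrow> complex) \<Rightarrow> (('r \<Rightarrow> complex) \<Rightarrow> complex) \<Rightarrow> complex" where
  "paths_integral L f = (LINT t|(\<Pi>\<^sub>M j\<in>UNIV. lborel). paths_integrand L f t)"

text \<open>
  The extended beta factor is defined only where \<open>\<Sum>\<^sub>j Re s\<^sub>j < Re \<alpha>\<close>, which restricts the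
  paths: the integrand makes sense only if \<open>L\<^sub>1 \<times> \<dots> \<times> L\<^sub>r\<close> stays in that region.
\<close>

definition mellin_barnes_integrand ::
  "(complex \<Rightarrow> complex) \<Rightarrow> complex \<Rightarrow> ('r::finite \<Rightarrow> complex) \<Rightarrow> complex \<Rightarrow>
   ('r \<Rightarrow> complex) \<Rightarrow> complex \<Rightarrow> complex \<Rightarrow> ('r \<Rightarrow> complex) \<Rightarrow> complex" where
  "mellin_barnes_integrand \<Theta> \<alpha> \<beta> \<gamma> x b d s =
     (\<Prod>j\<in>UNIV. Gamma (\<beta> j - s j) * Gamma (s j) / Gamma (\<beta> j)) *
     (ext_beta \<Theta> b d (\<alpha> - (\<Sum>j\<in>UNIV. s j)) (\<gamma> - \<alpha>) / Beta \<alpha> (\<gamma> - \<alpha>)) *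
     (\<Prod>j\<in>UNIV. (- x j) powr (- s j))"

end

theory Submission
  imports Defs "HOL-Real_Asymp.Real_Asymp"
begin

text \<open>
  Insert the integral defining the extended beta factor on both sides.  On the left, summing under
  the integral sign gives \<open>\<Prod>\<^sub>j (1 - x\<^sub>j t) powr (-\<beta>\<^sub>j)\<close> by the binomial series.  On the right, the
  factor \<open>t powr (-s\<^sub>j)\<close> turns \<open>-x\<^sub>j\<close> into \<open>z = -x\<^sub>j t\<close>, and the same product appears because of Barnes'
  formula \<open>\<integral> \<Gamma>(\<beta>-s) \<Gamma>(s) z powr (-s) ds = 2\<pi>i \<Gamma>(\<beta>) (1+z) powr (-\<beta>)\<close>.

  As \<open>\<bar>z\<bar> < 1\<close>, the latter follows by moving the path to the line \<open>Re s = -N-1/2\<close> and letting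
  \<open>N \<rightarrow> \<infinity>\<close>.  The residues at \<open>0, -1, \<dots>, -N\<close> are the terms of the binomial series, and the integral
  over the line decays geometrically since \<open>F(s-1) = z (\<beta>-s)/(s-1) F(s)\<close> for the integrand \<open>F\<close>.
  To move an infinite path past poles, one subtracts from \<open>F\<close> translates of \<open>exp(w\<^sup>2)/w\<close> that cancel
  the poles in a strip: the difference has a primitive there.
\<close>

section \<open>Integrals along infinite paths in a strip\<close>

text \<open>The paths are arbitrary curves, possibly self-intersecting, and their two sides are
  defined by connectedness alone, so there is no closed contour and no explicit deformation to work
  with. What replaces them: on a convex strip a holomorphic function has a primitive, and if the
  function decays, the primitive has limits at both ends that do not depend on the path.

  Plain 1/w could not be subtracted from the integrand, because it does not decay; the factor
  exp(w^2) cures this and keeps the residue. The constant 2 pi i is found by applying the resulting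
  residue formula to pi / sin(pi s), whose integrals over Re s = 1/2 and Re s = -1/2 are elementary.

  Absolute convergence of Barnes' integral rests on
  \<open>z \<notin> \<real>\<^sub>\<le>\<^sub>0\<close>: the two Gamma factors decay at any rate
  below pi in |Im s|, while z powr (-s) grows at most at the rate |arg z|. For the interchange with
  the integral over t, let S be the sum of the suprema of Re s_j on the paths. Then the powers of t
  are bounded by t powr (-S), which leaves a majorant that is a product of a function of the path
  parameters and a function of t.\<close>

text \<open>The conditions on a Barnes path other than the separation of the poles.\<close>

definition strip_path :: "(real \<Rightarrow> complex) \<Rightarrow> bool" where
  "strip_path g \<longleftrightarrow>
     (\<forall>T>0. g piecewise_C1_differentiable_on {-T..T}) \<and>
     filterlim (\<lambda>t. Im (g t)) at_bot at_bot \<and>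
     filterlim (\<lambda>t. Im (g t)) at_top at_top \<and>
     bounded (range (\<lambda>t. Re (g t))) \<and>
     (\<forall>\<epsilon>>0. integrable lborel
        (\<lambda>t. exp (- \<epsilon> * \<bar>Im (g t)\<bar>) * norm (vector_derivative g (at t))))"

definition path_integrand :: "(real \<Rightarrow> complex) \<Rightarrow> (complex \<Rightarrow> complex) \<Rightarrow> real \<Rightarrow> complex" where
  "path_integrand g f t = f (g t) * vector_derivative g (at t)"

definition path_integral :: "(real \<Rightarrow> complex) \<Rightarrow> (complex \<Rightarrow> complex) \<Rightarrow> complex" where
  "path_integral g f = (LINT t|lborel. path_integrand g f t)"

section \<open>Topology and measurability of strip paths\<close>

lemma strip_path_piecewise:
  "strip_path g \<Longrightarrow> 0 < T \<Longrightarrow> g piecewise_C1_differentiable_on {-T..T}"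
  by (simp add: strip_path_def)

lemma strip_path_continuous:
  assumes "strip_path g"
  shows "continuous_on UNIV g"
proof -
  have "isCont g t" for t
  proof -
    have "g piecewise_C1_differentiable_on {-(\<bar>t\<bar>+1)..\<bar>t\<bar>+1}"
      using strip_path_piecewise[OF assms, of "\<bar>t\<bar>+1"] by simp
    then have "continuous_on {-(\<bar>t\<bar>+1)..\<bar>t\<bar>+1} g"
      by (simp add: piecewise_C1_differentiable_on_def)
    then have "continuous_on {-(\<bar>t\<bar>+1)<..<\<bar>t\<bar>+1} g"
      by (rule continuous_on_subset) auto
    then show ?thesis
      by (rule continuous_on_interior) auto
  qed
  then show ?thesis by (simp add: continuous_at_imp_continuous_on)
qed

text \<open>Each interval [-n-1, n+1] has finitely many exceptional points, so the derivative is
  continuous off a countable set. Countably many points do not affect measurability, whatever value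
  \<open>vector_derivative\<close> takes there.\<close>

lemma strip_path_derivative_measurable:
  assumes g: "strip_path g"
  shows "(\<lambda>t. vector_derivative g (at t)) \<in> borel_measurable borel"
proof -
  have "\<exists>S. finite S \<and> continuous_on ({- real (Suc n)..real (Suc n)} - S) (\<lambda>t. vector_derivative g (at t))" for n
    using strip_path_piecewise[OF g, of "real (Suc n)"]
    by (auto simp: piecewise_C1_differentiable_on_def C1_differentiable_on_eq)
  then obtain S where S: "\<And>n. finite (S n)"
    "\<And>n. continuous_on ({- real (Suc n)..real (Suc n)} - S n) (\<lambda>t. vector_derivative g (at t))"
    by metis
  define X where "X = (\<Union>n. S n)"
  have X: "countable X" unfolding X_def using S(1) by (intro countable_UN) (auto intro: countable_finite)
  have "continuous (at t within - X) (\<lambda>t. vector_derivative g (at t))" if t: "t \<in> - X" for t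
  proof -
    obtain n :: nat where n: "\<bar>t\<bar> < real n" using reals_Archimedean2 by blast
    have tin: "t \<in> - X \<inter> {- real n<..<real n}" using t n by (auto simp: abs_less_iff)
    have "continuous_on (- X \<inter> {- real n<..<real n}) (\<lambda>t. vector_derivative g (at t))"
      by (rule continuous_on_subset[OF S(2)[of n]]) (auto simp: X_def)
    then have "continuous (at t within (- X \<inter> {- real n<..<real n})) (\<lambda>t. vector_derivative g (at t))"
      using tin unfolding continuous_on_eq_continuous_within by blast
    moreover have "at t within (- X \<inter> {- real n<..<real n}) = at t within (- X)"
      using tin by (intro at_within_nhd[of t "{- real n<..<real n}"]) auto
    ultimately show ?thesis by simp
  qed
  then have "continuous_on (- X) (\<lambda>t. vector_derivative g (at t))"
    by (simp add: continuous_on_eq_continuous_within)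
  then have "(\<lambda>t. vector_derivative g (at t)) \<in> borel_measurable (restrict_space borel (- X))"
    by (rule borel_measurable_continuous_on_restrict)
  then show ?thesis
    by (rule measurable_restrict_countable[OF X, rotated -1]) simp_all
qed

text \<open>The imaginary part tends to infinity at both ends, so the path is a proper map. This
  makes its image closed and lets estimates at large height be completed by compactness.\<close>

lemma strip_path_Im_bounded_compact:
  assumes "strip_path g"
  shows "compact {t. \<bar>Im (g t)\<bar> \<le> Y}"
proof -
  have "\<forall>\<^sub>F t in at_top. Im (g t) > Y" "\<forall>\<^sub>F t in at_bot. Im (g t) < -Y"
    using assms unfolding strip_path_def
    by (auto intro: filterlim_at_top_dense[THEN iffD1, rule_format]
        filterlim_at_bot_dense[THEN iffD1, rule_format])
  then obtain a b where ab: "\<And>t. t \<ge> b \<Longrightarrow> Im (g t) > Y" "\<And>t. t \<le> a \<Longrightarrow> Im (g t) < -Y"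
    unfolding eventually_at_top_linorder eventually_at_bot_linorder by blast
  have "{t. \<bar>Im (g t)\<bar> \<le> Y} \<subseteq> {a..b}"
  proof
    fix t assume "t \<in> {t. \<bar>Im (g t)\<bar> \<le> Y}"
    then show "t \<in> {a..b}" using ab(1)[of t] ab(2)[of t] by (cases "t < a"; cases "t > b") auto
  qed
  then have "bounded {t. \<bar>Im (g t)\<bar> \<le> Y}" using bounded_closed_interval bounded_subset by blast
  moreover have "closed {t. \<bar>Im (g t)\<bar> \<le> Y}"
    by (intro closed_Collect_le continuous_intros strip_path_continuous[OF assms])
  ultimately show ?thesis by (simp add: compact_eq_bounded_closed)
qed

text \<open>Only the compact piece of the path at heights up to |Im w| + 1 can come within distance
  1 of \<open>w\<close>. Closedness makes the complement open, as the arguments on its components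
  and on distances to a pole require.\<close>

lemma strip_path_closed_range:
  assumes "strip_path g"
  shows "closed (range g)"
proof -
  have "closed (range g)" if "\<And>w. w \<notin> range g \<Longrightarrow> \<exists>e>0. ball w e \<inter> range g = {}"
  proof -
    have "open (- range g)"
      unfolding open_contains_ball using that by (metis ComplD Compl_iff disjoint_eq_subset_Compl)
    then show ?thesis by (simp add: closed_def)
  qed
  moreover have "\<exists>e>0. ball w e \<inter> range g = {}" if w: "w \<notin> range g" for w
  proof -
    define K where "K = g ` {t. \<bar>Im (g t)\<bar> \<le> \<bar>Im w\<bar> + 1}"
    have "compact K" unfolding K_def
      by (intro compact_continuous_image strip_path_Im_bounded_compact assms)
        (use strip_path_continuous[OF assms] continuous_on_subset in blast)
    then have "open (- K)" by (simp add: compact_imp_closed open_Compl)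
    moreover have "w \<in> - K" using w by (auto simp: K_def)
    ultimately obtain e where e: "e > 0" "ball w e \<subseteq> - K" by (meson open_contains_ball)
    have "ball w (min e 1) \<inter> range g = {}"
    proof (rule ccontr)
      assume "ball w (min e 1) \<inter> range g \<noteq> {}"
      then obtain t where t: "dist w (g t) < e" "dist w (g t) < 1" by auto
      have "\<bar>Im (w - g t)\<bar> < 1" using t(2) abs_Im_le_cmod[of "w - g t"] by (simp add: dist_norm)
      then have "g t \<in> K" by (auto simp: K_def)
      then show False using e t by auto
    qed
    then show ?thesis using e by (intro exI[of _ "min e 1"]) auto
  qed
  ultimately show ?thesis by blast
qed

section \<open>Convergence of path integrals and the fundamental theorem\<close>

lemma path_integrand_measurable:
  assumes "strip_path g" "continuous_on U f" "range g \<subseteq> U"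
  shows "path_integrand g f \<in> borel_measurable borel"
proof -
  have "continuous_on UNIV (\<lambda>t. f (g t))"
    by (rule continuous_on_compose2[OF assms(2) strip_path_continuous[OF assms(1)]]) (use assms in auto)
  then have [measurable]: "(\<lambda>t. f (g t)) \<in> borel_measurable borel" by (rule borel_measurable_continuous_onI)
  note [measurable] = strip_path_derivative_measurable[OF assms(1)]
  show ?thesis unfolding path_integrand_def by measurable
qed

lemma path_integrand_integrable_bound:
  assumes "strip_path g" "continuous_on U f" "range g \<subseteq> U" "0 < \<epsilon>"
    and "\<And>t. norm (f (g t)) \<le> C * exp (- \<epsilon> * \<bar>Im (g t)\<bar>)"
  shows "integrable lborel (path_integrand g f)"
proof (rule Bochner_Integration.integrable_bound)
  show "integrable lborel (\<lambda>t. C * (exp (- \<epsilon> * \<bar>Im (g t)\<bar>) * norm (vector_derivative g (at t))))"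
    using assms(1,4) unfolding strip_path_def by (intro integrable_mult_right) auto
  show "path_integrand g f \<in> borel_measurable lborel"
    using path_integrand_measurable[OF assms(1-3)] by simp
  have "norm (path_integrand g f t) \<le> C * (exp (- \<epsilon> * \<bar>Im (g t)\<bar>) * norm (vector_derivative g (at t)))" for t
    using mult_right_mono[OF assms(5), of "norm (vector_derivative g (at t))" t]
    by (simp add: path_integrand_def norm_mult mult_ac)
  then show "AE t in lborel. norm (path_integrand g f t) 
      \<le> norm (C * (exp (- \<epsilon> * \<bar>Im (g t)\<bar>) * norm (vector_derivative g (at t))))"
    by (smt (verit, ccfv_threshold) AE_I2 real_norm_def)
qed

text \<open>Bounds on the Gamma function are available only away from the real axis. The remaining
  parameters form a compact set, on which continuity gives a bound, and a larger constant covers the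
  whole path.\<close>

lemma strip_path_decay_global:
  fixes f :: "complex \<Rightarrow> complex"
  assumes "strip_path g" "continuous_on U f" "range g \<subseteq> U"
    and "\<And>s. s \<in> U \<Longrightarrow> Y \<le> \<bar>Im s\<bar> \<Longrightarrow> norm (f s) \<le> C * exp (- \<epsilon> * \<bar>Im s\<bar>)"
  obtains C' where "0 < C'" "\<And>t. norm (f (g t)) \<le> C' * exp (- \<epsilon> * \<bar>Im (g t)\<bar>)"
proof -
  have cont: "continuous_on UNIV (\<lambda>t. f (g t))"
    by (rule continuous_on_compose2[OF assms(2) strip_path_continuous[OF assms(1)]]) (use assms in auto)
  have "continuous_on {t. \<bar>Im (g t)\<bar> \<le> Y} (\<lambda>t. norm (f (g t)) * exp (\<epsilon> * \<bar>Im (g t)\<bar>))"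
    using continuous_on_subset[OF cont] continuous_on_subset[OF strip_path_continuous[OF assms(1)]]
    by (intro continuous_intros) auto
  then have "compact ((\<lambda>t. norm (f (g t)) * exp (\<epsilon> * \<bar>Im (g t)\<bar>)) ` {t. \<bar>Im (g t)\<bar> \<le> Y})"
    by (intro compact_continuous_image strip_path_Im_bounded_compact assms(1))
  then obtain B where B: "\<And>t. \<bar>Im (g t)\<bar> \<le> Y \<Longrightarrow> \<bar>norm (f (g t)) * exp (\<epsilon> * \<bar>Im (g t)\<bar>)\<bar> \<le> B"
    by (force simp: bounded_iff dest!: compact_imp_bounded)
  have "norm (f (g t)) \<le> (\<bar>B\<bar> + \<bar>C\<bar> + 1) * exp (- \<epsilon> * \<bar>Im (g t)\<bar>)" for t
  proof (cases "\<bar>Im (g t)\<bar> \<le> Y")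
    case True
    have "norm (f (g t)) = (norm (f (g t)) * exp (\<epsilon> * \<bar>Im (g t)\<bar>)) * exp (- \<epsilon> * \<bar>Im (g t)\<bar>)"
      by (simp add: mult.assoc flip: exp_add)
    also have "\<dots> \<le> (\<bar>B\<bar> + \<bar>C\<bar> + 1) * exp (- \<epsilon> * \<bar>Im (g t)\<bar>)"
      using B[OF True] by (intro mult_right_mono) auto
    finally show ?thesis .
  next
    case False
    then have "norm (f (g t)) \<le> C * exp (- \<epsilon> * \<bar>Im (g t)\<bar>)" using assms(3) by (intro assms(4)) auto
    also have "\<dots> \<le> (\<bar>B\<bar> + \<bar>C\<bar> + 1) * exp (- \<epsilon> * \<bar>Im (g t)\<bar>)"
      by (intro mult_right_mono) auto
    finally show ?thesis .
  qed
  then show ?thesis using that[of "\<bar>B\<bar> + \<bar>C\<bar> + 1"] by auto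
qed

lemma path_integral_FTC:
  assumes g: "strip_path g" and U: "open U" "range g \<subseteq> U"
    and F: "\<And>s. s \<in> U \<Longrightarrow> (F has_field_derivative f s) (at s)"
    and int: "integrable lborel (path_integrand g f)"
    and lim: "((\<lambda>t. F (g t)) \<longlongrightarrow> A) at_top" "((\<lambda>t. F (g t)) \<longlongrightarrow> B) at_bot"
  shows "path_integral g f = A - B"
proof -
  have fin: "(LINT t:{- real n..real n}|lborel. path_integrand g f t) = F (g n) - F (g (- real n))" 
    if "n > 0" for n :: nat
  proof -
    have "g piecewise_C1_differentiable_on {- real n..real n}"
      using strip_path_piecewise[OF g, of "real n"] that by simp
    then obtain S where S: "finite S" "g C1_differentiable_on ({- real n..real n} - S)" 
      by (auto simp: piecewise_C1_differentiable_on_def)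
    \<comment> \<open>At the finitely many points of \<open>S\<close>, where \<open>g\<close> may
      have corners, continuity of the primitive along the path is enough.\<close>
    have "(path_integrand g f has_integral (F (g n) - F (g (- real n)))) {- real n..real n}"
    proof (rule fundamental_theorem_of_calculus_interior_strong[OF S(1)])
      show "- real n \<le> real n" by simp
      have "isCont F s" if "s \<in> U" for s using F[OF that] DERIV_isCont by blast
      then have "continuous_on U F" by (simp add: continuous_at_imp_continuous_on)
      then show "continuous_on {- real n..real n} (\<lambda>t. F (g t))"
        by (rule continuous_on_compose2) (use U continuous_on_subset[OF strip_path_continuous[OF g]] in auto)
      fix t assume t: "t \<in> {- real n<..<real n} - S"
      then have "(g has_vector_derivative vector_derivative g (at t)) (at t)"
        using S(2) by (auto simp: C1_differentiable_on_eq vector_derivative_works)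
      then have "((F \<circ> g) has_vector_derivative (vector_derivative g (at t) * f (g t))) (at t)"
        by (rule field_vector_diff_chain_at) (use F U in auto)
      then show "((\<lambda>t. F (g t)) has_vector_derivative path_integrand g f t) (at t)"
        by (simp add: o_def path_integrand_def mult.commute)
    qed
    moreover have si: "set_integrable lborel {- real n..real n} (path_integrand g f)"
      unfolding set_integrable_def by (rule integrable_mult_indicator) (use int in auto)
    ultimately show ?thesis
      by (metis integral_unique set_borel_integral_eq_integral(2))
  qed
  \<comment> \<open>Integrability over the whole line turns the integral into the limit over
    [-n, n]; the norm of the integrand is itself the dominating function.\<close>
  have lim1: "(\<lambda>n. LINT t:{- real n..real n}|lborel. path_integrand g f t) \<longlonglongrightarrow> path_integral g f"
    unfolding path_integral_def set_lebesgue_integral_def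
  proof (rule integral_dominated_convergence[where w="\<lambda>t. norm (path_integrand g f t)"])
    show "AE t in lborel. (\<lambda>n. indicat_real {- real n..real n} t *\<^sub>R path_integrand g f t) \<longlonglongrightarrow> path_integrand g f t"
    proof (rule AE_I2)
      fix t
      obtain N :: nat where "\<bar>t\<bar> < real N" using reals_Archimedean2 by blast
      then have "\<forall>n\<ge>N. indicat_real {- real n..real n} t *\<^sub>R path_integrand g f t = path_integrand g f t"
        by (auto simp: indicator_def)
      then show "(\<lambda>n. indicat_real {- real n..real n} t *\<^sub>R path_integrand g f t) \<longlonglongrightarrow> path_integrand g f t"
        by (intro tendsto_eventually) (auto simp: eventually_sequentially)
    qed
    show "\<And>n. AE t in lborel. norm (indicat_real {- real n..real n} t *\<^sub>R path_integrand g f t) \<le> norm (path_integrand g f t)"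
      by (auto simp: indicator_def)
    show "(\<lambda>t. indicat_real {- real n..real n} t *\<^sub>R path_integrand g f t) \<in> borel_measurable lborel" for n
      using int by measurable
  qed (use int in auto)
  have lim2: "(\<lambda>n. F (g (real n)) - F (g (- real n))) \<longlonglongrightarrow> A - B"
  proof (intro tendsto_diff)
    show "(\<lambda>n. F (g (real n))) \<longlonglongrightarrow> A"
      by (rule filterlim_compose[OF lim(1) filterlim_real_sequentially])
    show "(\<lambda>n. F (g (- real n))) \<longlonglongrightarrow> B"
      by (rule filterlim_compose[OF lim(2) filterlim_compose[OF filterlim_uminus_at_bot_at_top filterlim_real_sequentially]])
  qed
  have ev: "\<forall>\<^sub>F n in sequentially. (LINT t:{- real n..real n}|lborel. path_integrand g f t) = F (g (real n)) - F (g (- real n))"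
    using eventually_gt_at_top[of "0::nat"] by eventually_elim (use fin in auto)
  show ?thesis
    by (rule LIMSEQ_unique[OF Lim_transform_eventually[OF lim1 ev] lim2])
qed

text \<open>The primitive is arctan(sinh(a t)) / a. The integral serves twice: 1 / cosh dominates
  exp(-\<epsilon> |t|), which makes vertical lines strip paths, and its exact value is the source of
  the constant 2 pi i.\<close>

lemma sech_integral:
  fixes a :: real
  assumes "0 < a"
  shows "has_bochner_integral lborel (\<lambda>t. 1 / cosh (a * t)) (pi / a)"
proof -
  let ?F = "\<lambda>t. arctan (sinh (a * t)) / a"
  have "((\<lambda>t. arctan (sinh (a * t)) / a) \<longlongrightarrow> (pi / 2) / a) at_top"
    by (intro tendsto_divide tendsto_const filterlim_compose[OF tendsto_arctan_at_top]
        filterlim_compose[OF sinh_real_at_top] filterlim_tendsto_pos_mult_at_top[OF tendsto_const assms filterlim_ident])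
       (use assms in auto)
  then have B: "((?F \<circ> real_of_ereal) \<longlongrightarrow> (pi / 2) / a) (at_left \<infinity>)"
    by (simp only: ereal_tendsto_simps1)
  have "((\<lambda>t. arctan (sinh (a * t)) / a) \<longlongrightarrow> (- (pi / 2)) / a) at_bot"
    by (intro tendsto_divide tendsto_const filterlim_compose[OF tendsto_arctan_at_bot]
        filterlim_compose[OF sinh_real_at_bot] filterlim_tendsto_pos_mult_at_bot[OF tendsto_const assms filterlim_ident])
       (use assms in auto)
  then have A: "((?F \<circ> real_of_ereal) \<longlongrightarrow> (- (pi / 2)) / a) (at_right (-\<infinity>))"
    by (simp only: ereal_tendsto_simps1)
  have D: "DERIV ?F t :> 1 / cosh (a * t)" for t
  proof -
    have "DERIV ?F t :> (inverse (1 + (sinh (a * t))\<^sup>2) * (cosh (a * t) * a)) / a"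
      using assms by (auto intro!: derivative_eq_intros)
    moreover have "1 + (sinh (a * t))\<^sup>2 = cosh (a * t) * cosh (a * t)"
      by (simp add: cosh_square_eq flip: power2_eq_square)
    ultimately show ?thesis using assms by (simp add: inverse_eq_divide)
  qed
  have C: "isCont (\<lambda>t. 1 / cosh (a * t)) t" for t
    by (intro continuous_intros) auto
  have *: "set_integrable lborel (einterval (-\<infinity>) \<infinity>) (\<lambda>t. 1 / cosh (a * t))"
    "(LBINT x=-\<infinity>..\<infinity>. 1 / cosh (a * x)) = (pi / 2) / a - (- (pi / 2)) / a"
    using D C A B
    by (intro interval_integral_FTC_nonneg[where F="?F"]; simp)+
  then show ?thesis
    by (simp add: has_bochner_integral_iff set_integrable_def interval_lebesgue_integral_def set_lebesgue_integral_def field_simps)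
qed

section \<open>Vertical lines\<close>

definition vline :: "real \<Rightarrow> real \<Rightarrow> complex" where
  "vline \<sigma> t = Complex \<sigma> t"

lemma vline_simps [simp]: "Re (vline \<sigma> t) = \<sigma>" "Im (vline \<sigma> t) = t"
  by (simp_all add: vline_def)

lemma vline_derivative: "(vline \<sigma> has_vector_derivative \<i>) (at t)"
  unfolding vline_def has_vector_derivative_complex_iff
  by (auto intro!: derivative_eq_intros)

lemma vector_derivative_vline [simp]: "vector_derivative (vline \<sigma>) (at t) = \<i>"
  using vline_derivative by (rule vector_derivative_at)

lemma path_integrand_vline: "path_integrand (vline \<sigma>) f t = f (vline \<sigma> t) * \<i>"
  by (simp add: path_integrand_def)

lemma integrable_exp_abs:
  assumes "0 < (\<epsilon>::real)"
  shows "integrable lborel (\<lambda>t. exp (- \<epsilon> * \<bar>t\<bar>))"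
proof (rule Bochner_Integration.integrable_bound)
  show "integrable lborel (\<lambda>t. 1 / cosh (\<epsilon> * t))"
    using sech_integral[OF assms] by (simp add: has_bochner_integral_iff)
  have "exp (- \<epsilon> * \<bar>t\<bar>) \<le> 1 / cosh (\<epsilon> * t)" for t
  proof -
    have "cosh (\<epsilon> * t) \<le> exp (\<epsilon> * \<bar>t\<bar>)"
      using assms by (cases "t \<ge> 0") (auto simp: cosh_def mult_nonneg_nonpos)
    then show ?thesis by (simp add: exp_minus field_simps cosh_real_pos)
  qed
  then show "AE t in lborel. norm (exp (- \<epsilon> * \<bar>t\<bar>)) \<le> norm (1 / cosh (\<epsilon> * t))"
    by (simp add: cosh_real_pos)
qed simp

lemma strip_path_vline: "strip_path (vline \<sigma>)"
  unfolding strip_path_def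
proof (intro conjI allI impI)
  fix T :: real
  have "vline \<sigma> C1_differentiable_on {- T..T}"
    using vline_derivative by (auto simp: C1_differentiable_on_def intro!: exI[of _ "\<lambda>_. \<i>"])
  then show "vline \<sigma> piecewise_C1_differentiable_on {- T..T}"
    by (rule C1_differentiable_imp_piecewise)
qed (use integrable_exp_abs in \<open>auto simp: filterlim_ident\<close>)

text \<open>Going up a vertical line from height y, the primitive moves by at most the tail integral
  of C exp(-\<epsilon> y); across the strip it moves by at most the width times the bound at that
  height. So it approaches one and the same limit everywhere in the strip.\<close>

lemma strip_primitive_limit:
  fixes P H :: "complex \<Rightarrow> complex"
  assumes P: "\<And>s. a < Re s \<Longrightarrow> Re s < b \<Longrightarrow> (P has_field_derivative H s) (at s)"
    and H: "\<And>s. a < Re s \<Longrightarrow> Re s < b \<Longrightarrow> Y \<le> Im s \<Longrightarrow> norm (H s) \<le> C * exp (- \<epsilon> * Im s)"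
    and ab: "a < b" and \<epsilon>: "0 < \<epsilon>"
  obtains L K where "\<And>s. a < Re s \<Longrightarrow> Re s < b \<Longrightarrow> Y \<le> Im s \<Longrightarrow> norm (P s - L) \<le> K * exp (- \<epsilon> * Im s)"
proof -
  \<comment> \<open>The limit is taken along the midline; any other point is compared with the point
    of the midline at its own height.\<close>
  define c where "c = (a + b) / 2"
  have c: "a < c" "c < b" using ab by (auto simp: c_def)
  have "0 \<le> norm (H (Complex c Y))" by simp
  also have "\<dots> \<le> C * exp (- \<epsilon> * Y)" using H[of "Complex c Y"] c by simp
  finally have C0: "0 \<le> C" by (simp add: zero_le_mult_iff)
  have vert: "norm (P (Complex c y') - P (Complex c y)) \<le> C / \<epsilon> * exp (- \<epsilon> * y)"
    if y: "Y \<le> y" "y \<le> y'" for y y'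
  proof (cases "y = y'")
    case True then show ?thesis using C0 \<epsilon> by simp
  next
    case False
    have d: "((\<lambda>y. P (Complex c y)) has_vector_derivative (\<i> * H (Complex c x))) (at x)" for x
    proof -
      have "((P \<circ> vline c) has_vector_derivative (\<i> * H (vline c x))) (at x)"
        by (rule field_vector_diff_chain_at[OF vline_derivative]) (use P[of "vline c x"] c in auto)
      then show ?thesis by (simp add: o_def vline_def)
    qed
    then have cont: "continuous_on {y..y'} (\<lambda>y. P (Complex c y))"
      by (meson continuous_at_imp_continuous_on has_vector_derivative_continuous)
    have "norm (P (Complex c y') - P (Complex c y)) \<le> - (C / \<epsilon>) * exp (- \<epsilon> * y') - - (C / \<epsilon>) * exp (- \<epsilon> * y)"
    proof (rule differentiable_bound_general[where f'="\<lambda>x. \<i> * H (Complex c x)" and \<phi>'="\<lambda>x. C * exp (- \<epsilon> * x)"])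
      show "y < y'" using False y by simp
      show "continuous_on {y..y'} (\<lambda>x. - (C / \<epsilon>) * exp (- \<epsilon> * x))" by (intro continuous_intros)
      show "((\<lambda>x. - (C / \<epsilon>) * exp (- \<epsilon> * x)) has_vector_derivative C * exp (- \<epsilon> * x)) (at x)" for x
        using \<epsilon> by (auto simp flip: has_real_derivative_iff_has_vector_derivative intro!: derivative_eq_intros)
      show "norm (\<i> * H (Complex c x)) \<le> C * exp (- \<epsilon> * x)" if "y < x" for x
        using H[of "Complex c x"] c that y by (simp add: norm_mult)
    qed (use d cont in auto)
    also have "\<dots> \<le> C / \<epsilon> * exp (- \<epsilon> * y)" using C0 \<epsilon> by simp
    finally show ?thesis .
  qed
  have horiz: "norm (P s - P (Complex c (Im s))) \<le> C * (b - a) * exp (- \<epsilon> * Im s)"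
    if s: "a < Re s" "Re s < b" "Y \<le> Im s" for s
  proof -
    let ?S = "{w. a < Re w \<and> Re w < b \<and> Im w = Im s}"
    have eq: "?S = ({w. a < Re w} \<inter> {w. Re w < b}) \<inter> ({w. Im w \<le> Im s} \<inter> {w. Im w \<ge> Im s})" by auto
    have "convex ?S"
      unfolding eq by (intro convex_Int convex_halfspace_Re_gt convex_halfspace_Re_lt 
          convex_halfspace_Im_le convex_halfspace_Im_ge)
    moreover have "(P has_field_derivative H w) (at w within ?S)" if "w \<in> ?S" for w
      using that by (intro has_field_derivative_at_within[OF P]) auto
    moreover have "norm (H w) \<le> C * exp (- \<epsilon> * Im s)" if "w \<in> ?S" for w
      using H[of w] that s by auto
    ultimately have "norm (P s - P (Complex c (Im s))) \<le> C * exp (- \<epsilon> * Im s) * norm (s - Complex c (Im s))"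
      using s c by (intro field_differentiable_bound[of ?S P H]) auto
    also have "norm (s - Complex c (Im s)) = \<bar>Re s - c\<bar>" by (simp add: cmod_def)
    also have "C * exp (- \<epsilon> * Im s) * \<bar>Re s - c\<bar> \<le> C * exp (- \<epsilon> * Im s) * (b - a)"
      using s c C0 by (intro mult_left_mono) auto
    finally show ?thesis by (simp add: mult_ac)
  qed
  have "Cauchy (\<lambda>n. P (Complex c (real n)))"
  proof (rule metric_CauchyI)
    fix e :: real assume e: "0 < e"
    have "(\<lambda>n. C / \<epsilon> * exp (- \<epsilon> * real n)) \<longlonglongrightarrow> 0"
      using \<epsilon> by real_asymp
    then have "\<forall>\<^sub>F n in sequentially. C / \<epsilon> * exp (- \<epsilon> * real n) < e / 2"
      using e by (intro order_tendstoD) auto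
    moreover have "\<forall>\<^sub>F n in sequentially. Y \<le> real n" by real_asymp
    ultimately have "\<forall>\<^sub>F n in sequentially. C / \<epsilon> * exp (- \<epsilon> * real n) < e / 2 \<and> Y \<le> real n"
      by (rule eventually_conj)
    then obtain N where N: "C / \<epsilon> * exp (- \<epsilon> * real N) < e / 2" "Y \<le> real N"
      by (auto simp: eventually_sequentially)
    have close: "dist (P (Complex c (real n))) (P (Complex c (real N))) < e / 2" if "n \<ge> N" for n
    proof -
      have "dist (P (Complex c (real n))) (P (Complex c (real N))) \<le> C / \<epsilon> * exp (- \<epsilon> * real N)"
        unfolding dist_norm by (rule vert) (use N that in auto)
      then show ?thesis using N(1) by linarith
    qed
    have "dist (P (Complex c (real m))) (P (Complex c (real n))) < e" if "m \<ge> N" "n \<ge> N" for m n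
      by (rule dist_triangle_half_l[OF close[OF that(1)] close[OF that(2)]])
    then show "\<exists>M. \<forall>m\<ge>M. \<forall>n\<ge>M. dist (P (Complex c (real m))) (P (Complex c (real n))) < e" by blast
  qed
  then obtain L where L: "(\<lambda>n. P (Complex c (real n))) \<longlonglongrightarrow> L"
    using Cauchy_convergent_iff convergent_def by blast
  have "norm (P s - L) \<le> (C / \<epsilon> + C * (b - a)) * exp (- \<epsilon> * Im s)"
    if s: "a < Re s" "Re s < b" "Y \<le> Im s" for s
  proof -
    have "norm (L - P (Complex c (Im s))) \<le> C / \<epsilon> * exp (- \<epsilon> * Im s)"
    proof (rule tendsto_upperbound)
      show "(\<lambda>n. norm (P (Complex c (real n)) - P (Complex c (Im s)))) \<longlonglongrightarrow> norm (L - P (Complex c (Im s)))"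
        by (intro tendsto_intros L)
      have "\<forall>\<^sub>F n in sequentially. Im s \<le> real n" by real_asymp
      then show "\<forall>\<^sub>F n in sequentially. norm (P (Complex c (real n)) - P (Complex c (Im s))) \<le> C / \<epsilon> * exp (- \<epsilon> * Im s)"
        by eventually_elim (use vert s in auto)
    qed simp
    then have "norm (P s - L) \<le> C * (b - a) * exp (- \<epsilon> * Im s) + C / \<epsilon> * exp (- \<epsilon> * Im s)"
      using horiz[OF s] norm_triangle_le[of "P s - P (Complex c (Im s))" "P (Complex c (Im s)) - L"]
      by (simp add: norm_minus_commute)
    then show ?thesis by (simp add: algebra_simps)
  qed
  then show ?thesis by (rule that)
qed

text \<open>The order of the quantifiers matters: \<open>A\<close> and \<open>B\<close> are fixed
  before the path, so any two paths in the strip share them.\<close>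

lemma strip_path_limits:
  fixes P H :: "complex \<Rightarrow> complex"
  assumes P: "\<And>s. a < Re s \<Longrightarrow> Re s < b \<Longrightarrow> (P has_field_derivative H s) (at s)"
    and H: "\<And>s. a < Re s \<Longrightarrow> Re s < b \<Longrightarrow> Y \<le> \<bar>Im s\<bar> \<Longrightarrow> norm (H s) \<le> C * exp (- \<epsilon> * \<bar>Im s\<bar>)"
    and ab: "a < b" and \<epsilon>: "0 < \<epsilon>"
  obtains A B where
    "\<And>g. strip_path g \<Longrightarrow> (\<And>t. a < Re (g t) \<and> Re (g t) < b) \<Longrightarrow> ((\<lambda>t. P (g t)) \<longlongrightarrow> A) at_top"
    "\<And>g. strip_path g \<Longrightarrow> (\<And>t. a < Re (g t) \<and> Re (g t) < b) \<Longrightarrow> ((\<lambda>t. P (g t)) \<longlongrightarrow> B) at_bot"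
proof -
  \<comment> \<open>At heights above max Y 0 the bound in |Im s| is a bound in Im s. The lower end
    is treated by reflecting s to -s.\<close>
  define Y' where "Y' = max Y 0"
  have H1: "norm (H s) \<le> C * exp (- \<epsilon> * Im s)" if "a < Re s" "Re s < b" "Y' \<le> Im s" for s
    using H[of s] that by (simp add: Y'_def)
  obtain A K where A: "\<And>s. a < Re s \<Longrightarrow> Re s < b \<Longrightarrow> Y' \<le> Im s \<Longrightarrow> norm (P s - A) \<le> K * exp (- \<epsilon> * Im s)"
    by (rule strip_primitive_limit[of a b P H Y' C \<epsilon>, OF P H1]) (use ab \<epsilon> in auto)
  have P2: "((\<lambda>s. P (- s)) has_field_derivative (- H (- s))) (at s)" if "- b < Re s" "Re s < - a" for s
  proof -
    have "(P has_field_derivative H (- s)) (at (- s))" using P[of "-s"] that by simp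
    moreover have "(uminus has_field_derivative (-1)) (at s)" by (auto intro!: derivative_eq_intros)
    ultimately have "((\<lambda>s. P (- s)) has_field_derivative H (- s) * (- 1)) (at s)" by (rule DERIV_chain2)
    then show ?thesis by simp
  qed
  have H2: "norm (- H (- s)) \<le> C * exp (- \<epsilon> * Im s)" if "- b < Re s" "Re s < - a" "Y' \<le> Im s" for s
    using H[of "-s"] that by (simp add: Y'_def)
  obtain B K' where B: "\<And>s. - b < Re s \<Longrightarrow> Re s < - a \<Longrightarrow> Y' \<le> Im s \<Longrightarrow> norm (P (- s) - B) \<le> K' * exp (- \<epsilon> * Im s)"
    by (rule strip_primitive_limit[of "-b" "-a" "\<lambda>s. P (- s)" "\<lambda>s. - H (- s)" Y' C \<epsilon>, OF P2 H2]) (use ab \<epsilon> in auto)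
  show ?thesis
  proof (rule that)
    fix g assume g: "strip_path g" "\<And>t. a < Re (g t) \<and> Re (g t) < b"
    have top: "filterlim (\<lambda>t. Im (g t)) at_top at_top" and bot: "filterlim (\<lambda>t. - Im (g t)) at_top at_bot"
      using g(1) by (auto simp: strip_path_def filterlim_uminus_at_bot)
    have ex: "((\<lambda>x. k * exp (- \<epsilon> * x)) \<longlongrightarrow> 0) at_top" for k using \<epsilon> by real_asymp
    have "((\<lambda>t. P (g t) - A) \<longlongrightarrow> 0) at_top"
    proof (rule Lim_null_comparison)
      show "((\<lambda>t. K * exp (- \<epsilon> * Im (g t))) \<longlongrightarrow> 0) at_top" by (rule filterlim_compose[OF ex top])
      have "\<forall>\<^sub>F t in at_top. Y' \<le> Im (g t)" using top by (simp add: filterlim_at_top)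
      then show "\<forall>\<^sub>F t in at_top. norm (P (g t) - A) \<le> K * exp (- \<epsilon> * Im (g t))"
        by eventually_elim (use A g in auto)
    qed
    then show "((\<lambda>t. P (g t)) \<longlongrightarrow> A) at_top" by (simp add: LIM_zero_iff)
    have "((\<lambda>t. P (g t) - B) \<longlongrightarrow> 0) at_bot"
    proof (rule Lim_null_comparison)
      show "((\<lambda>t. K' * exp (- \<epsilon> * (- Im (g t)))) \<longlongrightarrow> 0) at_bot" by (rule filterlim_compose[OF ex bot])
      have "\<forall>\<^sub>F t in at_bot. Y' \<le> - Im (g t)" using bot by (simp add: filterlim_at_top)
      then show "\<forall>\<^sub>F t in at_bot. norm (P (g t) - B) \<le> K' * exp (- \<epsilon> * (- Im (g t)))"
        by eventually_elim (use B[of "- g _"] g in auto)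
    qed
    then show "((\<lambda>t. P (g t)) \<longlongrightarrow> B) at_bot" by (simp add: LIM_zero_iff)
  qed
qed

section \<open>Independence of the path within a strip\<close>

lemma open_strip: "open {s. a < Re s \<and> Re s < b}" and convex_strip: "convex {s. a < Re s \<and> Re s < b}"
proof -
  have eq: "{s. a < Re s \<and> Re s < b} = {w. a < Re w} \<inter> {w. Re w < b}" by auto
  show "open {s. a < Re s \<and> Re s < b}" unfolding eq by (intro open_Int open_halfspace_Re_gt open_halfspace_Re_lt)
  show "convex {s. a < Re s \<and> Re s < b}" unfolding eq by (intro convex_Int convex_halfspace_Re_gt convex_halfspace_Re_lt)
qed

text \<open>Both integrals equal the difference of the two end limits of one primitive. No
  deformation of one path into the other is constructed, so the paths may wind and cross
  freely.\<close>

lemma path_integral_strip_indep: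
  assumes hol: "H holomorphic_on {s. a < Re s \<and> Re s < b}"
    and H: "\<And>s. a < Re s \<Longrightarrow> Re s < b \<Longrightarrow> Y \<le> \<bar>Im s\<bar> \<Longrightarrow> norm (H s) \<le> C * exp (- \<epsilon> * \<bar>Im s\<bar>)"
    and \<epsilon>: "0 < \<epsilon>"
    and g1: "strip_path g1" "\<And>t. a < Re (g1 t) \<and> Re (g1 t) < b"
    and g2: "strip_path g2" "\<And>t. a < Re (g2 t) \<and> Re (g2 t) < b"
  shows "path_integral g1 H = path_integral g2 H"
proof -
  let ?S = "{s. a < Re s \<and> Re s < b}"
  have ab: "a < b" using g1(2)[of 0] by linarith
  obtain P where P: "\<And>s. s \<in> ?S \<Longrightarrow> (P has_field_derivative H s) (at s within ?S)"
    using holomorphic_convex_primitive'[OF convex_strip open_strip hol] by blast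
  then have P': "(P has_field_derivative H s) (at s)" if "a < Re s" "Re s < b" for s
    using that open_strip[of a b] P[of s] by (simp add: at_within_open[of s ?S])
  obtain A B where AB: 
    "\<And>g. strip_path g \<Longrightarrow> (\<And>t. a < Re (g t) \<and> Re (g t) < b) \<Longrightarrow> ((\<lambda>t. P (g t)) \<longlongrightarrow> A) at_top"
    "\<And>g. strip_path g \<Longrightarrow> (\<And>t. a < Re (g t) \<and> Re (g t) < b) \<Longrightarrow> ((\<lambda>t. P (g t)) \<longlongrightarrow> B) at_bot"
    using strip_path_limits[of a b P H, OF P' H ab \<epsilon>] by blast
  have "path_integral g H = A - B" if g: "strip_path g" "\<And>t. a < Re (g t) \<and> Re (g t) < b" for g
  proof (rule path_integral_FTC[OF g(1) open_strip[of a b]])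
    show rg: "range g \<subseteq> ?S" using g by auto
    have cont: "continuous_on ?S H" using hol by (rule holomorphic_on_imp_continuous_on)
    obtain C' where "\<And>t. norm (H (g t)) \<le> C' * exp (- \<epsilon> * \<bar>Im (g t)\<bar>)"
      by (rule strip_path_decay_global[OF g(1) cont rg, of Y C \<epsilon>]) (use H in auto)
    then show "integrable lborel (path_integrand g H)"
      by (rule path_integrand_integrable_bound[OF g(1) cont rg \<epsilon>])
  qed (use P' AB g in auto)
  then show ?thesis using g1 g2 by metis
qed

section \<open>Decay of the Gamma function on vertical strips\<close>

text \<open>Moving a point of the right half-plane to the right lowers the ratio of its modulus to
  its real part. Applied to each factor in Euler's limit formula, this makes |Gamma(u + i v)| /
  Gamma(u) nondecreasing in u > 0, so a bound on one vertical line carries over to the lines on its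
  left.\<close>

lemma norm_Gamma_shift_le:
  fixes w :: complex
  assumes w: "0 < Re w" and a: "0 \<le> a"
  shows "norm (Gamma w) * Gamma (Re w + a) \<le> Gamma (Re w) * norm (Gamma (w + of_real a))"
proof -
  let ?u = "Re w"
  have le: "norm (Gamma_series w n) * Gamma_series (?u + a) n
      \<le> Gamma_series ?u n * norm (Gamma_series (w + of_real a) n)" if n: "n > 0" for n
  proof -
    have fac: "norm (w + of_real a + of_nat k) * (?u + real k) \<le> (?u + a + real k) * norm (w + of_nat k)" for k
    proof -
      have "norm (w + of_real a + of_nat k) \<le> norm (w + of_nat k) + norm (of_real a :: complex)"
        using norm_triangle_ineq[of "w + of_nat k" "of_real a"] by (simp add: add_ac)
      moreover have "?u + real k \<le> norm (w + of_nat k)" using complex_Re_le_cmod[of "w + of_nat k"] by simp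
      ultimately have "norm (w + of_real a + of_nat k) * (?u + real k) 
          \<le> (norm (w + of_nat k) + a) * (?u + real k)"
        and "a * (?u + real k) \<le> a * norm (w + of_nat k)"
        using w a by (auto intro!: mult_right_mono mult_left_mono)
      then show ?thesis by (simp add: algebra_simps)
    qed
    have pos: "0 < norm (w + of_nat k)" "0 < norm (w + of_real a + of_nat k)" "0 < ?u + real k" "0 < ?u + a + real k" for k
      using w a by (auto simp: complex_eq_iff add_pos_nonneg intro!: add_pos_nonneg)
    have "(\<Prod>k<Suc n. norm (w + of_real a + of_nat k) * (?u + real k)) 
        \<le> (\<Prod>k<Suc n. (?u + a + real k) * norm (w + of_nat k))"
      by (rule prod_mono) (use fac w in auto)
    then have *: "norm (pochhammer (w + of_real a) (Suc n)) * pochhammer ?u (Suc n)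
        \<le> pochhammer (?u + a) (Suc n) * norm (pochhammer w (Suc n))"
      unfolding pochhammer_prod by (simp add: prod_norm prod.distrib norm_mult atLeast0LessThan)
    have pp: "0 < pochhammer ?u (Suc n)" "0 < pochhammer (?u + a) (Suc n)" 
      "0 < norm (pochhammer w (Suc n))" "0 < norm (pochhammer (w + of_real a) (Suc n))"
      using w a pos by (auto simp: pochhammer_prod intro!: prod_pos) (auto simp: prod_pos)
    have "norm (Gamma_series w n) * Gamma_series (?u + a) n = 
        (fact n * exp (?u * ln n)) * (fact n * exp ((?u + a) * ln n)) 
          / (pochhammer (?u + a) (Suc n) * norm (pochhammer w (Suc n)))"
      by (simp add: Gamma_series_def norm_mult norm_divide field_simps norm_exp_eq_Re)
    also have "\<dots> \<le> (fact n * exp (?u * ln n)) * (fact n * exp ((?u + a) * ln n)) 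
          / (norm (pochhammer (w + of_real a) (Suc n)) * pochhammer ?u (Suc n))"
      using * pp by (intro divide_left_mono mult_nonneg_nonneg mult_pos_pos) auto
    also have "\<dots> = Gamma_series ?u n * norm (Gamma_series (w + of_real a) n)"
      by (simp add: Gamma_series_def norm_mult norm_divide field_simps norm_exp_eq_Re)
    finally show ?thesis .
  qed
  show ?thesis
  proof (rule LIMSEQ_le)
    show "(\<lambda>n. norm (Gamma_series w n) * Gamma_series (?u + a) n) \<longlonglongrightarrow> norm (Gamma w) * Gamma (?u + a)"
      by (intro tendsto_intros Gamma_series_LIMSEQ)
    show "(\<lambda>n. Gamma_series ?u n * norm (Gamma_series (w + of_real a) n)) \<longlonglongrightarrow> Gamma ?u * norm (Gamma (w + of_real a))"
      by (intro tendsto_intros Gamma_series_LIMSEQ)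
    show "\<exists>N. \<forall>n\<ge>N. norm (Gamma_series w n) * Gamma_series (?u + a) n
      \<le> Gamma_series ?u n * norm (Gamma_series (w + of_real a) n)"
      using le by (intro exI[of _ 1]) auto
  qed
qed

text \<open>For w = 1/2 + i v the point 1 - w is the conjugate of w, so the reflection formula gives
  |Gamma(w)|^2 = pi / cosh(pi v) exactly; cosh is then bounded below by half an exponential.\<close>

lemma norm_Gamma_half_le:
  "norm (Gamma (1/2 + \<i> * of_real v)) \<le> sqrt (2 * pi) * exp (- (pi / 2) * \<bar>v\<bar>)"
proof -
  let ?w = "1/2 + \<i> * of_real v"
  have "norm (Gamma ?w) ^ 2 = norm (Gamma ?w) * norm (cnj (Gamma ?w))"
    by (simp add: power2_eq_square)
  also have "cnj (Gamma ?w) = Gamma (cnj ?w)" by (rule cnj_Gamma)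
  also have "cnj ?w = 1 - ?w" by (simp add: complex_eq_iff)
  also have "norm (Gamma ?w) * norm (Gamma (1 - ?w)) = norm (of_real pi / sin (of_real pi * ?w))"
    by (simp only: Gamma_reflection_complex flip: norm_mult)
  also have "sin (of_real pi * ?w) = cosh (of_real (pi * v))"
    by (simp add: distrib_left sin_add cosh_conv_cos mult_ac sin_of_real cos_of_real flip: of_real_divide)
  also have "norm (of_real pi / cosh (of_real (pi * v) :: complex)) = pi / cosh (pi * v)"
  proof -
    have "cosh (of_real (pi * v) :: complex) = of_real (cosh (pi * v))"
      by (simp add: cosh_def scaleR_conv_of_real exp_of_real flip: of_real_mult of_real_minus)
    then show ?thesis by (simp add: norm_divide cosh_real_pos)
  qed
  also have "\<dots> \<le> pi / (exp (pi * \<bar>v\<bar>) / 2)"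
  proof (intro divide_left_mono)
    show "exp (pi * \<bar>v\<bar>) / 2 \<le> cosh (pi * v)"
      by (cases "v \<ge> 0") (auto simp: cosh_def)
  qed auto
  also have "\<dots> = (sqrt (2 * pi) * exp (- (pi / 2) * \<bar>v\<bar>)) ^ 2"
    by (simp add: power_mult_distrib field_simps flip: exp_double exp_minus)
       (simp add: exp_minus field_simps)
  finally show ?thesis
    by (rule power2_le_imp_le) auto
qed

text \<open>A linear factor costs an arbitrarily small part \<eta> of an exponential rate. This is
  why the decay of Gamma is stated for every rate below pi / 2 and not for pi / 2 itself.\<close>

lemma affine_le_exp:
  fixes c x \<eta> :: real
  assumes "0 < \<eta>" "0 \<le> c" "0 \<le> x"
  shows "c + x \<le> (c + 1 / \<eta>) * exp (\<eta> * x)"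
proof -
  have "\<eta> * x \<le> exp (\<eta> * x)" using exp_ge_add_one_self[of "\<eta> * x"] by linarith
  then have "x \<le> exp (\<eta> * x) / \<eta>"
    using assms(1) by (simp add: pos_le_divide_eq mult.commute)
  moreover have "c * 1 \<le> c * exp (\<eta> * x)" using assms by (intro mult_left_mono) auto
  ultimately show ?thesis by (simp add: algebra_simps)
qed

text \<open>A shift to the line Re s = 3/2 reduces the claim to Gamma(3/2 + i v) = (1/2 + i v)
  Gamma(1/2 + i v), that is, to the bound on the line Re s = 1/2 and a linear factor. Width 1 is
  what the functional equation needs in order to extend the strip.\<close>

lemma Gamma_decay_base:
  assumes "\<theta> < pi / 2"
  obtains C where "0 < C"
    "\<And>s. 1/2 \<le> Re s \<Longrightarrow> Re s \<le> 3/2 \<Longrightarrow> norm (Gamma s) \<le> C * exp (- \<theta> * \<bar>Im s\<bar>)"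
proof -
  have "continuous_on {1/2..3/2::real} Gamma"
    by (intro continuous_intros) auto
  then have "compact (Gamma ` {1/2..3/2::real})" by (intro compact_continuous_image) auto
  then obtain B where B: "\<And>u::real. 1/2 \<le> u \<Longrightarrow> u \<le> 3/2 \<Longrightarrow> \<bar>Gamma u\<bar> \<le> B"
    by (force simp: bounded_iff dest!: compact_imp_bounded)
  then have B0: "0 \<le> B" using B[of 1] by auto
  \<comment> \<open>The gap to pi / 2 pays for the linear factor.\<close>
  define \<eta> where "\<eta> = pi / 2 - \<theta>"
  have \<eta>: "\<eta> > 0" using assms by (simp add: \<eta>_def)
  have G: "Gamma (3/2::real) > 0" by (rule Gamma_real_pos) auto
  define C where "C = B / Gamma (3/2) * ((1/2 + 1 / \<eta>) * sqrt (2 * pi))"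
  have "norm (Gamma s) \<le> (C + 1) * exp (- \<theta> * \<bar>Im s\<bar>)" if s: "1/2 \<le> Re s" "Re s \<le> 3/2" for s
  proof -
    let ?w = "1/2 + \<i> * of_real (Im s)"
    have "s + of_real (3/2 - Re s) = ?w + 1" by (simp add: complex_eq_iff)
    moreover have "?w \<notin> \<int>\<^sub>\<le>\<^sub>0" by (auto elim!: nonpos_Ints_cases simp: complex_eq_iff)
    ultimately have "Gamma (s + of_real (3/2 - Re s)) = ?w * Gamma ?w"
      by (metis Gamma_plus1)
    then have "norm (Gamma s) * Gamma (3/2) \<le> Gamma (Re s) * (norm ?w * norm (Gamma ?w))"
      using norm_Gamma_shift_le[of s "3/2 - Re s"] s by (simp add: norm_mult)
    also have "\<dots> \<le> B * (((1/2 + 1 / \<eta>) * exp (\<eta> * \<bar>Im s\<bar>)) * (sqrt (2 * pi) * exp (- (pi / 2) * \<bar>Im s\<bar>)))"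
    proof (intro mult_mono norm_Gamma_half_le mult_nonneg_nonneg)
      show "Gamma (Re s) \<le> B" using B[of "Re s"] s by auto
      have "norm ?w \<le> 1/2 + \<bar>Im s\<bar>" using cmod_le[of ?w] by simp
      also have "\<dots> \<le> (1/2 + 1 / \<eta>) * exp (\<eta> * \<bar>Im s\<bar>)" by (rule affine_le_exp) (use \<eta> in auto)
      finally show "norm ?w \<le> (1/2 + 1 / \<eta>) * exp (\<eta> * \<bar>Im s\<bar>)" .
    qed (use B0 \<eta> in auto)
    also have "\<dots> = B * ((1/2 + 1 / \<eta>) * sqrt (2 * pi)) * exp (- \<theta> * \<bar>Im s\<bar>)"
      by (simp add: \<eta>_def algebra_simps flip: exp_add)
    finally have "norm (Gamma s) \<le> C * exp (- \<theta> * \<bar>Im s\<bar>)"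
      using G by (simp add: C_def field_simps)
    also have "\<dots> \<le> (C + 1) * exp (- \<theta> * \<bar>Im s\<bar>)" by (intro mult_right_mono) auto
    finally show ?thesis .
  qed
  moreover have "C + 1 > 0" using B0 G \<eta> by (auto simp: C_def intro!: add_nonneg_pos mult_nonneg_nonneg divide_nonneg_pos)
  ultimately show ?thesis using that by blast
qed

text \<open>The functional equation widens the strip by one on each side. To the left one divides by
  s, which has modulus at least 1 as |Im s| \<ge> 1; to the right one multiplies by s - 1, which
  costs a little of the rate. Hence \<theta> varies in the induction.\<close>

lemma Gamma_decay_strip_nat:
  "\<theta> < pi / 2 \<Longrightarrow> \<exists>C>0. \<forall>s. 1/2 - real n \<le> Re s \<longrightarrow> Re s \<le> 3/2 + real n \<longrightarrow> 1 \<le> \<bar>Im s\<bar> \<longrightarrow>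
     norm (Gamma s) \<le> C * exp (- \<theta> * \<bar>Im s\<bar>)"
proof (induction n arbitrary: \<theta>)
  case 0
  then show ?case using Gamma_decay_base[of \<theta>] by (metis add.right_neutral diff_zero of_nat_0)
next
  case (Suc n)
  \<comment> \<open>Half of the gap, so that the induction hypothesis applies at the rate \<theta> +
    \<eta>, still below pi / 2.\<close>
  define \<eta> where "\<eta> = (pi / 2 - \<theta>) / 2"
  have \<eta>: "\<eta> > 0" "\<theta> + \<eta> < pi / 2" using Suc.prems by (simp_all add: \<eta>_def field_simps)
  obtain C where C: "C > 0" "\<And>s. 1/2 - real n \<le> Re s \<Longrightarrow> Re s \<le> 3/2 + real n \<Longrightarrow> 1 \<le> \<bar>Im s\<bar> \<Longrightarrow>
     norm (Gamma s) \<le> C * exp (- (\<theta> + \<eta>) * \<bar>Im s\<bar>)"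
    using Suc.IH[OF \<eta>(2)] by blast
  define D where "D = real n + 3/2 + 1 / \<eta>"
  have D: "D \<ge> 1" using \<eta> by (simp add: D_def add_increasing2)
  have "norm (Gamma s) \<le> D * C * exp (- \<theta> * \<bar>Im s\<bar>)"
    if s: "1/2 - real (Suc n) \<le> Re s" "Re s \<le> 3/2 + real (Suc n)" "1 \<le> \<bar>Im s\<bar>" for s
  proof -
    have nz: "w \<notin> \<int>\<^sub>\<le>\<^sub>0" if "Im w = Im s" for w
      using s(3) that by (auto elim!: nonpos_Ints_cases)
    have ex: "exp (- (\<theta> + \<eta>) * \<bar>Im s\<bar>) \<le> exp (- \<theta> * \<bar>Im s\<bar>)" 
      using \<eta> by (auto simp: algebra_simps)
    have one: "C * exp (- (\<theta> + \<eta>) * \<bar>Im s\<bar>) \<le> D * C * exp (- \<theta> * \<bar>Im s\<bar>)"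
    proof -
      have "C * exp (- (\<theta> + \<eta>) * \<bar>Im s\<bar>) \<le> C * exp (- \<theta> * \<bar>Im s\<bar>)"
        using ex C(1) by (intro mult_left_mono) auto
      also have "\<dots> \<le> D * (C * exp (- \<theta> * \<bar>Im s\<bar>))"
        using D C(1) by (intro mult_right_mono[of 1 D, simplified]) auto
      finally show ?thesis by (simp add: mult.assoc)
    qed
    consider "Re s < 1/2 - real n" | "1/2 - real n \<le> Re s" "Re s \<le> 3/2 + real n" | "3/2 + real n < Re s" by linarith
    then show ?thesis
    proof cases
      case 1
      have "1 \<le> norm s" using s(3) abs_Im_le_cmod[of s] by linarith
      then have "norm (Gamma s) \<le> norm s * norm (Gamma s)"
        by (intro mult_right_mono[of 1 "norm s", simplified]) auto
      also have "\<dots> = norm (Gamma (s + 1))" using nz[of s] by (simp add: Gamma_plus1 norm_mult)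
      also have "\<dots> \<le> C * exp (- (\<theta> + \<eta>) * \<bar>Im s\<bar>)" using C(2)[of "s + 1"] s 1 by simp
      finally show ?thesis using one by linarith
    next
      case 2
      then show ?thesis using C(2)[of s] s one by linarith
    next
      case 3
      have "Gamma s = (s - 1) * Gamma (s - 1)" using Gamma_plus1[of "s - 1"] nz[of "s - 1"] by simp
      then have "norm (Gamma s) = norm (s - 1) * norm (Gamma (s - 1))" by (simp add: norm_mult)
      also have "\<dots> \<le> (D * exp (\<eta> * \<bar>Im s\<bar>)) * (C * exp (- (\<theta> + \<eta>) * \<bar>Im s\<bar>))"
      proof (intro mult_mono)
        have "norm (s - 1) \<le> (real n + 3/2) + \<bar>Im s\<bar>" using cmod_le[of "s - 1"] s 3 by simp
        also have "\<dots> \<le> D * exp (\<eta> * \<bar>Im s\<bar>)" unfolding D_def by (rule affine_le_exp) (use \<eta> in auto)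
        finally show "norm (s - 1) \<le> D * exp (\<eta> * \<bar>Im s\<bar>)" .
        show "norm (Gamma (s - 1)) \<le> C * exp (- (\<theta> + \<eta>) * \<bar>Im s\<bar>)" using C(2)[of "s - 1"] s 3 by simp
      qed (use D in auto)
      also have "\<dots> = D * C * exp (- \<theta> * \<bar>Im s\<bar>)"
        by (simp add: algebra_simps flip: exp_add)
      finally show ?thesis .
    qed
  qed
  moreover have "D * C > 0" using D C by simp
  ultimately show ?case by (intro exI[of _ "D * C"]) auto
qed

lemma Gamma_decay_strip:
  assumes "\<theta> < pi / 2"
  obtains C where "0 < C"
    "\<And>s. A \<le> Re s \<Longrightarrow> Re s \<le> B \<Longrightarrow> 1 \<le> \<bar>Im s\<bar> \<Longrightarrow> norm (Gamma s) \<le> C * exp (- \<theta> * \<bar>Im s\<bar>)"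
proof -
  obtain n :: nat where n: "\<bar>A\<bar> + \<bar>B\<bar> + 1 < real n" using reals_Archimedean2 by blast
  obtain C where C: "C > 0" "\<And>s. 1/2 - real n \<le> Re s \<Longrightarrow> Re s \<le> 3/2 + real n \<Longrightarrow> 1 \<le> \<bar>Im s\<bar> \<Longrightarrow>
     norm (Gamma s) \<le> C * exp (- \<theta> * \<bar>Im s\<bar>)"
    using Gamma_decay_strip_nat[OF assms, of n] by blast
  show ?thesis
  proof (rule that[OF C(1)])
    fix s assume "A \<le> Re s" "Re s \<le> B" "1 \<le> \<bar>Im s\<bar>"
    then show "norm (Gamma s) \<le> C * exp (- \<theta> * \<bar>Im s\<bar>)" using n by (intro C(2)) linarith+
  qed
qed

section \<open>Decay of the integrand in Barnes' formula\<close>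

definition barnes_kernel :: "complex \<Rightarrow> complex \<Rightarrow> complex \<Rightarrow> complex" where
  "barnes_kernel \<beta> z s = Gamma (\<beta> - s) * Gamma s * z powr (- s)"

text \<open>The Gamma factors together decay at a rate 2 \<theta> that may be chosen above |arg z|,
  since |arg z| < pi off the cut. Heights from 1 + |Im \<beta>| on keep the imaginary parts of both
  Gamma arguments at modulus at least 1.\<close>

lemma barnes_kernel_decay:
  assumes z: "z \<notin> \<real>\<^sub>\<le>\<^sub>0"
  obtains C \<epsilon> where "0 < C" "0 < \<epsilon>"
    "\<And>s. A \<le> Re s \<Longrightarrow> Re s \<le> B \<Longrightarrow> 1 + \<bar>Im \<beta>\<bar> \<le> \<bar>Im s\<bar> \<Longrightarrow>
       norm (barnes_kernel \<beta> z s) \<le> C * exp (- \<epsilon> * \<bar>Im s\<bar>)"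
proof -
  have z0: "z \<noteq> 0" using z by auto
  have arg: "\<bar>Im (Ln z)\<bar> < pi"
    using mpi_less_Im_Ln[OF z0] Im_Ln_le_pi[OF z0] Im_Ln_eq_pi[OF z0] z by (auto simp: complex_nonpos_Reals_iff abs_less_iff order_le_less)
  \<comment> \<open>2 \<theta> is the midpoint of |arg z| and pi, and \<epsilon> is the rate left
    over after the growth of z powr (-s).\<close>
  define \<theta> where "\<theta> = (\<bar>Im (Ln z)\<bar> + pi) / 4"
  define \<epsilon> where "\<epsilon> = (pi - \<bar>Im (Ln z)\<bar>) / 2"
  have th: "\<theta> < pi / 2" "0 \<le> \<theta>" "0 < \<epsilon>" "2 * \<theta> - \<bar>Im (Ln z)\<bar> = \<epsilon>"
    using arg by (auto simp: \<theta>_def \<epsilon>_def field_simps)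
  obtain C1 where C1: "0 < C1"
    "\<And>s. A \<le> Re s \<Longrightarrow> Re s \<le> B \<Longrightarrow> 1 \<le> \<bar>Im s\<bar> \<Longrightarrow> norm (Gamma s) \<le> C1 * exp (- \<theta> * \<bar>Im s\<bar>)"
    using Gamma_decay_strip[OF th(1)] by metis
  obtain C2 where C2: "0 < C2"
    "\<And>s. Re \<beta> - B \<le> Re s \<Longrightarrow> Re s \<le> Re \<beta> - A \<Longrightarrow> 1 \<le> \<bar>Im s\<bar> \<Longrightarrow> norm (Gamma s) \<le> C2 * exp (- \<theta> * \<bar>Im s\<bar>)"
    using Gamma_decay_strip[OF th(1)] by metis
  define M where "M = (\<bar>A\<bar> + \<bar>B\<bar>) * \<bar>Re (Ln z)\<bar>"
  define C where "C = C2 * exp (\<theta> * \<bar>Im \<beta>\<bar>) * C1 * exp M"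
  have "norm (barnes_kernel \<beta> z s) \<le> C * exp (- \<epsilon> * \<bar>Im s\<bar>)"
    if s: "A \<le> Re s" "Re s \<le> B" "1 + \<bar>Im \<beta>\<bar> \<le> \<bar>Im s\<bar>" for s
  proof -
    have "norm (Gamma (\<beta> - s)) \<le> C2 * exp (- \<theta> * \<bar>Im (\<beta> - s)\<bar>)"
      using s by (intro C2(2)) auto
    also have "\<dots> \<le> C2 * (exp (\<theta> * \<bar>Im \<beta>\<bar>) * exp (- \<theta> * \<bar>Im s\<bar>))"
    proof -
      have "\<bar>Im s\<bar> \<le> \<bar>Im (\<beta> - s)\<bar> + \<bar>Im \<beta>\<bar>" by simp
      then have "\<theta> * \<bar>Im s\<bar> \<le> \<theta> * (\<bar>Im (\<beta> - s)\<bar> + \<bar>Im \<beta>\<bar>)" using th(2) by (rule mult_left_mono)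
      then show ?thesis using C2(1) by (simp add: algebra_simps flip: exp_add)
    qed
    finally have 2: "norm (Gamma (\<beta> - s)) \<le> C2 * (exp (\<theta> * \<bar>Im \<beta>\<bar>) * exp (- \<theta> * \<bar>Im s\<bar>))" .
    have 1: "norm (Gamma s) \<le> C1 * exp (- \<theta> * \<bar>Im s\<bar>)" using s by (intro C1(2)) auto
    have 3: "norm (z powr (- s)) \<le> exp M * exp (\<bar>Im (Ln z)\<bar> * \<bar>Im s\<bar>)"
    proof -
      have "Re (- s * Ln z) = - Re s * Re (Ln z) + Im s * Im (Ln z)" by simp
      also have "\<dots> \<le> \<bar>Re s\<bar> * \<bar>Re (Ln z)\<bar> + \<bar>Im s\<bar> * \<bar>Im (Ln z)\<bar>"
        by (intro add_mono) (metis abs_ge_self abs_minus abs_mult, metis abs_ge_self abs_mult)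
      also have "\<dots> \<le> M + \<bar>Im (Ln z)\<bar> * \<bar>Im s\<bar>"
      proof -
        have "\<bar>Re s\<bar> * \<bar>Re (Ln z)\<bar> \<le> M" unfolding M_def using s by (intro mult_right_mono) auto
        then show ?thesis by (simp add: mult.commute)
      qed
      finally show ?thesis using z0 by (simp add: powr_def flip: exp_add)
    qed
    have "norm (barnes_kernel \<beta> z s) = norm (Gamma (\<beta> - s)) * norm (Gamma s) * norm (z powr (- s))"
      by (simp add: barnes_kernel_def norm_mult)
    also have "\<dots> \<le> (C2 * (exp (\<theta> * \<bar>Im \<beta>\<bar>) * exp (- \<theta> * \<bar>Im s\<bar>))) * (C1 * exp (- \<theta> * \<bar>Im s\<bar>)) * (exp M * exp (\<bar>Im (Ln z)\<bar> * \<bar>Im s\<bar>))"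
      using 1 2 3 C1(1) C2(1) by (intro mult_mono) auto
    also have "\<dots> = C * (exp (- \<theta> * \<bar>Im s\<bar>) * exp (- \<theta> * \<bar>Im s\<bar>) * exp (\<bar>Im (Ln z)\<bar> * \<bar>Im s\<bar>))"
      by (simp add: C_def)
    also have "\<dots> = C * exp (- \<epsilon> * \<bar>Im s\<bar>)"
      by (simp add: algebra_simps flip: th(4) exp_add)
    finally show ?thesis .
  qed
  moreover have "C > 0" using C1 C2 by (simp add: C_def)
  ultimately show ?thesis using that th(3) by blast
qed

section \<open>Poles and infinite paths\<close>

definition gauss_kernel :: "complex \<Rightarrow> complex" where
  "gauss_kernel w = exp (w\<^sup>2) / w"

text \<open>
  A path that runs to infinity has no winding number.  Its role is played by the integral of a
  kernel that has residue 1 at \<open>p\<close> and decays on vertical strips: as a function of \<open>p\<close> it is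
  locally constant off the path, and its values on the two sides differ by \<open>2\<pi>i\<close>.
\<close>

definition gauss_winding :: "(real \<Rightarrow> complex) \<Rightarrow> complex \<Rightarrow> complex" where
  "gauss_winding g p = path_integral g (\<lambda>s. gauss_kernel (s - p))"

text \<open>From (y - 1)^2 \<ge> 0 one gets exp(-y^2) \<le> exp(1 - 2 y), and half of this rate
  absorbs the factor 1 + |w|. Only an exponential is kept, because that is the weight under which
  \<open>strip_path\<close> makes the length of a path finite.\<close>

lemma gauss_decay:
  assumes "\<bar>Re w\<bar> \<le> K"
  shows "norm (exp (w\<^sup>2)) * (1 + norm w) \<le> (K + 2) * exp (K\<^sup>2 + 1) * exp (- \<bar>Im w\<bar>)"
proof -
  let ?y = "\<bar>Im w\<bar>"
  have K0: "0 \<le> K" using assms by linarith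
  have "norm (exp (w\<^sup>2)) = exp ((Re w)\<^sup>2 - ?y\<^sup>2)"
    by (simp add: norm_exp_eq_Re power2_eq_square)
  also have "\<dots> \<le> exp (K\<^sup>2 + 1 - 2 * ?y)"
  proof -
    have "(Re w)\<^sup>2 \<le> K\<^sup>2" using assms K0 by (metis abs_le_square_iff abs_of_nonneg)
    moreover have "0 \<le> (?y - 1)\<^sup>2" by simp
    ultimately show ?thesis by (simp add: power2_diff)
  qed
  finally have 1: "norm (exp (w\<^sup>2)) \<le> exp (K\<^sup>2 + 1 - 2 * ?y)" .
  have "1 + norm w \<le> (1 + K) + ?y" using cmod_le[of w] assms by linarith
  also have "\<dots> \<le> (1 + K + 1 / 1) * exp (1 * ?y)" by (rule affine_le_exp) (use K0 in auto)
  finally have 2: "1 + norm w \<le> (K + 2) * exp ?y" by (simp add: add_ac)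
  have "norm (exp (w\<^sup>2)) * (1 + norm w) \<le> exp (K\<^sup>2 + 1 - 2 * ?y) * ((K + 2) * exp ?y)"
    using 1 2 by (intro mult_mono) auto
  also have "\<dots> = (K + 2) * exp (K\<^sup>2 + 1) * exp (- ?y)"
    by (simp add: algebra_simps flip: exp_add)
  finally show ?thesis .
qed

text \<open>The kernel and its first two derivatives are all of the form f(w) exp(w^2), with f of at
  most linear growth away from 0, so one estimate serves for the three.\<close>

lemma gauss_decay_mult:
  assumes K: "\<bar>Re w\<bar> \<le> K" and f: "norm (f w) \<le> M * (1 + norm w)" and M: "0 \<le> M"
  shows "norm (f w * exp (w\<^sup>2)) \<le> M * ((K + 2) * exp (K\<^sup>2 + 1)) * exp (- \<bar>Im w\<bar>)"
proof -
  have "norm (f w * exp (w\<^sup>2)) \<le> (M * (1 + norm w)) * norm (exp (w\<^sup>2))"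
    unfolding norm_mult using f by (intro mult_right_mono) auto
  also have "\<dots> \<le> M * ((K + 2) * exp (K\<^sup>2 + 1) * exp (- \<bar>Im w\<bar>))"
    using mult_left_mono[OF gauss_decay[OF K] M] by (simp add: mult_ac)
  finally show ?thesis by (simp add: mult_ac)
qed

lemma norm_inverse_le:
  fixes w :: complex
  assumes "0 < r" "r \<le> norm w"
  shows "norm (inverse w) \<le> 1 / r"
proof -
  have "1 / norm w \<le> 1 / r" by (rule frac_le) (use assms in auto)
  then show ?thesis by (simp add: norm_inverse inverse_eq_divide norm_divide)
qed

lemma gauss_kernel_decay:
  assumes K: "\<bar>Re w\<bar> \<le> K" and r: "0 < r" "r \<le> norm w"
  shows "norm (gauss_kernel w) \<le> 1 / r * ((K + 2) * exp (K\<^sup>2 + 1)) * exp (- \<bar>Im w\<bar>)"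
proof -
  have "norm (inverse w) \<le> 1 / r" by (rule norm_inverse_le[OF r])
  also have "\<dots> \<le> 1 / r * (1 + norm w)" using r by (simp add: field_simps)
  finally have "norm (inverse w * exp (w\<^sup>2)) \<le> 1 / r * ((K + 2) * exp (K\<^sup>2 + 1)) * exp (- \<bar>Im w\<bar>)"
    using r by (intro gauss_decay_mult[OF K]) auto
  then show ?thesis by (simp add: gauss_kernel_def divide_inverse mult.commute)
qed

text \<open>The derivative of \<open>gauss_kernel\<close>; the next definition is the second
  derivative. In \<open>gauss_kernel (s - p)\<close> the derivative in the pole \<open>p\<close> is
  the same up to sign.\<close>

definition gauss_kernel1 :: "complex \<Rightarrow> complex" where
  "gauss_kernel1 w = (2 - inverse w ^ 2) * exp (w\<^sup>2)"

definition gauss_kernel2 :: "complex \<Rightarrow> complex" where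
  "gauss_kernel2 w = (4 * w - 2 * inverse w + 2 * inverse w ^ 3) * exp (w\<^sup>2)"

lemma gauss_kernel_deriv:
  assumes "w \<noteq> 0"
  shows "(gauss_kernel has_field_derivative gauss_kernel1 w) (at w within S)"
    and "(gauss_kernel1 has_field_derivative gauss_kernel2 w) (at w within S)"
  unfolding gauss_kernel_def[abs_def] gauss_kernel1_def[abs_def] gauss_kernel2_def using assms
  by (auto intro!: derivative_eq_intros simp: field_simps power2_eq_square power3_eq_cube)

lemma gauss_kernel1_decay:
  assumes K: "\<bar>Re w\<bar> \<le> K" and r: "0 < r" "r \<le> norm w"
  shows "norm (gauss_kernel1 w) \<le> (2 + (1 / r) ^ 2) * ((K + 2) * exp (K\<^sup>2 + 1)) * exp (- \<bar>Im w\<bar>)"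
  unfolding gauss_kernel1_def
proof (rule gauss_decay_mult[OF K, of "\<lambda>w. 2 - inverse w ^ 2"])
  have i: "norm (inverse w) \<le> 1 / r" by (rule norm_inverse_le[OF r])
  have "norm (2 - inverse w ^ 2) \<le> 2 + norm (inverse w) ^ 2"
    using norm_triangle_ineq4[of 2 "inverse w ^ 2"] by (simp add: norm_power)
  also have "\<dots> \<le> 2 + (1 / r) ^ 2" using power_mono[OF i, of 2] by simp
  also have "\<dots> \<le> (2 + (1 / r) ^ 2) * (1 + norm w)"
    using mult_left_mono[of 1 "1 + norm w" "2 + (1 / r) ^ 2"] by simp
  finally show "norm (2 - inverse w ^ 2) \<le> (2 + (1 / r) ^ 2) * (1 + norm w)" .
qed auto

lemma gauss_kernel2_decay:
  assumes K: "\<bar>Re w\<bar> \<le> K" and r: "0 < r" "r \<le> norm w"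
  shows "norm (gauss_kernel2 w) \<le> (4 + 2 * (1 / r) + 2 * (1 / r) ^ 3) * ((K + 2) * exp (K\<^sup>2 + 1)) * exp (- \<bar>Im w\<bar>)"
  unfolding gauss_kernel2_def
proof (rule gauss_decay_mult[OF K, of "\<lambda>w. 4 * w - 2 * inverse w + 2 * inverse w ^ 3"])
  let ?M = "2 * (1 / r) + 2 * (1 / r) ^ 3"
  have i: "norm (inverse w) \<le> 1 / r" by (rule norm_inverse_le[OF r])
  have "norm (4 * w - 2 * inverse w + 2 * inverse w ^ 3) \<le> norm (4 * w) + norm (2 * inverse w) + norm (2 * inverse w ^ 3)"
    by (intro norm_triangle_le norm_triangle_le_diff add_mono order_refl norm_triangle_ineq4)
  also have "\<dots> \<le> 4 * norm w + ?M" using power_mono[OF i, of 3] i by (simp add: norm_power norm_mult)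
  also have "\<dots> \<le> (4 + ?M) * (1 + norm w)"
  proof -
    have "0 \<le> ?M" using r by simp
    then have "0 \<le> ?M * norm w" by simp
    then show ?thesis unfolding distrib_left distrib_right by simp
  qed
  finally show "norm (4 * w - 2 * inverse w + 2 * inverse w ^ 3) \<le> (4 + 2 * (1 / r) + 2 * (1 / r) ^ 3) * (1 + norm w)"
    by (simp only: add.assoc)
qed (use r in auto)

lemma strip_path_Re_bound:
  assumes "strip_path g"
  obtains K where "0 < K" "\<And>t. \<bar>Re (g t)\<bar> \<le> K"
proof -
  from assms obtain B where B: "\<And>t. \<bar>Re (g t)\<bar> \<le> B" unfolding strip_path_def bounded_iff by auto
  show ?thesis by (rule that[of "\<bar>B\<bar> + 1"]) (auto intro!: order_trans[OF B])
qed

text \<open>The distance is called 2 r so that a pole moved by less than r still stays r away from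
  the path; r \<le> 1 bounds the displacement.\<close>

lemma strip_path_distance:
  assumes "strip_path g" "p \<notin> range g"
  obtains r where "0 < r" "r \<le> 1" "\<And>t. 2 * r \<le> norm (g t - p)"
proof -
  have "open (- range g)" using strip_path_closed_range[OF assms(1)] by (simp add: open_Compl)
  then obtain e where e: "e > 0" "ball p e \<subseteq> - range g" using assms(2) by (meson ComplI open_contains_ball)
  show ?thesis
  proof (rule that[of "min 1 (e / 2)"])
    fix t
    have "g t \<notin> ball p e" using e by auto
    then show "2 * min 1 (e / 2) \<le> norm (g t - p)" by (auto simp: dist_norm norm_minus_commute)
  qed (use e in auto)
qed

lemma gauss_kernel_shift_continuous:
  "continuous_on (- {p}) (\<lambda>s. gauss_kernel (s - p))" "continuous_on (- {p}) (\<lambda>s. gauss_kernel1 (s - p))"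
  unfolding gauss_kernel_def gauss_kernel1_def by (intro continuous_intros; auto)+

lemma gauss_kernel_path_integrable:
  assumes g: "strip_path g" and p: "p \<notin> range g"
  shows "integrable lborel (path_integrand g (\<lambda>s. gauss_kernel (s - p)))"
    "integrable lborel (path_integrand g (\<lambda>s. gauss_kernel1 (s - p)))"
proof -
  obtain K0 where K0: "\<And>t. \<bar>Re (g t)\<bar> \<le> K0" using strip_path_Re_bound[OF g] by metis
  define K where "K = K0 + \<bar>Re p\<bar>"
  have K: "\<bar>Re (g t - p)\<bar> \<le> K" for t using K0[of t] by (simp add: K_def)
  obtain r where r: "0 < r" "r \<le> 1" "\<And>t. 2 * r \<le> norm (g t - p)" by (rule strip_path_distance[OF g p]) blast
  have rt: "r \<le> norm (g t - p)" for t using r(1) r(3)[of t] by simp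
  have ran: "range g \<subseteq> - {p}" using p by auto
  have im: "exp (- \<bar>Im (g t - p)\<bar>) \<le> exp \<bar>Im p\<bar> * exp (- 1 * \<bar>Im (g t)\<bar>)" for t
    by (simp flip: exp_add)
  have K0': "0 \<le> K" using K[of 0] by linarith
  have *: "c * exp (- \<bar>Im (g t - p)\<bar>) \<le> (c * exp \<bar>Im p\<bar>) * exp (- 1 * \<bar>Im (g t)\<bar>)" if "0 \<le> c" for c t
    using mult_left_mono[OF im that, of t] by (simp add: mult.assoc)
  show "integrable lborel (path_integrand g (\<lambda>s. gauss_kernel (s - p)))"
    by (rule path_integrand_integrable_bound[OF g gauss_kernel_shift_continuous(1) ran zero_less_one
          order_trans[OF gauss_kernel_decay[OF K r(1) rt] *]]) (use K0' r in auto)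
  show "integrable lborel (path_integrand g (\<lambda>s. gauss_kernel1 (s - p)))"
    by (rule path_integrand_integrable_bound[OF g gauss_kernel_shift_continuous(2) ran zero_less_one
          order_trans[OF gauss_kernel1_decay[OF K r(1) rt] *]]) (use K0' r in auto)
qed

text \<open>Being a derivative, the integrand has a single-valued primitive off the pole, namely the
  kernel, which tends to 0 at both ends of the path.\<close>

lemma gauss_kernel1_path_integral:
  assumes g: "strip_path g" and p: "p \<notin> range g"
  shows "path_integral g (\<lambda>s. gauss_kernel1 (s - p)) = 0"
proof -
  obtain K0 where K0: "\<And>t. \<bar>Re (g t)\<bar> \<le> K0" using strip_path_Re_bound[OF g] by metis
  define K where "K = K0 + \<bar>Re p\<bar>"
  have K: "\<bar>Re (g t - p)\<bar> \<le> K" for t using K0[of t] by (simp add: K_def)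
  obtain r where r: "0 < r" "r \<le> 1" "\<And>t. 2 * r \<le> norm (g t - p)" by (rule strip_path_distance[OF g p]) blast
  have rt: "r \<le> norm (g t - p)" for t using r(1) r(3)[of t] by simp
  define D where "D = 1 / r * ((K + 2) * exp (K\<^sup>2 + 1))"
  have lim: "((\<lambda>x. D * exp (- \<bar>x - Im p\<bar>)) \<longlongrightarrow> 0) at_top" "((\<lambda>x. D * exp (- \<bar>x - Im p\<bar>)) \<longlongrightarrow> 0) at_bot"
    by real_asymp+
  have bnd: "norm (gauss_kernel (g t - p)) \<le> D * exp (- \<bar>Im (g t) - Im p\<bar>)" for t
    using gauss_kernel_decay[OF K r(1) rt] by (simp add: D_def)
  have "path_integral g (\<lambda>s. gauss_kernel1 (s - p)) = 0 - 0"
  proof (rule path_integral_FTC[OF g, of "- {p}" "\<lambda>s. gauss_kernel (s - p)"])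
    show "range g \<subseteq> - {p}" using p by auto
    show "((\<lambda>s. gauss_kernel (s - p)) has_field_derivative gauss_kernel1 (s - p)) (at s)" if "s \<in> - {p}" for s
    proof -
      have "((\<lambda>s. s - p) has_field_derivative 1) (at s)" by (auto intro!: derivative_eq_intros)
      with gauss_kernel_deriv(1)[of "s - p" UNIV] that
      have "((\<lambda>s. gauss_kernel (s - p)) has_field_derivative gauss_kernel1 (s - p) * 1) (at s)"
        by (intro DERIV_chain2) auto
      then show ?thesis by simp
    qed
    show "((\<lambda>t. gauss_kernel (g t - p)) \<longlongrightarrow> 0) at_top"
      by (rule Lim_null_comparison[OF always_eventually filterlim_compose[OF lim(1)]])
         (use bnd g in \<open>auto simp: strip_path_def\<close>)
    show "((\<lambda>t. gauss_kernel (g t - p)) \<longlongrightarrow> 0) at_bot"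
      by (rule Lim_null_comparison[OF always_eventually filterlim_compose[OF lim(2)]])
         (use bnd g in \<open>auto simp: strip_path_def\<close>)
  qed (use gauss_kernel_path_integrable[OF g p] in auto)
  then show ?thesis by simp
qed

text \<open>Moving the pole changes the integral by the integral of a total derivative to first order.\<close>

lemma gauss_winding_deriv_zero:
  assumes g: "strip_path g" and p: "p \<notin> range g"
  shows "(gauss_winding g has_field_derivative 0) (at p)"
proof -
  obtain K0 where K0: "\<And>t. \<bar>Re (g t)\<bar> \<le> K0" using strip_path_Re_bound[OF g] by metis
  \<comment> \<open>The extra 1 covers the disc of radius r \<le> 1 in which the pole is
    moved.\<close>
  define K where "K = K0 + \<bar>Re p\<bar> + 1"
  obtain r where r: "0 < r" "r \<le> 1" "\<And>t. 2 * r \<le> norm (g t - p)" by (rule strip_path_distance[OF g p]) blast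
  define M where "M = (4 + 2 * (1 / r) + 2 * (1 / r) ^ 3) * ((K + 2) * exp (K\<^sup>2 + 1)) * exp (\<bar>Im p\<bar> + 1)"
  have K0': "0 \<le> K" using K0[of 0] by (simp add: K_def)
  have M0: "0 \<le> M" using r K0' by (auto simp: M_def)
  \<comment> \<open>First-order Taylor formula for the kernel at g t - p: moving the pole from p to
    q moves the argument by p - q. The quadratic remainder must be integrable along the path, hence
    the weight exp(-|Im (g t)|).\<close>
  have rem: "norm (gauss_kernel (g t - q) - gauss_kernel (g t - p) - gauss_kernel1 (g t - p) * (p - q))
      \<le> M * exp (- 1 * \<bar>Im (g t)\<bar>) * norm (q - p) ^ 2" if q: "q \<in> ball p r" for q t
  proof -
    let ?B = "ball (g t - p) r"
    have far: "r \<le> norm u" "\<bar>Re u\<bar> \<le> K" "\<bar>Im (g t)\<bar> - \<bar>Im p\<bar> - 1 \<le> \<bar>Im u\<bar>" if "u \<in> ?B" for u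
    proof -
      have d: "norm (g t - p - u) < r" using that by (simp add: dist_norm)
      show "r \<le> norm u" using r(3)[of t] d norm_triangle_ineq2[of "g t - p" u] by linarith
      show "\<bar>Re u\<bar> \<le> K" using d r(2) abs_Re_le_cmod[of "g t - p - u"] K0[of t] by (simp add: K_def)
      show "\<bar>Im (g t)\<bar> - \<bar>Im p\<bar> - 1 \<le> \<bar>Im u\<bar>" using d r(2) abs_Im_le_cmod[of "g t - p - u"] by simp
    qed
    define h where "h i = (if i = 0 then gauss_kernel else if i = 1 then gauss_kernel1 else gauss_kernel2)" for i :: nat
    have "norm (h 0 (g t - q) - (\<Sum>i\<le>1. h i (g t - p) * ((g t - q) - (g t - p)) ^ i / fact i))
        \<le> M * exp (- 1 * \<bar>Im (g t)\<bar>) * norm ((g t - q) - (g t - p)) ^ Suc 1 / fact 1"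
    proof (rule complex_Taylor[of ?B])
      fix i :: nat and u assume u: "u \<in> ?B" "i \<le> 1"
      then have "u \<noteq> 0" using far(1)[of u] r by auto
      then show "(h i has_field_derivative h (Suc i) u) (at u within ?B)"
        using u gauss_kernel_deriv by (cases "i = 0") (auto simp: h_def)
    next
      fix u assume u: "u \<in> ?B"
      have "norm (gauss_kernel2 u) \<le> (4 + 2 * (1 / r) + 2 * (1 / r) ^ 3) * ((K + 2) * exp (K\<^sup>2 + 1)) * exp (- \<bar>Im u\<bar>)"
        by (rule gauss_kernel2_decay) (use far[OF u] r in auto)
      also have "\<dots> \<le> (4 + 2 * (1 / r) + 2 * (1 / r) ^ 3) * ((K + 2) * exp (K\<^sup>2 + 1)) * (exp (\<bar>Im p\<bar> + 1) * exp (- 1 * \<bar>Im (g t)\<bar>))"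
        using far(3)[OF u] r K0' by (intro mult_left_mono) (auto simp flip: exp_add)
      finally show "norm (h (Suc 1) u) \<le> M * exp (- 1 * \<bar>Im (g t)\<bar>)" by (simp add: h_def M_def mult_ac)
    qed (use q r in \<open>auto simp: dist_norm norm_minus_commute\<close>)
    then show ?thesis by (simp add: h_def norm_minus_commute power2_eq_square diff_diff_eq2 algebra_simps)
  qed
  define I where "I = (LINT t|lborel. exp (- 1 * \<bar>Im (g t)\<bar>) * norm (vector_derivative g (at t)))"
  have intI: "integrable lborel (\<lambda>t. exp (- 1 * \<bar>Im (g t)\<bar>) * norm (vector_derivative g (at t)))"
    using g unfolding strip_path_def by (metis zero_less_one)
  have quad: "norm (gauss_winding g q - gauss_winding g p) \<le> M * I * norm (q - p) ^ 2" if q: "q \<in> ball p r" for q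
  proof -
    have qn: "q \<notin> range g"
    proof
      assume "q \<in> range g"
      then obtain t where "q = g t" by auto
      then show False using q r(3)[of t] r(1) by (simp add: dist_norm norm_minus_commute)
    qed
    \<comment> \<open>Subtracting the linear term leaves the integral unchanged, since
      \<open>gauss_kernel1\<close> integrates to 0; what remains is of second order in q -
      p.\<close>
    let ?f = "\<lambda>t. path_integrand g (\<lambda>s. gauss_kernel (s - q)) t - path_integrand g (\<lambda>s. gauss_kernel (s - p)) t
        - path_integrand g (\<lambda>s. gauss_kernel1 (s - p)) t * (p - q)"
    note int = gauss_kernel_path_integrable[OF g p] gauss_kernel_path_integrable(1)[OF g qn]
    have "gauss_winding g q - gauss_winding g p = (LINT t|lborel. ?f t)"
      using int gauss_kernel1_path_integral[OF g p] unfolding gauss_winding_def path_integral_def by simp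
    also have "norm \<dots> \<le> (LINT t|lborel. M * norm (q - p) ^ 2 * (exp (- 1 * \<bar>Im (g t)\<bar>) * norm (vector_derivative g (at t))))"
    proof (rule Bochner_Integration.integral_norm_bound_integral)
      fix t
      have "?f t = (gauss_kernel (g t - q) - gauss_kernel (g t - p) - gauss_kernel1 (g t - p) * (p - q)) * vector_derivative g (at t)"
        by (simp add: path_integrand_def algebra_simps)
      then have "norm (?f t) = norm (gauss_kernel (g t - q) - gauss_kernel (g t - p) - gauss_kernel1 (g t - p) * (p - q)) * norm (vector_derivative g (at t))"
        by (simp only: norm_mult)
      also have "\<dots> \<le> (M * exp (- 1 * \<bar>Im (g t)\<bar>) * norm (q - p) ^ 2) * norm (vector_derivative g (at t))"
        by (intro mult_right_mono rem q) auto
      finally show "norm (?f t) \<le> M * norm (q - p) ^ 2 * (exp (- 1 * \<bar>Im (g t)\<bar>) * norm (vector_derivative g (at t)))"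
        by (simp only: mult_ac)
    qed (intro Bochner_Integration.integrable_diff integrable_mult_left integrable_mult_right int intI)+
    also have "\<dots> = M * I * norm (q - p) ^ 2" unfolding I_def by (subst integral_mult_right_zero) (simp only: mult_ac)
    finally show ?thesis .
  qed
  have "((\<lambda>q. (gauss_winding g q - gauss_winding g p) / (q - p)) \<longlongrightarrow> 0) (at p)"
  proof (rule Lim_null_comparison)
    have "((\<lambda>q. M * I * norm (q - p)) \<longlongrightarrow> M * I * norm (p - p)) (at p)" by (intro tendsto_intros)
    then show "((\<lambda>q. M * I * norm (q - p)) \<longlongrightarrow> 0) (at p)" by simp
    have "\<forall>\<^sub>F q in at p. q \<in> ball p r" using r(1) by (intro eventually_at_in_open') auto
    moreover have "\<forall>\<^sub>F q in at p. q \<noteq> p" by (simp add: eventually_at_filter)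
    ultimately show "\<forall>\<^sub>F q in at p. norm ((gauss_winding g q - gauss_winding g p) / (q - p)) \<le> M * I * norm (q - p)"
    proof eventually_elim
      case (elim q)
      then show ?case using quad[of q] by (simp add: norm_divide divide_le_eq power2_eq_square mult.assoc)
    qed
  qed
  then show ?thesis by (simp add: has_field_derivative_iff)
qed

section \<open>Values on the two sides of a path\<close>

lemma gauss_winding_component:
  assumes g: "strip_path g" and c: "connected_component (- range g) p q"
  shows "gauss_winding g p = gauss_winding g q"
proof -
  obtain T where T: "connected T" "T \<subseteq> - range g" "p \<in> T" "q \<in> T"
    using c by (auto simp: connected_component_def)
  let ?C = "connected_component_set (- range g) p"
  have op: "open (- range g)" using strip_path_closed_range[OF g] by (simp add: open_Compl)
  have "gauss_winding g constant_on ?C"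
  proof (rule has_field_derivative_0_imp_constant_on)
    show "(gauss_winding g has_field_derivative 0) (at z)" if "z \<in> ?C" for z
      using gauss_winding_deriv_zero[OF g, of z] connected_component_in[of "- range g" p z] that by auto
  qed (use op in \<open>auto simp: open_connected_component\<close>)
  moreover have "p \<in> ?C" "q \<in> ?C" using c connected_component_in[OF c] by auto
  ultimately show ?thesis unfolding constant_on_def by metis
qed

lemma path_integral_vline_shift:
  "path_integral (vline \<sigma>) (\<lambda>s. f (s - p)) = path_integral (vline (\<sigma> - Re p)) f"
proof -
  have eq: "vline \<sigma> (Im p + 1 * t) - p = vline (\<sigma> - Re p) t" for t
    by (simp add: vline_def complex_eq_iff)
  have "path_integral (vline \<sigma>) (\<lambda>s. f (s - p)) = (LINT t|lborel. f (vline \<sigma> t - p) * \<i>)"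
    by (simp add: path_integral_def path_integrand_vline)
  also have "\<dots> = \<bar>1\<bar> *\<^sub>R (LINT t|lborel. f (vline \<sigma> (Im p + 1 * t) - p) * \<i>)"
    by (rule lborel_integral_real_affine) simp
  also have "\<dots> = path_integral (vline (\<sigma> - Re p)) f"
    unfolding eq by (simp add: path_integral_def path_integrand_vline)
  finally show ?thesis .
qed

text \<open>The margin \<delta> makes the translated kernel holomorphic and uniformly decaying in
  the strip, so a vertical line may replace the path. After a translation only the offset of that
  line from \<open>p\<close> matters.\<close>

lemma gauss_winding_outside:
  assumes g: "strip_path g" "\<And>t. a < Re (g t) \<and> Re (g t) < b"
    and \<sigma>: "a < \<sigma>" "\<sigma> < b" and \<delta>: "0 < \<delta>" and p: "Re p \<le> a - \<delta> \<or> b + \<delta> \<le> Re p"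
  shows "gauss_winding g p = path_integral (vline (\<sigma> - Re p)) gauss_kernel"
proof -
  define K where "K = \<bar>a\<bar> + \<bar>b\<bar> + \<bar>Re p\<bar>"
  define C where "C = 1 / \<delta> * ((K + 2) * exp (K\<^sup>2 + 1)) * exp \<bar>Im p\<bar>"
  have far: "\<delta> \<le> norm (s - p)" if "a < Re s" "Re s < b" for s
    using that p abs_Re_le_cmod[of "s - p"] by auto
  have "gauss_winding g p = path_integral (vline \<sigma>) (\<lambda>s. gauss_kernel (s - p))"
    unfolding gauss_winding_def
  proof (rule path_integral_strip_indep)
    show "(\<lambda>s. gauss_kernel (s - p)) holomorphic_on {s. a < Re s \<and> Re s < b}"
      unfolding gauss_kernel_def by (intro holomorphic_intros) (use far \<delta> in force)
    show "norm (gauss_kernel (s - p)) \<le> C * exp (- 1 * \<bar>Im s\<bar>)" if s: "a < Re s" "Re s < b" for s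
    proof -
      have "norm (gauss_kernel (s - p)) \<le> 1 / \<delta> * ((K + 2) * exp (K\<^sup>2 + 1)) * exp (- \<bar>Im (s - p)\<bar>)"
        by (rule gauss_kernel_decay[OF _ \<delta> far[OF s]]) (use s in \<open>simp add: K_def\<close>)
      also have "\<dots> \<le> 1 / \<delta> * ((K + 2) * exp (K\<^sup>2 + 1)) * (exp \<bar>Im p\<bar> * exp (- 1 * \<bar>Im s\<bar>))"
        using \<delta> by (intro mult_left_mono) (auto simp: K_def simp flip: exp_add)
      finally show ?thesis by (simp add: C_def mult_ac)
    qed
  qed (use g \<sigma> strip_path_vline in auto)
  then show ?thesis by (simp add: path_integral_vline_shift)
qed

text \<open>Every point on the left can be joined to one that lies exactly 1/2 to the left of a
  vertical line in a strip containing the path. This normalises the value: it depends neither on the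
  path nor on the point.\<close>

lemma gauss_winding_left:
  assumes g: "strip_path g" and p: "left_of_path g p"
  shows "gauss_winding g p = path_integral (vline (1/2)) gauss_kernel"
proof -
  obtain q where q: "\<And>t. Re q < Re (g t)" "connected_component (- range g) p q"
    using p unfolding left_of_path_def by blast
  obtain K where K: "0 < K" "\<And>t. \<bar>Re (g t)\<bar> \<le> K" by (rule strip_path_Re_bound[OF g]) blast
  \<comment> \<open>The half-plane to the left of \<open>q\<close> misses the path, so
    \<open>q\<close> may retreat by 1/2. The strip used below starts at Re q - 1/4, which leaves a
    margin of 1/4 to the pole.\<close>
  have "connected_component (- range g) q (q - 1/2)"
    unfolding connected_component_def
  proof (intro exI conjI)
    show "connected {s. Re s \<le> Re q}" by (intro convex_connected convex_halfspace_Re_le)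
    show "{s. Re s \<le> Re q} \<subseteq> - range g" using q(1) by (auto simp: not_le[symmetric])
  qed auto
  then have "gauss_winding g p = gauss_winding g (q - 1/2)"
    using gauss_winding_component[OF g] q(2) by metis
  also have "\<dots> = path_integral (vline (Re q - Re (q - 1/2))) gauss_kernel"
  proof (rule gauss_winding_outside[OF g, of "Re q - 1/4" "K + 1" _ "1/4"])
    show "Re q < K + 1" using q(1)[of 0] K(2)[of 0] by linarith
    show "Re q - 1 / 4 < Re (g t) \<and> Re (g t) < K + 1" for t using q(1)[of t] K(2)[of t] by linarith
  qed auto
  finally show ?thesis by simp
qed

lemma gauss_winding_right:
  assumes g: "strip_path g" and p: "right_of_path g p"
  shows "gauss_winding g p = path_integral (vline (- 1/2)) gauss_kernel"
proof -
  obtain q where q: "\<And>t. Re (g t) < Re q" "connected_component (- range g) p q"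
    using p unfolding right_of_path_def by blast
  obtain K where K: "0 < K" "\<And>t. \<bar>Re (g t)\<bar> \<le> K" by (rule strip_path_Re_bound[OF g]) blast
  have "connected_component (- range g) q (q + 1/2)"
    unfolding connected_component_def
  proof (intro exI conjI)
    show "connected {s. Re s \<ge> Re q}" by (intro convex_connected convex_halfspace_Re_ge)
    show "{s. Re s \<ge> Re q} \<subseteq> - range g" using q(1) by (auto simp: not_le[symmetric])
  qed auto
  then have "gauss_winding g p = gauss_winding g (q + 1/2)"
    using gauss_winding_component[OF g] q(2) by metis
  also have "\<dots> = path_integral (vline (Re q - Re (q + 1/2))) gauss_kernel"
  proof (rule gauss_winding_outside[OF g, of "- K - 1" "Re q + 1/4" _ "1/4"])
    show "- K - 1 < Re q" using q(1)[of 0] K(2)[of 0] by linarith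
    show "- K - 1 < Re (g t) \<and> Re (g t) < Re q + 1/4" for t using q(1)[of t] K(2)[of t] by linarith
  qed auto
  finally show ?thesis by simp
qed

section \<open>The cosecant and the residue theorem for infinite paths\<close>

lemma norm_sin_ge:
  assumes "1 \<le> \<bar>Im w\<bar>"
  shows "exp \<bar>Im w\<bar> / 4 \<le> norm (sin w)"
proof -
  let ?y = "\<bar>Im w\<bar>"
  have "2 * norm (sin w) = norm (exp (\<i> * w) - exp (- (\<i> * w)))"
    by (simp add: sin_exp_eq norm_divide norm_mult)
  also have "\<dots> \<ge> \<bar>exp (- Im w) - exp (Im w)\<bar>"
    using norm_triangle_ineq3[of "exp (\<i> * w)" "exp (- (\<i> * w))"] by (simp add: norm_exp_eq_Re)
  finally have "2 * norm (sin w) \<ge> \<bar>exp (- Im w) - exp (Im w)\<bar>" .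
  also have "\<bar>exp (- Im w) - exp (Im w)\<bar> = exp ?y - exp (- ?y)"
    by (cases "Im w \<ge> 0") auto
  finally have 1: "2 * norm (sin w) \<ge> exp ?y - exp (- ?y)" .
  have "2 \<le> exp ?y" using exp_ge_add_one_self[of ?y] assms by linarith
  moreover have "exp (- ?y) \<le> 1" by simp
  ultimately show ?thesis using 1 by linarith
qed

text \<open>On the lines Re s = 1/2 and Re s = -1/2 the sine becomes cosh(pi t) and -cosh(pi t),
  which leaves the integral of 1 / cosh. This supplies a function with one simple pole between the
  lines and explicit integrals over both.\<close>

lemma path_integral_cosecant:
  assumes "\<sigma> = 1/2 \<or> \<sigma> = - 1/2"
  shows "path_integral (vline \<sigma>) (\<lambda>s. of_real pi / sin (of_real pi * s)) = of_real (sgn \<sigma> * pi) * \<i>"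
proof -
  have "sin (of_real pi * vline \<sigma> t) = of_real (sgn \<sigma> * cosh (pi * t))" for t
  proof -
    have "vline \<sigma> t = of_real \<sigma> + \<i> * of_real t" by (simp add: complex_eq_iff)
    then have "of_real pi * vline \<sigma> t = of_real (\<sigma> * pi) + \<i> * of_real (pi * t)"
      by (simp add: algebra_simps)
    moreover have "cos (\<i> * of_real (pi * t)) = of_real (cosh (pi * t))"
      unfolding cosh_conv_cos[symmetric]
      by (simp add: cosh_def scaleR_conv_of_real exp_of_real flip: of_real_mult of_real_minus)
    moreover have "sin (of_real (\<sigma> * pi) :: complex) = of_real (sgn \<sigma>)" "cos (of_real (\<sigma> * pi) :: complex) = 0"
    proof -
      have "sin (\<sigma> * pi) = sgn \<sigma>" "cos (\<sigma> * pi) = 0"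
        using assms by (elim disjE; hypsubst; simp)+
      then show "sin (of_real (\<sigma> * pi) :: complex) = of_real (sgn \<sigma>)" "cos (of_real (\<sigma> * pi) :: complex) = 0"
        by (simp_all only: sin_of_real cos_of_real of_real_0)
    qed
    ultimately show ?thesis by (simp add: sin_add)
  qed
  then have "path_integral (vline \<sigma>) (\<lambda>s. of_real pi / sin (of_real pi * s)) 
      = (LINT t|lborel. of_real (1 / cosh (pi * t)) * (of_real (sgn \<sigma> * pi) * \<i>))"
    unfolding path_integral_def path_integrand_vline
    using assms by (intro Bochner_Integration.integral_cong) (auto simp: sgn_if)
  also have "\<dots> = of_real (LINT t|lborel. 1 / cosh (pi * t)) * (of_real (sgn \<sigma> * pi) * \<i>)"
    unfolding integral_mult_left_zero integral_complex_of_real ..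
  also have "(LINT t|lborel. 1 / cosh (pi * t)) = 1"
    using sech_integral[of pi] by (simp add: has_bochner_integral_iff)
  finally show ?thesis by simp
qed

text \<open>The poles are removed one at a time: \<open>F\<close> minus \<open>c p\<close> times the
  kernel at \<open>p\<close> extends holomorphically across \<open>p\<close> and still decays. With
  no pole left, both paths give the same integral. The decay constants change on the way, so
  \<open>F\<close>, \<open>C\<close> and \<open>Y\<close> are arbitrary in the induction.\<close>

lemma strip_path_singular_integral:
  assumes P: "finite P" and hol: "F holomorphic_on {s. a < Re s \<and> Re s < b} - P"
    and res: "\<And>p. p \<in> P \<Longrightarrow> a < Re p \<and> Re p < b" "\<And>p. p \<in> P \<Longrightarrow> ((\<lambda>s. (s - p) * F s) \<longlongrightarrow> c p) (at p)"
    and dec: "\<And>s. a < Re s \<Longrightarrow> Re s < b \<Longrightarrow> s \<notin> P \<Longrightarrow> Y \<le> \<bar>Im s\<bar> \<Longrightarrow> norm (F s) \<le> C * exp (- \<epsilon> * \<bar>Im s\<bar>)"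
    and \<epsilon>: "0 < \<epsilon>" "\<epsilon> \<le> 1"
    and g1: "strip_path g1" "\<And>t. a < Re (g1 t) \<and> Re (g1 t) < b" "range g1 \<inter> P = {}"
    and g2: "strip_path g2" "\<And>t. a < Re (g2 t) \<and> Re (g2 t) < b" "range g2 \<inter> P = {}"
  shows "path_integral g1 F - path_integral g2 F = (\<Sum>p\<in>P. c p * (gauss_winding g1 p - gauss_winding g2 p))"
  using P hol res dec g1(3) g2(3)
proof (induction P arbitrary: F C Y)
  case empty
  then show ?case using path_integral_strip_indep[of F a b Y C \<epsilon> g1 g2] g1 g2 \<epsilon> by simp
next
  case (insert p P)
  let ?S = "{s. a < Re s \<and> Re s < b}"
  define h where "h s = c p * gauss_kernel (s - p)" for s
  have pS: "p \<in> ?S" using insert.prems(2) by auto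
  have opSP: "open (?S - P)" using open_strip insert.hyps(1) by (intro open_Diff finite_imp_closed)
  have hol_h: "h holomorphic_on - {p}"
    unfolding h_def gauss_kernel_def by (intro holomorphic_intros) auto
  have hol1: "(\<lambda>s. F s - h s) holomorphic_on (?S - P) - {p}"
    by (intro holomorphic_on_diff holomorphic_on_subset[OF insert.prems(1)] holomorphic_on_subset[OF hol_h]) auto
  have lim1: "((\<lambda>s. (s - p) * (F s - h s)) \<longlongrightarrow> 0) (at p)"
  proof -
    have "((\<lambda>s. c p * exp ((s - p)\<^sup>2)) \<longlongrightarrow> c p * exp ((p - p)\<^sup>2)) (at p)" by (intro tendsto_intros)
    then have "((\<lambda>s. c p * exp ((s - p)\<^sup>2)) \<longlongrightarrow> c p) (at p)" by simp
    moreover have "\<forall>\<^sub>F s in at p. c p * exp ((s - p)\<^sup>2) = (s - p) * h s"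
      by (simp add: eventually_at_filter h_def gauss_kernel_def)
    ultimately have "((\<lambda>s. (s - p) * h s) \<longlongrightarrow> c p) (at p)" by (rule Lim_transform_eventually)
    with insert.prems(3)[of p] have "((\<lambda>s. (s - p) * F s - (s - p) * h s) \<longlongrightarrow> c p - c p) (at p)"
      by (intro tendsto_diff) auto
    then show ?thesis by (simp add: right_diff_distrib)
  qed
  \<comment> \<open>By \<open>lim1\<close> the singularity at \<open>p\<close> is removable.
    \<open>G\<close> is the extension; on the paths it equals F - h, because they avoid
    \<open>p\<close>.\<close>
  have "p \<in> interior (?S - P)" using opSP pS insert.hyps(2) by (simp add: interior_open)
  from holomorphic_on_extend_lim[OF hol1 this] lim1 obtain G where
    G: "G holomorphic_on ?S - P" "\<And>z. z \<in> ?S - P - {p} \<Longrightarrow> G z = F z - h z" by blast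
  obtain K where K: "\<bar>a\<bar> + \<bar>b\<bar> + \<bar>Re p\<bar> \<le> K" by blast
  define D where "D = norm (c p) * (1 * ((K + 2) * exp (K\<^sup>2 + 1)) * exp \<bar>Im p\<bar>)"
  have hb: "norm (h s) \<le> D * exp (- \<epsilon> * \<bar>Im s\<bar>)" if s: "s \<in> ?S" "\<bar>Im p\<bar> + 1 \<le> \<bar>Im s\<bar>" for s
  proof -
    have "norm (gauss_kernel (s - p)) \<le> 1 / 1 * ((K + 2) * exp (K\<^sup>2 + 1)) * exp (- \<bar>Im (s - p)\<bar>)"
      using s K abs_Im_le_cmod[of "s - p"] by (intro gauss_kernel_decay) auto
    also have "\<dots> \<le> 1 / 1 * ((K + 2) * exp (K\<^sup>2 + 1)) * (exp \<bar>Im p\<bar> * exp (- \<epsilon> * \<bar>Im s\<bar>))"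
    proof (intro mult_left_mono)
      \<comment> \<open>The kernel is bounded at the rate 1, which is weakened to the common rate
        \<epsilon> \<le> 1.\<close>
      have "\<epsilon> * \<bar>Im s\<bar> \<le> 1 * \<bar>Im s\<bar>" using \<epsilon> by (intro mult_right_mono) auto
      then show "exp (- \<bar>Im (s - p)\<bar>) \<le> exp \<bar>Im p\<bar> * exp (- \<epsilon> * \<bar>Im s\<bar>)"
        by (simp flip: exp_add)
    qed (use K in auto)
    finally have "norm (c p) * norm (gauss_kernel (s - p)) \<le>
        norm (c p) * (1 / 1 * ((K + 2) * exp (K\<^sup>2 + 1)) * (exp \<bar>Im p\<bar> * exp (- \<epsilon> * \<bar>Im s\<bar>)))"
      by (rule mult_left_mono) simp
    then show ?thesis by (simp add: h_def norm_mult D_def mult_ac)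
  qed
  have IH: "path_integral g1 G - path_integral g2 G = (\<Sum>q\<in>P. c q * (gauss_winding g1 q - gauss_winding g2 q))"
  proof (rule insert.IH[OF G(1)])
    show "a < Re q \<and> Re q < b" if "q \<in> P" for q using insert.prems(2) that by auto
    show "((\<lambda>s. (s - q) * G s) \<longlongrightarrow> c q) (at q)" if q: "q \<in> P" for q
    proof -
      have qp: "q \<noteq> p" using q insert.hyps by auto
      have "continuous_on (- {p}) h" using hol_h by (rule holomorphic_on_imp_continuous_on)
      then have "isCont h q" using qp continuous_on_eq_continuous_at[of "- {p}" h] by auto
      then have "((\<lambda>s. (s - q) * F s - (s - q) * h s) \<longlongrightarrow> c q - (q - q) * h q) (at q)"
        using insert.prems(3)[of q] q unfolding isCont_def by (intro tendsto_intros) auto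
      then have l: "((\<lambda>s. (s - q) * F s - (s - q) * h s) \<longlongrightarrow> c q) (at q)" by simp
      have "open (?S - (P - {q}) - {p})" using open_strip insert.hyps(1) by (intro open_Diff finite_imp_closed) auto
      moreover have "q \<in> ?S - (P - {q}) - {p}" using q qp insert.prems(2) by auto
      ultimately have "\<forall>\<^sub>F s in at q. s \<in> ?S - (P - {q}) - {p}" by (rule eventually_at_in_open')
      moreover have "\<forall>\<^sub>F s in at q. s \<noteq> q" by (simp add: eventually_at_filter)
      ultimately have "\<forall>\<^sub>F s in at q. (s - q) * F s - (s - q) * h s = (s - q) * G s"
        by eventually_elim (use G(2) in \<open>simp add: right_diff_distrib\<close>)
      with l show ?thesis by (rule Lim_transform_eventually)
    qed
    show "norm (G s) \<le> (C + D) * exp (- \<epsilon> * \<bar>Im s\<bar>)"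
      if s: "a < Re s" "Re s < b" "s \<notin> P" "max Y (\<bar>Im p\<bar> + 1) \<le> \<bar>Im s\<bar>" for s
    proof -
      have sp: "s \<noteq> p" using s(4) by auto
      have "norm (G s) \<le> norm (F s) + norm (h s)" using G(2)[of s] s sp by (simp add: norm_triangle_ineq4)
      also have "\<dots> \<le> C * exp (- \<epsilon> * \<bar>Im s\<bar>) + D * exp (- \<epsilon> * \<bar>Im s\<bar>)"
        using s sp by (intro add_mono insert.prems(4) hb) auto
      finally show ?thesis by (simp add: algebra_simps)
    qed
  qed (use insert.prems in auto)
  have split: "path_integral g F = path_integral g G + c p * gauss_winding g p"
    if g: "strip_path g" "\<And>t. a < Re (g t) \<and> Re (g t) < b" "range g \<inter> insert p P = {}" for g
  proof -
    have rg: "range g \<subseteq> ?S - P" "range g \<subseteq> ?S - insert p P" using g by auto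
    have cont: "continuous_on (?S - insert p P) F" using insert.prems(1) by (rule holomorphic_on_imp_continuous_on)
    obtain C' where "\<And>t. norm (F (g t)) \<le> C' * exp (- \<epsilon> * \<bar>Im (g t)\<bar>)"
      by (rule strip_path_decay_global[OF g(1) cont rg(2), of Y C \<epsilon>]) (use insert.prems(4) in auto)
    then have i1: "integrable lborel (path_integrand g F)"
      by (rule path_integrand_integrable_bound[OF g(1) cont rg(2) \<epsilon>(1)])
    have i2: "integrable lborel (path_integrand g (\<lambda>s. gauss_kernel (s - p)))"
      by (rule gauss_kernel_path_integrable) (use g in auto)
    have "path_integrand g G t = path_integrand g F t - c p * path_integrand g (\<lambda>s. gauss_kernel (s - p)) t" for t
    proof -
      have "g t \<in> ?S - P - {p}" using rg(2) by auto
      then show ?thesis by (simp add: path_integrand_def G(2) h_def algebra_simps)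
    qed
    then have "path_integral g G = 
        (LINT t|lborel. path_integrand g F t - c p * path_integrand g (\<lambda>s. gauss_kernel (s - p)) t)"
      by (simp add: path_integral_def)
    also have "\<dots> = path_integral g F - c p * gauss_winding g p"
      using i1 i2 by (simp add: path_integral_def gauss_winding_def)
    finally have "path_integral g G = path_integral g F - c p * gauss_winding g p" .
    then show ?thesis by simp
  qed
  show ?case
    using IH split[OF g1(1,2) insert.prems(5)] split[OF g2(1,2) insert.prems(6)] insert.hyps
    by (simp add: algebra_simps)
qed

section \<open>Barnes' integral\<close>

text \<open>The constant involves no particular integrand, so a single example determines it. The
  function pi / sin(pi s) has 0 as its only pole with |Re s| < 3/4, with residue 1, and its
  integrals over the two lines are pi i and -pi i.\<close>

lemma vline_gauss_diff:
  "path_integral (vline (1/2)) gauss_kernel - path_integral (vline (- 1/2)) gauss_kernel = 2 * of_real pi * \<i>"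
proof -
  let ?F = "\<lambda>s::complex. of_real pi / sin (of_real pi * s)"
  let ?S = "{s. - 3/4 < Re s \<and> Re s < 3/4}"
  have nz: "sin (of_real pi * s) \<noteq> 0" if s: "s \<in> ?S" "s \<noteq> 0" for s :: complex
  proof
    assume "sin (of_real pi * s) = 0"
    then obtain n :: int where "of_real pi * s = of_real (real_of_int n * pi)"
      unfolding sin_eq_0 by auto
    then have "s = of_int n" by (simp add: field_simps)
    then show False using s by auto
  qed
  have "path_integral (vline (1/2)) ?F - path_integral (vline (- 1/2)) ?F
    = (\<Sum>p\<in>{0}. 1 * (gauss_winding (vline (1/2)) p - gauss_winding (vline (- 1/2)) p))"
  proof (rule strip_path_singular_integral[where a="- 3/4" and b="3/4" and \<epsilon>=1 and Y=1 and C="4 * pi"])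
    show "?F holomorphic_on ?S - {0}"
      using nz by (intro holomorphic_intros) auto
    show "((\<lambda>s. (s - p) * ?F s) \<longlongrightarrow> 1) (at p)" if "p \<in> {0}" for p
    proof -
      have "((\<lambda>s::complex. sin (of_real pi * s)) has_field_derivative of_real pi) (at 0)"
        by (auto intro!: derivative_eq_intros)
      then have "((\<lambda>s::complex. sin (of_real pi * s) / s) \<longlongrightarrow> of_real pi) (at 0)"
        by (simp add: has_field_derivative_iff)
      then have "((\<lambda>s::complex. of_real pi / (sin (of_real pi * s) / s)) \<longlongrightarrow> of_real pi / of_real pi) (at 0)"
        by (intro tendsto_intros) auto
      then show ?thesis using that by (simp add: mult.commute)
    qed
    show "norm (?F s) \<le> 4 * pi * exp (- 1 * \<bar>Im s\<bar>)" if "1 \<le> \<bar>Im s\<bar>" for s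
    proof -
      have pi1: "1 \<le> pi" using pi_ge_two by linarith
      have "\<bar>Im s\<bar> \<le> \<bar>Im (of_real pi * s)\<bar>" using pi1 mult_right_mono[of 1 pi "\<bar>Im s\<bar>"] by (simp add: abs_mult)
      then have "exp \<bar>Im s\<bar> / 4 \<le> exp \<bar>Im (of_real pi * s)\<bar> / 4" "1 \<le> \<bar>Im (of_real pi * s)\<bar>"
        using that by simp_all
      then have "exp \<bar>Im s\<bar> / 4 \<le> norm (sin (of_real pi * s))"
        using order_trans norm_sin_ge by blast
      then have "norm (?F s) \<le> pi / (exp \<bar>Im s\<bar> / 4)"
        unfolding norm_divide by (intro frac_le) auto
      then show ?thesis by (simp add: exp_minus field_simps)
    qed
    show "range (vline (1/2)) \<inter> {0} = {}" "range (vline (- 1/2)) \<inter> {0} = {}"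
      by (auto simp: vline_def complex_eq_iff)
  qed (auto simp: strip_path_vline)
  moreover have "path_integral (vline (1/2)) ?F = of_real pi * \<i>" "path_integral (vline (- 1/2)) ?F = - (of_real pi * \<i>)"
    using path_integral_cosecant[of "1/2"] path_integral_cosecant[of "- 1/2"] by (simp_all add: sgn_if)
  ultimately show ?thesis by (simp add: gauss_winding_def mult_ac)
qed

section \<open>Barnes paths and the poles of the integrand\<close>

lemma barnes_path_strip_path: "barnes_path \<beta> g \<Longrightarrow> strip_path g"
  by (simp add: barnes_path_def strip_path_def)

text \<open>Otherwise \<beta> would belong to both families of poles and lie on both sides of the
  path, although the values of \<open>gauss_winding\<close> on the two sides differ by 2 pi
  i.\<close>

lemma barnes_path_not_nonpos_Int:
  assumes "barnes_path \<beta> g"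
  shows "\<beta> \<notin> \<int>\<^sub>\<le>\<^sub>0"
proof
  assume "\<beta> \<in> \<int>\<^sub>\<le>\<^sub>0"
  then have "left_of_path g \<beta>" "right_of_path g \<beta>" using assms by (auto simp: barnes_path_def)
  then show False
    using gauss_winding_left gauss_winding_right barnes_path_strip_path[OF assms] vline_gauss_diff by fastforce
qed

text \<open>A point of the path lies in no component of the complement, hence on neither
  side.\<close>

lemma barnes_path_avoids_poles:
  assumes "barnes_path \<beta> g"
  shows "g t \<notin> \<int>\<^sub>\<le>\<^sub>0" "\<beta> - g t \<notin> \<int>\<^sub>\<le>\<^sub>0"
proof -
  have "g t \<notin> \<int>\<^sub>\<le>\<^sub>0 \<and> \<beta> - g t \<notin> \<int>\<^sub>\<le>\<^sub>0"
  proof (rule ccontr)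
    assume "\<not> ?thesis"
    then have "left_of_path g (g t) \<or> right_of_path g (g t)" using assms by (auto simp: barnes_path_def)
    then obtain q where "connected_component (- range g) (g t) q"
      unfolding left_of_path_def right_of_path_def by auto
    then show False using connected_component_in by fastforce
  qed
  then show "g t \<notin> \<int>\<^sub>\<le>\<^sub>0" "\<beta> - g t \<notin> \<int>\<^sub>\<le>\<^sub>0" by auto
qed

lemma barnes_kernel_holomorphic:
  assumes "z \<noteq> 0" "\<And>s. s \<in> A \<Longrightarrow> s \<notin> \<int>\<^sub>\<le>\<^sub>0" "\<And>s. s \<in> A \<Longrightarrow> \<beta> - s \<notin> \<int>\<^sub>\<le>\<^sub>0"
  shows "barnes_kernel \<beta> z holomorphic_on A"
proof -
  have "barnes_kernel \<beta> z = (\<lambda>s. Gamma (\<beta> - s) * Gamma s * exp (- s * Ln z))"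
    using assms(1) by (auto simp: barnes_kernel_def powr_def)
  moreover have "(\<lambda>s. Gamma (\<beta> - s) * Gamma s * exp (- s * Ln z)) holomorphic_on A"
    using assms(2,3) by (intro holomorphic_intros) auto
  ultimately show ?thesis by simp
qed

lemma barnes_kernel_on_path:
  assumes g: "strip_path g" and z: "z \<notin> \<real>\<^sub>\<le>\<^sub>0"
    and poles: "\<And>t. g t \<notin> \<int>\<^sub>\<le>\<^sub>0" "\<And>t. \<beta> - g t \<notin> \<int>\<^sub>\<le>\<^sub>0"
  shows "integrable lborel (path_integrand g (barnes_kernel \<beta> z))"
proof -
  obtain K where K: "\<And>t. \<bar>Re (g t)\<bar> \<le> K" using strip_path_Re_bound[OF g] by metis
  let ?U = "{s. - K \<le> Re s \<and> Re s \<le> K \<and> s \<notin> \<int>\<^sub>\<le>\<^sub>0 \<and> \<beta> - s \<notin> \<int>\<^sub>\<le>\<^sub>0}"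
  have z0: "z \<noteq> 0" using z by auto
  have rg: "range g \<subseteq> ?U" using K poles by (auto simp: abs_le_iff) (metis minus_le_iff)
  have cont: "continuous_on ?U (barnes_kernel \<beta> z)"
    by (intro holomorphic_on_imp_continuous_on barnes_kernel_holomorphic z0) auto
  obtain C \<epsilon> where C: "0 < \<epsilon>"
    "\<And>s. - K \<le> Re s \<Longrightarrow> Re s \<le> K \<Longrightarrow> 1 + \<bar>Im \<beta>\<bar> \<le> \<bar>Im s\<bar> \<Longrightarrow>
       norm (barnes_kernel \<beta> z s) \<le> C * exp (- \<epsilon> * \<bar>Im s\<bar>)"
    using barnes_kernel_decay[OF z] by metis
  obtain C' where C': "\<And>t. norm (barnes_kernel \<beta> z (g t)) \<le> C' * exp (- \<epsilon> * \<bar>Im (g t)\<bar>)"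
    by (rule strip_path_decay_global[OF g cont rg, of "1 + \<bar>Im \<beta>\<bar>" C \<epsilon>]) (use C(2) in auto)
  show ?thesis by (rule path_integrand_integrable_bound[OF g cont rg C(1) C'])
qed

text \<open>The two families of poles are disjoint, so at each pole the other Gamma factor is
  regular and the pole is simple. At \<beta> + n the mere existence of the limit is enough: these
  poles lie to the right of both paths to be compared, and their contributions cancel.\<close>

lemma barnes_kernel_poles:
  assumes "z \<noteq> 0" "\<beta> \<notin> \<int>\<^sub>\<le>\<^sub>0"
  shows "((\<lambda>s. (s - (- of_nat n)) * barnes_kernel \<beta> z s) \<longlongrightarrow>
    (- 1) ^ n / fact n * Gamma (\<beta> + of_nat n) * z ^ n) (at (- of_nat n))"
    and "\<exists>l. ((\<lambda>s. (s - (\<beta> + of_nat n)) * barnes_kernel \<beta> z s) \<longlongrightarrow> l) (at (\<beta> + of_nat n))"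
proof -
  have bn: "\<beta> + of_nat n \<notin> \<int>\<^sub>\<le>\<^sub>0"
  proof
    assume "\<beta> + of_nat n \<in> \<int>\<^sub>\<le>\<^sub>0"
    then have "(\<beta> + of_nat n) - of_nat n \<in> \<int>\<^sub>\<le>\<^sub>0" by (intro nonpos_Ints_diff_Nats) auto
    then show False using assms(2) by simp
  qed
  have pw: "z powr (- (- of_nat n)) = z ^ n" using assms(1) by (simp add: powr_nat)
  have "((\<lambda>s. (Gamma s * (s + of_nat n)) * Gamma (\<beta> - s) * exp (- s * Ln z)) \<longlongrightarrow>
    ((- 1) ^ n / fact n) * Gamma (\<beta> - (- of_nat n)) * exp (- (- of_nat n) * Ln z)) (at (- of_nat n))"
    by (intro tendsto_mult Gamma_residues isContD continuous_intros) (use bn in auto)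
  moreover have "exp (- (- of_nat n) * Ln z) = z ^ n" using pw assms(1) by (simp add: powr_def)
  ultimately show "((\<lambda>s. (s - (- of_nat n)) * barnes_kernel \<beta> z s) \<longlongrightarrow>
    (- 1) ^ n / fact n * Gamma (\<beta> + of_nat n) * z ^ n) (at (- of_nat n))"
    using assms(1) by (simp add: barnes_kernel_def powr_def mult_ac)
  let ?p = "\<beta> + of_nat n"
  have "((\<lambda>w. Gamma w * (w + of_nat n)) \<longlongrightarrow> (- 1) ^ n / fact n) (at (- of_nat n :: complex))"
    by (rule Gamma_residues)
  moreover have "filterlim (\<lambda>s. \<beta> - s) (at (- of_nat n)) (at ?p)"
  proof (rule filterlim_atI)
    have "((\<lambda>s. \<beta> - s) \<longlongrightarrow> \<beta> - ?p) (at ?p)" by (intro tendsto_intros)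
    then show "((\<lambda>s. \<beta> - s) \<longlongrightarrow> - of_nat n) (at ?p)" by simp
    have "\<forall>\<^sub>F s in at ?p. s \<noteq> ?p" by (simp add: eventually_at_filter)
    then show "\<forall>\<^sub>F s in at ?p. \<beta> - s \<noteq> - of_nat n" by eventually_elim (auto simp: algebra_simps)
  qed
  ultimately have "((\<lambda>s. Gamma (\<beta> - s) * ((\<beta> - s) + of_nat n)) \<longlongrightarrow> (- 1) ^ n / fact n) (at ?p)"
    by (rule filterlim_compose)
  then have "((\<lambda>s. - (Gamma (\<beta> - s) * ((\<beta> - s) + of_nat n)) * Gamma s * exp (- s * Ln z)) \<longlongrightarrow>
      - ((- 1) ^ n / fact n) * Gamma ?p * exp (- ?p * Ln z)) (at ?p)"
    by (intro tendsto_mult tendsto_minus isContD continuous_intros) (use bn in auto)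
  then have "((\<lambda>s. (s - (\<beta> + of_nat n)) * barnes_kernel \<beta> z s) \<longlongrightarrow>
      - ((- 1) ^ n / fact n) * Gamma ?p * exp (- ?p * Ln z)) (at ?p)"
    by (rule Lim_transform_eventually)
       (use assms(1) in \<open>auto simp: barnes_kernel_def powr_def algebra_simps intro!: always_eventually\<close>)
  then show "\<exists>l. ((\<lambda>s. (s - (\<beta> + of_nat n)) * barnes_kernel \<beta> z s) \<longlongrightarrow> l) (at (\<beta> + of_nat n))" by blast
qed

lemma right_of_vline: "\<sigma> < Re p \<Longrightarrow> right_of_path (vline \<sigma>) p"
  unfolding right_of_path_def by (intro exI[of _ p]) (auto simp: vline_def complex_eq_iff)

lemma finite_nat_real_bounded: "finite {n::nat. real n < x}"
proof -
  obtain N :: nat where "x < real N" using reals_Archimedean2 by blast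
  then have "{n::nat. real n < x} \<subseteq> {..N}" by auto
  then show ?thesis using finite_subset by blast
qed

lemma vline_avoids_poles:
  "vline (- real N - 1/2) t \<notin> \<int>\<^sub>\<le>\<^sub>0"
  "- real N - 1/2 < Re \<beta> \<Longrightarrow> \<beta> - vline (- real N - 1/2) t \<notin> \<int>\<^sub>\<le>\<^sub>0"
proof -
  show "vline (- real N - 1/2) t \<notin> \<int>\<^sub>\<le>\<^sub>0"
  proof
    assume "vline (- real N - 1/2) t \<in> \<int>\<^sub>\<le>\<^sub>0"
    then obtain m where "vline (- real N - 1/2) t = - of_nat m" by (auto elim: nonpos_Ints_cases')
    then have "Re (vline (- real N - 1/2) t) = Re (- of_nat m)" by (rule arg_cong)
    then have "real m = real N + 1/2" by simp
    then have "real (2 * m) = real (2 * N + 1)" by simp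
    then have "2 * m = 2 * N + 1" by (simp only: of_nat_eq_iff)
    then show False by presburger
  qed
  show "\<beta> - vline (- real N - 1/2) t \<notin> \<int>\<^sub>\<le>\<^sub>0" if "- real N - 1/2 < Re \<beta>"
  proof
    assume "\<beta> - vline (- real N - 1/2) t \<in> \<int>\<^sub>\<le>\<^sub>0"
    then obtain m where "\<beta> - vline (- real N - 1/2) t = - of_nat m" by (auto elim: nonpos_Ints_cases')
    then have "Re (\<beta> - vline (- real N - 1/2) t) = Re (- of_nat m)" by (rule arg_cong)
    then show False using that by simp
  qed
qed

text \<open>Only poles between the path and the line count. The points 0, -1, ..., -N lie left of
  the path and right of the line; every other pole in the strip lies on the same side of both, so
  its two winding integrals are equal. The condition on \<open>N\<close> puts all the points \<beta>
  + n to the right of the line.\<close>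

lemma barnes_path_shift:
  assumes bp: "barnes_path \<beta> g" and z: "z \<notin> \<real>\<^sub>\<le>\<^sub>0" and N: "- real N - 1/2 < Re \<beta>"
  shows "path_integral g (barnes_kernel \<beta> z) = path_integral (vline (- real N - 1/2)) (barnes_kernel \<beta> z)
    + 2 * of_real pi * \<i> * (\<Sum>n\<le>N. (- 1) ^ n / fact n * Gamma (\<beta> + of_nat n) * z ^ n)"
proof -
  let ?\<sigma> = "- real N - 1/2"
  let ?F = "barnes_kernel \<beta> z"
  have g: "strip_path g" using bp by (rule barnes_path_strip_path)
  have z0: "z \<noteq> 0" using z by auto
  have b0: "\<beta> \<notin> \<int>\<^sub>\<le>\<^sub>0" by (rule barnes_path_not_nonpos_Int[OF bp])
  obtain K where K: "0 < K" "\<And>t. \<bar>Re (g t)\<bar> \<le> K" by (rule strip_path_Re_bound[OF g]) blast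
  \<comment> \<open>The strip a < Re s < b must contain both the path and the line. It holds
    finitely many poles of each family, cut off by \<open>a\<close> on the left and by
    \<open>b\<close> on the right.\<close>
  define a where "a = min (?\<sigma> - 1/4) (- K - 1)"
  define b where "b = K + 1"
  have ab: "a < ?\<sigma>" "0 < b" "a < - K" "?\<sigma> < b" using K(1) by (auto simp: a_def b_def)
  define PL where "PL = (\<lambda>n. - of_nat n :: complex) ` {n. real n < - a}"
  define PR where "PR = (\<lambda>n. \<beta> + of_nat n) ` {n. real n < b - Re \<beta>}"
  have poles: "p \<in> \<int>\<^sub>\<le>\<^sub>0 \<or> \<beta> - p \<in> \<int>\<^sub>\<le>\<^sub>0" if "p \<in> PL \<union> PR" for p
    using that by (auto simp: PL_def PR_def)
  have finL: "finite PL" "finite PR" unfolding PL_def PR_def by (intro finite_imageI finite_nat_real_bounded)+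
  have dis: "PL \<inter> PR = {}"
  proof (rule ccontr)
    assume "PL \<inter> PR \<noteq> {}"
    then obtain n m where "- of_nat n = \<beta> + of_nat m" by (auto simp: PL_def PR_def)
    then have "\<beta> = - of_nat (n + m)" by (simp add: algebra_simps)
    then show False using b0 by (metis minus_of_nat_in_nonpos_Ints)
  qed
  have PRg: "right_of_path g p" "right_of_path (vline ?\<sigma>) p" if "p \<in> PR" for p
  proof -
    from that obtain n where n: "p = \<beta> + of_nat n" by (auto simp: PR_def)
    show "right_of_path g p" using bp unfolding barnes_path_def n by simp
    show "right_of_path (vline ?\<sigma>) p" by (rule right_of_vline) (use N n in auto)
  qed
  have PLg: "left_of_path g p" if "p \<in> PL" for p
    using that bp unfolding barnes_path_def PL_def by auto
  \<comment> \<open>The line at -N - 1/2 runs between -N and -N - 1, so the poles beyond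
    \<open>N\<close> stay on its left.\<close>
  have vl: "gauss_winding (vline ?\<sigma>) (- of_nat n) = 
      (if n \<le> N then path_integral (vline (- 1/2)) gauss_kernel else path_integral (vline (1/2)) gauss_kernel)" for n
  proof (cases "n \<le> N")
    case True
    then show ?thesis using gauss_winding_right[OF strip_path_vline right_of_vline[of ?\<sigma> "- of_nat n"]] by simp
  next
    case False
    have "left_of_path (vline ?\<sigma>) (- of_nat n)"
      unfolding left_of_path_def using False
      by (intro exI[of _ "- of_nat n"]) (auto simp: vline_def complex_eq_iff)
    then show ?thesis using gauss_winding_left[OF strip_path_vline] False by simp
  qed
  have "\<exists>l. ((\<lambda>s. (s - p) * ?F s) \<longlongrightarrow> l) (at p)" if "p \<in> PL \<union> PR" for p
    using that barnes_kernel_poles[OF z0 b0] unfolding PL_def PR_def by blast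
  then obtain c where c: "\<And>p. p \<in> PL \<union> PR \<Longrightarrow> ((\<lambda>s. (s - p) * ?F s) \<longlongrightarrow> c p) (at p)" by metis
  obtain C \<epsilon> where C: "0 < C" "0 < \<epsilon>"
    "\<And>s. a \<le> Re s \<Longrightarrow> Re s \<le> b \<Longrightarrow> 1 + \<bar>Im \<beta>\<bar> \<le> \<bar>Im s\<bar> \<Longrightarrow> norm (?F s) \<le> C * exp (- \<epsilon> * \<bar>Im s\<bar>)"
    by (rule barnes_kernel_decay[OF z]) blast
  have "path_integral g ?F - path_integral (vline ?\<sigma>) ?F
      = (\<Sum>p\<in>PL \<union> PR. c p * (gauss_winding g p - gauss_winding (vline ?\<sigma>) p))"
  proof (rule strip_path_singular_integral[where a=a and b=b and \<epsilon>="min \<epsilon> 1" and Y="1 + \<bar>Im \<beta>\<bar>" and C=C])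
    show "?F holomorphic_on {s. a < Re s \<and> Re s < b} - (PL \<union> PR)"
    proof (rule barnes_kernel_holomorphic[OF z0])
      fix s assume s: "s \<in> {s. a < Re s \<and> Re s < b} - (PL \<union> PR)"
      show "s \<notin> \<int>\<^sub>\<le>\<^sub>0"
      proof
        assume "s \<in> \<int>\<^sub>\<le>\<^sub>0"
        then obtain n where "s = - of_nat n" by (auto elim: nonpos_Ints_cases')
        then show False using s by (auto simp: PL_def)
      qed
      show "\<beta> - s \<notin> \<int>\<^sub>\<le>\<^sub>0"
      proof
        assume "\<beta> - s \<in> \<int>\<^sub>\<le>\<^sub>0"
        then obtain n where "\<beta> - s = - of_nat n" by (auto elim: nonpos_Ints_cases')
        then have "s = \<beta> + of_nat n" by (simp add: algebra_simps)
        then show False using s by (auto simp: PR_def)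
      qed
    qed
    show "a < Re p \<and> Re p < b" if "p \<in> PL \<union> PR" for p
      using that ab N by (auto simp: PL_def PR_def)
    show "norm (?F s) \<le> C * exp (- min \<epsilon> 1 * \<bar>Im s\<bar>)"
      if "a < Re s" "Re s < b" "1 + \<bar>Im \<beta>\<bar> \<le> \<bar>Im s\<bar>" for s
    proof -
      have "norm (?F s) \<le> C * exp (- \<epsilon> * \<bar>Im s\<bar>)" using that by (intro C(3)) auto
      also have "\<dots> \<le> C * exp (- min \<epsilon> 1 * \<bar>Im s\<bar>)"
        using C(1) by (auto intro!: mult_left_mono mult_right_mono)
      finally show ?thesis .
    qed
    show "a < Re (g t) \<and> Re (g t) < b" for t using K(2)[of t] ab by (auto simp: b_def)
    show "range g \<inter> (PL \<union> PR) = {}"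
      using barnes_path_avoids_poles[OF bp] poles by blast
    show "range (vline ?\<sigma>) \<inter> (PL \<union> PR) = {}"
      using vline_avoids_poles[where N=N] N poles by blast
  qed (use c ab C strip_path_vline g finL in auto)
  also have "\<dots> = (\<Sum>p\<in>PL. c p * (gauss_winding g p - gauss_winding (vline ?\<sigma>) p))
      + (\<Sum>p\<in>PR. c p * (gauss_winding g p - gauss_winding (vline ?\<sigma>) p))"
    by (rule sum.union_disjoint[OF finL dis])
  also have "(\<Sum>p\<in>PR. c p * (gauss_winding g p - gauss_winding (vline ?\<sigma>) p)) = 0"
    using PRg g strip_path_vline by (intro sum.neutral) (simp add: gauss_winding_right)
  also have "(\<Sum>p\<in>PL. c p * (gauss_winding g p - gauss_winding (vline ?\<sigma>) p)) =
      (\<Sum>n | real n < - a. c (- of_nat n) * (gauss_winding g (- of_nat n) - gauss_winding (vline ?\<sigma>) (- of_nat n)))"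
    unfolding PL_def by (subst sum.reindex) (auto simp: inj_on_def)
  also have "\<dots> = (\<Sum>n | real n < - a. if n \<le> N then 2 * of_real pi * \<i> * ((- 1) ^ n / fact n * Gamma (\<beta> + of_nat n) * z ^ n) else 0)"
  proof (rule sum.cong[OF refl])
    fix n assume n: "n \<in> {n. real n < - a}"
    then have p: "- of_nat n \<in> PL" by (auto simp: PL_def)
    have "c (- of_nat n) = (- 1) ^ n / fact n * Gamma (\<beta> + of_nat n) * z ^ n"
      by (rule tendsto_unique[OF _ c barnes_kernel_poles(1)[OF z0 b0]]) (use p in auto)
    moreover have "gauss_winding g (- of_nat n) = path_integral (vline (1/2)) gauss_kernel"
      by (rule gauss_winding_left[OF g PLg[OF p]])
    ultimately show "c (- of_nat n) * (gauss_winding g (- of_nat n) - gauss_winding (vline ?\<sigma>) (- of_nat n)) =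
        (if n \<le> N then 2 * of_real pi * \<i> * ((- 1) ^ n / fact n * Gamma (\<beta> + of_nat n) * z ^ n) else 0)"
      by (simp only: vl if_distrib[of "\<lambda>x. _ - x"] if_distrib[of "\<lambda>x. _ * x"] vline_gauss_diff diff_self mult_zero_right mult_ac split: if_split)
         (simp add: vline_gauss_diff[symmetric])
  qed
  also have "\<dots> = (\<Sum>n\<le>N. 2 * of_real pi * \<i> * ((- 1) ^ n / fact n * Gamma (\<beta> + of_nat n) * z ^ n))"
  proof (rule sum.mono_neutral_cong_right)
    show "finite {n. real n < - a}" by (rule finite_nat_real_bounded)
    show "{..N} \<subseteq> {n. real n < - a}" using ab by auto
  qed auto
  finally show ?thesis by (simp add: sum_distrib_left algebra_simps)
qed

section \<open>Moving the line to the far left\<close>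

lemma barnes_kernel_shift:
  assumes "s - 1 \<notin> \<int>\<^sub>\<le>\<^sub>0" "\<beta> - s \<notin> \<int>\<^sub>\<le>\<^sub>0" "z \<noteq> 0"
  shows "barnes_kernel \<beta> z (s - 1) = z * ((\<beta> - s) / (s - 1)) * barnes_kernel \<beta> z s"
proof -
  have "Gamma (\<beta> - (s - 1)) = (\<beta> - s) * Gamma (\<beta> - s)"
    using Gamma_plus1[OF assms(2)] by (simp add: algebra_simps)
  moreover have "Gamma s = (s - 1) * Gamma (s - 1)" using Gamma_plus1[OF assms(1)] by simp
  moreover have "s \<noteq> 1" using assms(1) by auto
  moreover have "z powr (- (s - 1)) = z * z powr (- s)"
    using assms(3) by (simp add: powr_def exp_diff exp_add exp_minus field_simps)
  ultimately show ?thesis by (simp add: barnes_kernel_def)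
qed

text \<open>The factor between neighbouring lines is bounded uniformly in the height, by |z| (1 +
  |\<beta> - 1| / (N + 3/2)), where N + 3/2 is the modulus of Re (s - 1). From some \<open>M\<close>
  on this is below a fixed \<rho> < 1, and the integrals are compared with the one on the line
  number \<open>M\<close>.\<close>

lemma barnes_kernel_left_limit:
  assumes z: "z \<notin> \<real>\<^sub>\<le>\<^sub>0" "norm z < 1"
  shows "(\<lambda>N. path_integral (vline (- real N - 1/2)) (barnes_kernel \<beta> z)) \<longlonglongrightarrow> 0"
proof -
  let ?f = "\<lambda>N t. barnes_kernel \<beta> z (vline (- real N - 1/2) t)"
  have z0: "z \<noteq> 0" using z by auto
  \<comment> \<open>Midway between |z| and 1.\<close>
  define \<rho> where "\<rho> = (1 + norm z) / 2"
  have \<rho>: "0 < \<rho>" "\<rho> < 1" using z by (auto simp: \<rho>_def add_pos_nonneg)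
  have "(\<lambda>N. norm z * (1 + norm (\<beta> - 1) / (real N + 3/2))) \<longlonglongrightarrow> norm z" by real_asymp
  moreover have "norm z < \<rho>" using z by (simp add: \<rho>_def)
  ultimately have "\<forall>\<^sub>F N in sequentially. norm z * (1 + norm (\<beta> - 1) / (real N + 3/2)) < \<rho>"
    by (rule order_tendstoD)
  moreover have "\<forall>\<^sub>F N in sequentially. - real N - 1/2 < Re \<beta>" by real_asymp
  ultimately have "\<forall>\<^sub>F N in sequentially. norm z * (1 + norm (\<beta> - 1) / (real N + 3/2)) < \<rho> \<and> - real N - 1/2 < Re \<beta>"
    by (rule eventually_conj)
  then obtain M where M: "\<And>N. M \<le> N \<Longrightarrow> norm z * (1 + norm (\<beta> - 1) / (real N + 3/2)) < \<rho>"
      "\<And>N. M \<le> N \<Longrightarrow> - real N - 1/2 < Re \<beta>"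
    by (auto simp: eventually_sequentially)
  have step: "norm (?f (Suc N) t) \<le> \<rho> * norm (?f N t)" if N: "M \<le> N" for N t
  proof -
    let ?s = "vline (- real N - 1/2) t"
    have eq: "vline (- real (Suc N) - 1/2) t = ?s - 1" by (simp add: vline_def complex_eq_iff)
    have big: "real N + 3/2 \<le> norm (?s - 1)" using abs_Re_le_cmod[of "?s - 1"] by simp
    have "?f (Suc N) t = z * ((\<beta> - ?s) / (?s - 1)) * ?f N t"
      unfolding eq
    proof (rule barnes_kernel_shift[OF _ _ z0])
      show "?s - 1 \<notin> \<int>\<^sub>\<le>\<^sub>0" unfolding eq[symmetric] by (rule vline_avoids_poles)
      show "\<beta> - ?s \<notin> \<int>\<^sub>\<le>\<^sub>0" by (rule vline_avoids_poles M N)+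
    qed
    then have "norm (?f (Suc N) t) = norm z * (norm (\<beta> - ?s) / norm (?s - 1)) * norm (?f N t)"
      by (simp add: norm_mult norm_divide)
    also have "\<dots> \<le> \<rho> * norm (?f N t)"
    proof (rule mult_right_mono)
      have pos: "0 < norm (?s - 1)" using big by linarith
      have "norm (\<beta> - ?s) \<le> norm (\<beta> - 1) + norm (?s - 1)"
        using norm_triangle_ineq4[of "\<beta> - 1" "?s - 1"] by simp
      then have "norm (\<beta> - ?s) / norm (?s - 1) \<le> (norm (\<beta> - 1) + norm (?s - 1)) / norm (?s - 1)"
        using pos by (intro divide_right_mono) auto
      also have "\<dots> = 1 + norm (\<beta> - 1) / norm (?s - 1)" using pos by (simp add: add_divide_distrib)
      also have "\<dots> \<le> 1 + norm (\<beta> - 1) / (real N + 3/2)" using big by (intro add_left_mono divide_left_mono) (auto intro: mult_pos_pos pos)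
      finally have "norm z * (norm (\<beta> - ?s) / norm (?s - 1)) \<le> norm z * (1 + norm (\<beta> - 1) / (real N + 3/2))"
        by (intro mult_left_mono) auto
      then show "norm z * (norm (\<beta> - ?s) / norm (?s - 1)) \<le> \<rho>" using M(1)[OF N] by linarith
    qed simp
    finally show ?thesis .
  qed
  have geo: "norm (?f (k + M) t) \<le> \<rho> ^ k * norm (?f M t)" for k t
  proof (induction k)
    case (Suc k)
    have "norm (?f (Suc k + M) t) \<le> \<rho> * norm (?f (k + M) t)" using step[of "k + M" t] by simp
    also have "\<dots> \<le> \<rho> * (\<rho> ^ k * norm (?f M t))" using Suc \<rho> by (intro mult_left_mono) auto
    finally show ?case by (simp add: mult.assoc)
  qed simp
  have int: "integrable lborel (path_integrand (vline (- real N - 1/2)) (barnes_kernel \<beta> z))" if "M \<le> N" for N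
    by (rule barnes_kernel_on_path[OF strip_path_vline z(1)]) (rule vline_avoids_poles M that)+
  define I where "I = (LINT t|lborel. norm (path_integrand (vline (- real M - 1/2)) (barnes_kernel \<beta> z) t))"
  have "norm (path_integral (vline (- real (k + M) - 1/2)) (barnes_kernel \<beta> z)) \<le> \<rho> ^ k * I" for k
  proof -
    have "norm (path_integral (vline (- real (k + M) - 1/2)) (barnes_kernel \<beta> z)) \<le>
       (LINT t|lborel. \<rho> ^ k * norm (path_integrand (vline (- real M - 1/2)) (barnes_kernel \<beta> z) t))"
      unfolding path_integral_def
    proof (rule Bochner_Integration.integral_norm_bound_integral)
      show "norm (path_integrand (vline (- real (k + M) - 1/2)) (barnes_kernel \<beta> z) t)
         \<le> \<rho> ^ k * norm (path_integrand (vline (- real M - 1/2)) (barnes_kernel \<beta> z) t)" for t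
        using geo[of k t] by (simp add: path_integrand_vline norm_mult)
      show "integrable lborel (path_integrand (vline (- real (k + M) - 1/2)) (barnes_kernel \<beta> z))"
        by (rule int) simp
      show "integrable lborel (\<lambda>t. \<rho> ^ k * norm (path_integrand (vline (- real M - 1/2)) (barnes_kernel \<beta> z) t))"
        by (rule integrable_mult_right[OF integrable_norm[OF int]]) simp
    qed
    then show ?thesis by (simp add: I_def)
  qed
  then have bnd: "\<forall>k. norm (path_integral (vline (- real (k + M) - 1/2)) (barnes_kernel \<beta> z)) \<le> \<rho> ^ k * I"
    by blast
  have "(\<lambda>k. \<rho> ^ k * I) \<longlonglongrightarrow> 0"
    using \<rho> by (intro tendsto_mult_left_zero LIMSEQ_power_zero) auto
  then have "(\<lambda>k. path_integral (vline (- real (k + M) - 1/2)) (barnes_kernel \<beta> z)) \<longlonglongrightarrow> 0"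
    by (rule Lim_null_comparison[OF always_eventually[OF bnd]])
  then show ?thesis by (rule LIMSEQ_offset)
qed

lemma barnes_integral:
  assumes bp: "barnes_path \<beta> g" and z: "z \<notin> \<real>\<^sub>\<le>\<^sub>0" "norm z < 1"
  shows "path_integral g (barnes_kernel \<beta> z) = 2 * of_real pi * \<i> * Gamma \<beta> * (1 + z) powr (- \<beta>)"
proof -
  have b0: "\<beta> \<notin> \<int>\<^sub>\<le>\<^sub>0" by (rule barnes_path_not_nonpos_Int[OF bp])
  \<comment> \<open>Gamma(\<beta> + n) is Gamma(\<beta>) times a Pochhammer symbol, and the sign
    turns that symbol over n! into the binomial coefficient of -\<beta>.\<close>
  have coeff: "(- 1) ^ n / fact n * Gamma (\<beta> + of_nat n) * z ^ n = Gamma \<beta> * (((- \<beta>) gchoose n) * z ^ n)" for n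
  proof -
    have "Gamma \<beta> \<noteq> 0" using b0 by (simp add: Gamma_eq_zero_iff)
    then have "Gamma (\<beta> + of_nat n) = Gamma \<beta> * pochhammer \<beta> n"
      using pochhammer_Gamma[OF b0, of n] by simp
    then show ?thesis by (simp add: gbinomial_pochhammer)
  qed
  have "(\<lambda>N. \<Sum>n\<le>N. ((- \<beta>) gchoose n) * z ^ n) \<longlonglongrightarrow> (1 + z) powr (- \<beta>)"
    using gen_binomial_complex[OF z(2), of "- \<beta>"] by (simp add: sums_def_le)
  then have "(\<lambda>N. path_integral (vline (- real N - 1/2)) (barnes_kernel \<beta> z)
      + 2 * of_real pi * \<i> * (Gamma \<beta> * (\<Sum>n\<le>N. ((- \<beta>) gchoose n) * z ^ n)))
      \<longlonglongrightarrow> 0 + 2 * of_real pi * \<i> * (Gamma \<beta> * (1 + z) powr (- \<beta>))"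
    by (intro tendsto_add tendsto_mult tendsto_const barnes_kernel_left_limit z)
  moreover have "\<forall>\<^sub>F N in sequentially. path_integral (vline (- real N - 1/2)) (barnes_kernel \<beta> z)
      + 2 * of_real pi * \<i> * (Gamma \<beta> * (\<Sum>n\<le>N. ((- \<beta>) gchoose n) * z ^ n)) = path_integral g (barnes_kernel \<beta> z)"
  proof -
    have "\<forall>\<^sub>F N in sequentially. - real N - 1/2 < Re \<beta>" by real_asymp
    then show ?thesis
    proof eventually_elim
      case (elim N)
      then show ?case by (simp only: barnes_path_shift[OF bp z(1) elim] coeff sum_distrib_left)
    qed
  qed
  ultimately have "(\<lambda>N::nat. path_integral g (barnes_kernel \<beta> z)) \<longlonglongrightarrow> 0 + 2 * of_real pi * \<i> * (Gamma \<beta> * (1 + z) powr (- \<beta>))"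
    by (rule Lim_transform_eventually)
  from LIMSEQ_unique[OF tendsto_const this] show ?thesis by (simp add: mult.assoc)
qed

section \<open>The extended Lauricella function\<close>

text \<open>A product majorant reduces joint integrability to two separate integrals.
  \<open>M\<close> will be the counting measure on multi-indices for the series and the Lebesgue
  product measure for the contour integrals; \<open>N\<close> is Lebesgue measure in t both
  times.\<close>

lemma dominated_Fubini:
  fixes f :: "'a \<Rightarrow> 'b \<Rightarrow> complex"
  assumes "sigma_finite_measure M" "sigma_finite_measure N"
    and f: "(\<lambda>(x, y). f x y) \<in> borel_measurable (M \<Otimes>\<^sub>M N)"
    and HK: "integrable M (H :: 'a \<Rightarrow> real)" "integrable N (K :: 'b \<Rightarrow> real)"
    and bound: "\<And>x y. norm (f x y) \<le> H x * K y"
  shows "integrable M (\<lambda>x. LINT y|N. f x y)"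
    and "(LINT x|M. LINT y|N. f x y) = (LINT y|N. LINT x|M. f x y)"
proof -
  interpret M: sigma_finite_measure M by fact
  interpret N: sigma_finite_measure N by fact
  interpret pair_sigma_finite M N ..
  have [measurable]: "H \<in> borel_measurable M" "K \<in> borel_measurable N" using HK by auto
  have "integrable (M \<Otimes>\<^sub>M N) (\<lambda>p. H (fst p) * K (snd p))"
  proof (rule Fubini_integrable)
    show "(\<lambda>p. H (fst p) * K (snd p)) \<in> borel_measurable (M \<Otimes>\<^sub>M N)" by measurable
    show "integrable M (\<lambda>x. LINT y|N. norm (H (fst (x, y)) * K (snd (x, y))))"
      using HK by (simp add: abs_mult)
    show "AE x in M. integrable N (\<lambda>y. H (fst (x, y)) * K (snd (x, y)))" using HK by simp
  qed
  then have int: "integrable (M \<Otimes>\<^sub>M N) (\<lambda>(x, y). f x y)"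
  proof (rule Bochner_Integration.integrable_bound[OF _ f])
    show "AE p in M \<Otimes>\<^sub>M N. norm (case p of (x, y) \<Rightarrow> f x y) \<le> norm (H (fst p) * K (snd p))"
    proof (rule AE_I2)
      fix p
      show "norm (case p of (x, y) \<Rightarrow> f x y) \<le> norm (H (fst p) * K (snd p))"
        using bound[of "fst p" "snd p"] by (auto simp: case_prod_beta intro: order_trans[OF _ abs_ge_self])
    qed
  qed
  show "integrable M (\<lambda>x. LINT y|N. f x y)" using integrable_fst'[OF int] by simp
  show "(LINT x|M. LINT y|N. f x y) = (LINT y|N. LINT x|M. f x y)"
    using Fubini_integral[OF int] by simp
qed

lemma ext_beta_integrand_diff:
  assumes "0 < t"
  shows "ext_beta_integrand \<Theta> b d (\<alpha> - S) \<beta> t = ext_beta_integrand \<Theta> b d \<alpha> \<beta> t * exp (- S * of_real (ln t))"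
proof -
  have "of_real t powr (\<alpha> - S - 1) = of_real t powr (\<alpha> - 1) * exp (- S * of_real (ln t))"
    using assms by (simp add: powr_def Ln_of_real algebra_simps flip: exp_add)
  then show ?thesis by (simp add: ext_beta_integrand_def)
qed

text \<open>The power t powr (-S) is written as an exponential so that, for S a sum of the s_j, it
  splits into one factor for each j. Outside (0, 1) the indicator makes both integrands 0, whatever
  \<open>ln\<close> is there.\<close>

lemma ext_beta_diff:
  "ext_beta \<Theta> b d (\<alpha> - S) \<beta> =
    (LINT t|lborel. indicator {0<..<1} t *\<^sub>R ext_beta_integrand \<Theta> b d \<alpha> \<beta> t * exp (- S * of_real (ln t)))"
  unfolding ext_beta_def set_lebesgue_integral_def
  by (intro Bochner_Integration.integral_cong) (auto simp: ext_beta_integrand_diff indicator_def)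

text \<open>For t > 0 the logarithm of t z splits without a branch correction.\<close>

lemma barnes_kernel_scale:
  assumes "0 < t" "z \<noteq> 0"
  shows "barnes_kernel \<beta> z s * exp (- s * of_real (ln t)) = barnes_kernel \<beta> (of_real t * z) s"
proof -
  have "Ln (of_real t * z) = of_real (ln t) + Ln z"
    using assms by (simp add: Ln_times_of_real Ln_of_real)
  then have "exp (- s * Ln (of_real t * z)) = exp (- s * Ln z) * exp (- s * of_real (ln t))"
    by (simp only: distrib_left exp_add mult.commute)
  then show ?thesis using assms by (simp only: barnes_kernel_def powr_def) simp
qed

lemma barnes_integral_scaled:
  assumes bp: "barnes_path \<beta> g" and x: "norm x < 1" "- x \<notin> \<real>\<^sub>\<le>\<^sub>0" and t: "0 < t" "t < 1"
  shows "(LINT u|lborel. path_integrand g (barnes_kernel \<beta> (- x)) u / Gamma \<beta> * exp (- g u * of_real (ln t)))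
    = 2 * of_real pi * \<i> * (1 - of_real t * x) powr (- \<beta>)"
proof -
  have x0: "- x \<noteq> 0" using x(2) by auto
  have "Gamma \<beta> \<noteq> 0" using barnes_path_not_nonpos_Int[OF bp] by (simp add: Gamma_eq_zero_iff)
  have "of_real t * (- x) \<notin> \<real>\<^sub>\<le>\<^sub>0"
    using x(2) t by (auto simp: complex_nonpos_Reals_iff mult_le_0_iff zero_le_mult_iff)
  moreover have "norm (of_real t * (- x)) < 1"
    using mult_strict_mono'[of t 1 "norm x" 1] x(1) t by (simp add: norm_mult)
  ultimately have main: "path_integral g (barnes_kernel \<beta> (of_real t * (- x))) 
      = 2 * of_real pi * \<i> * Gamma \<beta> * (1 + of_real t * (- x)) powr (- \<beta>)"
    by (rule barnes_integral[OF bp])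
  have "path_integrand g (barnes_kernel \<beta> (- x)) u / Gamma \<beta> * exp (- g u * of_real (ln t)) =
     path_integrand g (barnes_kernel \<beta> (of_real t * (- x))) u / Gamma \<beta>" for u
    unfolding path_integrand_def barnes_kernel_scale[OF t(1) x0, symmetric] by simp
  then have "(LINT u|lborel. path_integrand g (barnes_kernel \<beta> (- x)) u / Gamma \<beta> * exp (- g u * of_real (ln t)))
    = path_integral g (barnes_kernel \<beta> (of_real t * (- x))) / Gamma \<beta>"
    by (simp only: path_integral_def integral_divide_zero)
  also have "\<dots> = 2 * of_real pi * \<i> * (1 - of_real t * x) powr (- \<beta>)"
    unfolding main using \<open>Gamma \<beta> \<noteq> 0\<close> by simp
  finally show ?thesis .
qed

lemma binomial_series:
  fixes x \<beta> :: complex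
  assumes "norm x < 1"
  shows "summable (\<lambda>n. norm (pochhammer \<beta> n * x ^ n / fact n))"
    and "(\<Sum>n. pochhammer \<beta> n * x ^ n / fact n) = (1 - x) powr (- \<beta>)"
proof -
  have eq: "pochhammer \<beta> n * x ^ n / fact n = ((- \<beta>) gchoose n) * (- x) ^ n" for n
  proof -
    have "((- \<beta>) gchoose n) * (- x) ^ n = pochhammer \<beta> n * ((- 1) ^ n * (- x) ^ n) / fact n"
      by (simp add: gbinomial_pochhammer)
    also have "(- 1) ^ n * (- x) ^ n = x ^ n" by (simp flip: power_mult_distrib)
    finally show ?thesis by simp
  qed
  have "conv_radius (\<lambda>n. (- \<beta>) gchoose n) \<ge> 1" by (simp add: conv_radius_gchoose)
  then have "ereal (norm (- x)) < conv_radius (\<lambda>n. (- \<beta>) gchoose n)"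
    using assms by (simp add: less_le_trans[of _ 1])
  then show "summable (\<lambda>n. norm (pochhammer \<beta> n * x ^ n / fact n))"
    unfolding eq by (rule abs_summable_in_conv_radius)
  show "(\<Sum>n. pochhammer \<beta> n * x ^ n / fact n) = (1 - x) powr (- \<beta>)"
    unfolding eq using gen_binomial_complex[of "- x" "- \<beta>"] assms by (simp add: sums_iff)
qed

text \<open>As 0 < t < 1, powers of t only shrink the terms. So the product of the absolutely
  convergent binomial series, free of t, times the beta integrand is a majorant; it justifies the
  exchange of sum and integral and gives the convergence of the multiple series.\<close>

lemma ext_lauricella_FD_eq_integral:
  fixes x \<beta> :: "'r::finite \<Rightarrow> complex"
  assumes E: "set_integrable lborel {0<..<1} (ext_beta_integrand \<Theta> b d \<alpha> (\<gamma> - \<alpha>))"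
    and x: "\<And>j. norm (x j) < 1"
  shows "ext_lauricella_FD_term \<Theta> \<alpha> \<beta> \<gamma> x b d summable_on UNIV"
    and "ext_lauricella_FD \<Theta> \<alpha> \<beta> \<gamma> x b d = (LINT t|lborel. indicator {0<..<1} t *\<^sub>R
      ext_beta_integrand \<Theta> b d \<alpha> (\<gamma> - \<alpha>) t * (\<Prod>j\<in>UNIV. (1 - of_real t * x j) powr (- \<beta> j))) / Beta \<alpha> (\<gamma> - \<alpha>)"
proof -
  define E0 where "E0 t = indicator {0<..<1} t *\<^sub>R ext_beta_integrand \<Theta> b d \<alpha> (\<gamma> - \<alpha>) t" for t
  have intE: "integrable lborel E0" using E unfolding set_integrable_def E0_def[abs_def] .
  then have [measurable]: "E0 \<in> borel_measurable borel" by auto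
  define c where "c j n = pochhammer (\<beta> j) n * x j ^ n / fact n" for j n
  define f where "f m t = E0 t * (\<Prod>j\<in>UNIV. c j (m j) * of_real t ^ m j)" for m :: "'r \<Rightarrow> nat" and t
  \<comment> \<open>A sum over all multi-indices of a product of one-variable terms is the product
    of the single series. As the index type is finite, multi-indices are an extensional product over
    all of it.\<close>
  have prod_summable: "Infinite_Set_Sum.abs_summable_on (\<lambda>m. \<Prod>j\<in>UNIV. h j (m j)) (UNIV :: ('r \<Rightarrow> nat) set)"
    and prod_sum: "infsetsum (\<lambda>m. \<Prod>j\<in>UNIV. h j (m j)) (UNIV :: ('r \<Rightarrow> nat) set) = (\<Prod>j\<in>UNIV. \<Sum>n. h j n)"
    if "\<And>j. summable (\<lambda>n. norm (h j n))" for h :: "'r \<Rightarrow> nat \<Rightarrow> complex"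
  proof -
    have U: "PiE (UNIV :: 'r set) (\<lambda>_. UNIV :: nat set) = UNIV" by (simp add: PiE_UNIV_domain)
    have s: "Infinite_Set_Sum.abs_summable_on (h j) UNIV" for j using that by (simp add: abs_summable_on_nat_iff')
    show "Infinite_Set_Sum.abs_summable_on (\<lambda>m. \<Prod>j\<in>UNIV. h j (m j)) (UNIV :: ('r \<Rightarrow> nat) set)"
      using abs_summable_on_prod_PiE[of UNIV "\<lambda>_. UNIV" h] s unfolding U by simp
    have "infsetsum (h j) UNIV = (\<Sum>n. h j n)" for j by (rule infsetsum_nat'[OF s])
    then show "infsetsum (\<lambda>m. \<Prod>j\<in>UNIV. h j (m j)) (UNIV :: ('r \<Rightarrow> nat) set) = (\<Prod>j\<in>UNIV. \<Sum>n. h j n)"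
      using infsetsum_prod_PiE[of UNIV "\<lambda>_. UNIV" h] s unfolding U by simp
  qed
  have sc: "summable (\<lambda>n. norm (c j n))" for j unfolding c_def by (rule binomial_series(1)[OF x])
  note swap = dominated_Fubini[of "count_space (UNIV :: ('r \<Rightarrow> nat) set)" lborel f 
      "\<lambda>m. norm (\<Prod>j\<in>UNIV. c j (m j))" "\<lambda>t. norm (E0 t)"]
  have pre: "sigma_finite_measure (count_space (UNIV :: ('r \<Rightarrow> nat) set))" "sigma_finite_measure (lborel :: real measure)"
    "(\<lambda>(m, t). f m t) \<in> borel_measurable (count_space UNIV \<Otimes>\<^sub>M lborel)"
    "integrable (count_space UNIV) (\<lambda>m. norm (\<Prod>j\<in>UNIV. c j (m j)))"
    "integrable lborel (\<lambda>t. norm (E0 t))"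
    "\<And>m t. norm (f m t) \<le> norm (\<Prod>j\<in>UNIV. c j (m j)) * norm (E0 t)"
  proof -
    show "sigma_finite_measure (count_space (UNIV :: ('r \<Rightarrow> nat) set))"
      by (rule sigma_finite_measure_count_space)
    show "sigma_finite_measure (lborel :: real measure)" by (rule lborel.sigma_finite_measure_axioms)
    \<comment> \<open>There are countably many multi-indices, so measurability in t for each of them
      suffices.\<close>
    show "(\<lambda>(m, t). f m t) \<in> borel_measurable (count_space UNIV \<Otimes>\<^sub>M lborel)"
      by (rule measurable_pair_measure_countable1) (simp_all add: f_def)
    show "integrable (count_space UNIV) (\<lambda>m. norm (\<Prod>j\<in>UNIV. c j (m j)))"
      using prod_summable[of c, OF sc] unfolding Infinite_Set_Sum.abs_summable_on_def by (rule integrable_norm)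
    show "integrable lborel (\<lambda>t. norm (E0 t))" using intE by (rule integrable_norm)
    show "norm (f m t) \<le> norm (\<Prod>j\<in>UNIV. c j (m j)) * norm (E0 t)" for m t
    proof (cases "t \<in> {0<..<1}")
      case True
      then have "(\<Prod>j\<in>UNIV. norm (of_real t :: complex) ^ m j) \<le> 1"
        by (intro prod_le_1) (auto simp: power_le_one)
      then have "norm (E0 t) * (norm (\<Prod>j\<in>UNIV. c j (m j)) * (\<Prod>j\<in>UNIV. norm (of_real t :: complex) ^ m j))
        \<le> norm (E0 t) * (norm (\<Prod>j\<in>UNIV. c j (m j)) * 1)"
        by (intro mult_left_mono) auto
      then show ?thesis by (simp add: f_def norm_mult prod.distrib norm_power mult_ac flip: prod_norm)
    next
      case False
      then show ?thesis by (simp add: f_def E0_def)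
    qed
  qed
  have tm: "ext_lauricella_FD_term \<Theta> \<alpha> \<beta> \<gamma> x b d m = (LINT t|lborel. f m t) / Beta \<alpha> (\<gamma> - \<alpha>)" for m
  proof -
    have "ext_beta \<Theta> b d (\<alpha> + of_nat (\<Sum>j\<in>UNIV. m j)) (\<gamma> - \<alpha>) = (LINT t|lborel. E0 t * (\<Prod>j\<in>UNIV. of_real t ^ m j))"
    proof -
      have "ext_beta \<Theta> b d (\<alpha> + of_nat (\<Sum>j\<in>UNIV. m j)) (\<gamma> - \<alpha>) = 
         (LINT t|lborel. E0 t * exp (of_nat (\<Sum>j\<in>UNIV. m j) * of_real (ln t)))"
        using ext_beta_diff[of \<Theta> b d \<alpha> "- of_nat (\<Sum>j\<in>UNIV. m j)" "\<gamma> - \<alpha>"] by (simp add: E0_def)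
      also have "\<dots> = (LINT t|lborel. E0 t * (\<Prod>j\<in>UNIV. of_real t ^ m j))"
      proof (intro Bochner_Integration.integral_cong refl)
        fix t
        have "exp (of_nat (\<Sum>j\<in>UNIV. m j) * of_real (ln t)) = (\<Prod>j\<in>UNIV. of_real t ^ m j :: complex)" if "0 < t"
        proof -
          have "exp (of_nat (\<Sum>j\<in>UNIV. m j) * of_real (ln t)) = exp (of_real (ln t) :: complex) ^ (\<Sum>j\<in>UNIV. m j)"
            by (rule exp_of_nat_mult)
          also have "exp (of_real (ln t)) = (of_real t :: complex)" using that by (simp add: exp_of_real)
          finally show ?thesis by (simp add: power_sum)
        qed
        then show "E0 t * exp (of_nat (\<Sum>j\<in>UNIV. m j) * of_real (ln t)) = E0 t * (\<Prod>j\<in>UNIV. of_real t ^ m j)"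
          by (cases "0 < t") (auto simp: E0_def)
      qed
      finally show ?thesis .
    qed
    moreover have "(LINT t|lborel. f m t) = (\<Prod>j\<in>UNIV. c j (m j)) * (LINT t|lborel. E0 t * (\<Prod>j\<in>UNIV. of_real t ^ m j))"
      unfolding f_def prod.distrib by (subst integral_mult_right_zero[symmetric]) (simp add: mult_ac)
    moreover have "(\<Prod>j\<in>UNIV. pochhammer (\<beta> j) (m j)) * (\<Prod>j\<in>UNIV. x j ^ m j / fact (m j)) = (\<Prod>j\<in>UNIV. c j (m j))"
      unfolding c_def prod.distrib[symmetric] by simp
    ultimately show ?thesis
      unfolding ext_lauricella_FD_term_def by (simp add: mult_ac)
  qed
  have "integrable (count_space UNIV) (\<lambda>m. LINT t|lborel. f m t)" by (rule swap(1)[OF pre])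
  \<comment> \<open>Absolute summability identifies the integral over the counting measure with the
    unordered sum in the definition.\<close>
  then have abs: "Infinite_Set_Sum.abs_summable_on (ext_lauricella_FD_term \<Theta> \<alpha> \<beta> \<gamma> x b d) UNIV"
    unfolding Infinite_Set_Sum.abs_summable_on_def tm[abs_def] by (rule integrable_divide_zero)
  then show "ext_lauricella_FD_term \<Theta> \<alpha> \<beta> \<gamma> x b d summable_on UNIV"
    by (rule abs_summable_summable[OF abs_summable_equivalent[THEN iffD2]])
  have "ext_lauricella_FD \<Theta> \<alpha> \<beta> \<gamma> x b d = (LINT m|count_space UNIV. LINT t|lborel. f m t) / Beta \<alpha> (\<gamma> - \<alpha>)"
    unfolding ext_lauricella_FD_def infsetsum_infsum[OF abs, symmetric] infsetsum_def tm by simp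
  also have "(LINT m|count_space UNIV. LINT t|lborel. f m t) = (LINT t|lborel. LINT m|count_space UNIV. f m t)"
    by (rule swap(2)[OF pre])
  also have "\<dots> = (LINT t|lborel. E0 t * (\<Prod>j\<in>UNIV. (1 - of_real t * x j) powr (- \<beta> j)))"
  proof (intro Bochner_Integration.integral_cong refl)
    fix t
    show "(LINT m|count_space UNIV. f m t) = E0 t * (\<Prod>j\<in>UNIV. (1 - of_real t * x j) powr (- \<beta> j))"
    proof (cases "t \<in> {0<..<1}")
      case False
      then show ?thesis by (simp add: f_def E0_def)
    next
      case True
      have ct: "c j n * of_real t ^ n = pochhammer (\<beta> j) n * (of_real t * x j) ^ n / fact n" for j n
        by (simp add: c_def power_mult_distrib)
      have nt: "norm (of_real t * x j) < 1" for j
        using True mult_strict_mono'[of t 1 "norm (x j)" 1] x[of j] by (simp add: norm_mult)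
      have "(LINT m|count_space UNIV. f m t) = E0 t * infsetsum (\<lambda>m. \<Prod>j\<in>UNIV. c j (m j) * of_real t ^ m j) UNIV"
        unfolding f_def infsetsum_def by simp
      also have "infsetsum (\<lambda>m. \<Prod>j\<in>UNIV. c j (m j) * of_real t ^ m j) UNIV = (\<Prod>j\<in>UNIV. \<Sum>n. c j n * of_real t ^ n)"
        by (rule prod_sum[of "\<lambda>j n. c j n * of_real t ^ n"]) (unfold ct, rule binomial_series(1)[OF nt])
      also have "\<dots> = (\<Prod>j\<in>UNIV. (1 - of_real t * x j) powr (- \<beta> j))"
        unfolding ct binomial_series(2)[OF nt] ..
      finally show ?thesis .
    qed
  qed
  finally show "ext_lauricella_FD \<Theta> \<alpha> \<beta> \<gamma> x b d = (LINT t|lborel. indicator {0<..<1} t *\<^sub>R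
      ext_beta_integrand \<Theta> b d \<alpha> (\<gamma> - \<alpha>) t * (\<Prod>j\<in>UNIV. (1 - of_real t * x j) powr (- \<beta> j))) / Beta \<alpha> (\<gamma> - \<alpha>)"
    unfolding E0_def .
qed

text \<open>For 0 < t < 1 each |t powr (-s_j)| is at most t to the power minus the supremum of Re
  s_j. So the majorant in t is the norm of the beta integrand with \<alpha> lowered by the sum of
  the suprema, integrable by the second assumption; the majorant in the parameters is a product of
  one-variable functions. After the exchange the inner integral factorises into Barnes
  integrals.\<close>

lemma mellin_barnes_eq_integral:
  fixes x \<beta> :: "'r::finite \<Rightarrow> complex" and L :: "'r \<Rightarrow> real \<Rightarrow> complex"
  assumes E: "set_integrable lborel {0<..<1} (ext_beta_integrand \<Theta> b d \<alpha> (\<gamma> - \<alpha>))"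
      "set_integrable lborel {0<..<1} (ext_beta_integrand \<Theta> b d (\<alpha> - of_real (\<Sum>j\<in>UNIV. SUP t. Re (L j t))) (\<gamma> - \<alpha>))"
    and x: "\<And>j. norm (x j) < 1" "\<And>j. - x j \<notin> \<real>\<^sub>\<le>\<^sub>0"
    and bp: "\<And>j. barnes_path (\<beta> j) (L j)"
  shows "paths_integrable L (mellin_barnes_integrand \<Theta> \<alpha> \<beta> \<gamma> x b d)"
    and "paths_integral L (mellin_barnes_integrand \<Theta> \<alpha> \<beta> \<gamma> x b d) = (2 * of_real pi * \<i>) ^ CARD('r) *
      ((LINT t|lborel. indicator {0<..<1} t *\<^sub>R ext_beta_integrand \<Theta> b d \<alpha> (\<gamma> - \<alpha>) t *
        (\<Prod>j\<in>UNIV. (1 - of_real t * x j) powr (- \<beta> j))) / Beta \<alpha> (\<gamma> - \<alpha>))"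
proof -
  define E0 where "E0 t = indicator {0<..<1} t *\<^sub>R ext_beta_integrand \<Theta> b d \<alpha> (\<gamma> - \<alpha>) t" for t
  have "integrable lborel E0" using E(1) unfolding set_integrable_def E0_def[abs_def] .
  then have [measurable]: "E0 \<in> borel_measurable borel" by auto
  define \<sigma> where "\<sigma> j = (SUP t. Re (L j t))" for j
  have sp: "strip_path (L j)" for j by (rule barnes_path_strip_path[OF bp])
  have [measurable]: "L j \<in> borel_measurable borel" for j
    by (intro borel_measurable_continuous_onI strip_path_continuous sp)
  \<comment> \<open>Real parts on a strip path are bounded, so the supremum is a genuine one and not
    a default value.\<close>
  have \<sigma>: "Re (L j u) \<le> \<sigma> j" for j u
  proof -
    have "bdd_above (range (\<lambda>t. Re (L j t)))"
      using sp[of j] unfolding strip_path_def by (intro bounded_imp_bdd_above) auto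
    then show ?thesis unfolding \<sigma>_def by (intro cSUP_upper) auto
  qed
  \<comment> \<open>The derivative of the path is included, so the product of the
    \<open>\<phi> j\<close> is everything in the integrand except the beta factor.\<close>
  define \<phi> where "\<phi> j u = path_integrand (L j) (barnes_kernel (\<beta> j) (- x j)) u / Gamma (\<beta> j)" for j u
  have int\<phi>: "integrable lborel (\<phi> j)" for j
    unfolding \<phi>_def
    by (intro integrable_divide_zero barnes_kernel_on_path[OF sp x(2)] barnes_path_avoids_poles[OF bp])
  have [measurable]: "\<phi> j \<in> borel_measurable borel" for j using int\<phi>[of j] by auto
  interpret P: product_sigma_finite "\<lambda>_::'r. lborel :: real measure" ..
  interpret PF: finite_product_sigma_finite "\<lambda>_::'r. lborel :: real measure" UNIV by standard simp
  let ?M = "\<Pi>\<^sub>M j\<in>(UNIV::'r set). (lborel :: real measure)"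
  define f where "f u t = E0 t * (\<Prod>j\<in>UNIV. \<phi> j (u j) * exp (- L j (u j) * of_real (ln t)))" for u t
  define S where "S = (\<Sum>j\<in>UNIV. \<sigma> j)"
  note swap = dominated_Fubini[of ?M lborel f "\<lambda>u. norm (\<Prod>j\<in>UNIV. \<phi> j (u j))" "\<lambda>t. norm (E0 t) * exp (- S * ln t)"]
  have pre: "sigma_finite_measure ?M" "sigma_finite_measure (lborel :: real measure)"
    "(\<lambda>(u, t). f u t) \<in> borel_measurable (?M \<Otimes>\<^sub>M lborel)"
    "integrable ?M (\<lambda>u. norm (\<Prod>j\<in>UNIV. \<phi> j (u j)))"
    "integrable lborel (\<lambda>t. norm (E0 t) * exp (- S * ln t))"
    "\<And>u t. norm (f u t) \<le> norm (\<Prod>j\<in>UNIV. \<phi> j (u j)) * (norm (E0 t) * exp (- S * ln t))"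
  proof -
    show "sigma_finite_measure ?M" by (rule PF.sigma_finite_measure_axioms)
    show "sigma_finite_measure (lborel :: real measure)" by (rule lborel.sigma_finite_measure_axioms)
    show "(\<lambda>(u, t). f u t) \<in> borel_measurable (?M \<Otimes>\<^sub>M lborel)"
      unfolding f_def by measurable
    show "integrable ?M (\<lambda>u. norm (\<Prod>j\<in>UNIV. \<phi> j (u j)))"
      by (intro integrable_norm P.product_integrable_prod int\<phi>) auto
    have "integrable lborel (\<lambda>t. norm (indicator {0<..<1} t *\<^sub>R ext_beta_integrand \<Theta> b d (\<alpha> - of_real S) (\<gamma> - \<alpha>) t))"
      using E(2) unfolding set_integrable_def S_def \<sigma>_def by (rule integrable_norm)
    also have "(\<lambda>t. norm (indicator {0<..<1} t *\<^sub>R ext_beta_integrand \<Theta> b d (\<alpha> - of_real S) (\<gamma> - \<alpha>) t)) =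
        (\<lambda>t. norm (E0 t) * exp (- S * ln t))"
    proof
      fix t
      show "norm (indicator {0<..<1} t *\<^sub>R ext_beta_integrand \<Theta> b d (\<alpha> - of_real S) (\<gamma> - \<alpha>) t) = norm (E0 t) * exp (- S * ln t)"
        by (auto simp: E0_def ext_beta_integrand_diff norm_mult indicator_def)
    qed
    finally show "integrable lborel (\<lambda>t. norm (E0 t) * exp (- S * ln t))" .
    show "norm (f u t) \<le> norm (\<Prod>j\<in>UNIV. \<phi> j (u j)) * (norm (E0 t) * exp (- S * ln t))" for u t
    proof (cases "t \<in> {0<..<1}")
      case False
      then show ?thesis by (simp add: f_def E0_def)
    next
      case True
      then have ln: "ln t \<le> 0" by simp
      have "(\<Prod>j\<in>UNIV. exp (- Re (L j (u j)) * ln t)) \<le> (\<Prod>j\<in>UNIV. exp (- \<sigma> j * ln t))"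
        using \<sigma> ln by (intro prod_mono) (auto intro!: mult_right_mono_neg)
      also have "\<dots> = exp (- S * ln t)"
        by (simp add: S_def sum_distrib_right sum_negf flip: exp_sum)
      finally have "norm (E0 t) * (norm (\<Prod>j\<in>UNIV. \<phi> j (u j)) * (\<Prod>j\<in>UNIV. exp (- Re (L j (u j)) * ln t)))
         \<le> norm (E0 t) * (norm (\<Prod>j\<in>UNIV. \<phi> j (u j)) * exp (- S * ln t))"
        by (intro mult_left_mono) auto
      then show ?thesis by (simp add: f_def norm_mult prod.distrib mult_ac flip: prod_norm)
    qed
  qed
  have eq: "paths_integrand L (mellin_barnes_integrand \<Theta> \<alpha> \<beta> \<gamma> x b d) u = (LINT t|lborel. f u t) / Beta \<alpha> (\<gamma> - \<alpha>)" for u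
  proof -
    have "ext_beta \<Theta> b d (\<alpha> - (\<Sum>j\<in>UNIV. L j (u j))) (\<gamma> - \<alpha>) =
       (LINT t|lborel. E0 t * (\<Prod>j\<in>UNIV. exp (- L j (u j) * of_real (ln t))))"
      unfolding ext_beta_diff E0_def[symmetric]
      by (simp add: sum_distrib_right sum_negf flip: exp_sum)
    moreover have "(LINT t|lborel. f u t) = (\<Prod>j\<in>UNIV. \<phi> j (u j)) *
        (LINT t|lborel. E0 t * (\<Prod>j\<in>UNIV. exp (- L j (u j) * of_real (ln t))))"
      unfolding f_def prod.distrib by (subst integral_mult_right_zero[symmetric]) (simp add: mult_ac)
    moreover have "(\<Prod>j\<in>UNIV. \<phi> j (u j)) = (\<Prod>j\<in>UNIV. Gamma (\<beta> j - L j (u j)) * Gamma (L j (u j)) / Gamma (\<beta> j)) *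
        (\<Prod>j\<in>UNIV. (- x j) powr (- L j (u j))) * (\<Prod>j\<in>UNIV. vector_derivative (L j) (at (u j)))"
      unfolding prod.distrib[symmetric] by (simp add: \<phi>_def path_integrand_def barnes_kernel_def)
    ultimately show ?thesis
      by (simp add: paths_integrand_def mellin_barnes_integrand_def)
  qed
  show "paths_integrable L (mellin_barnes_integrand \<Theta> \<alpha> \<beta> \<gamma> x b d)"
    unfolding paths_integrable_def eq[abs_def] by (rule integrable_divide_zero[OF swap(1)[OF pre]])
  have "paths_integral L (mellin_barnes_integrand \<Theta> \<alpha> \<beta> \<gamma> x b d) = (LINT u|?M. LINT t|lborel. f u t) / Beta \<alpha> (\<gamma> - \<alpha>)"
    unfolding paths_integral_def eq by simp
  also have "(LINT u|?M. LINT t|lborel. f u t) = (LINT t|lborel. LINT u|?M. f u t)" by (rule swap(2)[OF pre])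
  also have "\<dots> = (LINT t|lborel. (2 * of_real pi * \<i>) ^ CARD('r) * (E0 t * (\<Prod>j\<in>UNIV. (1 - of_real t * x j) powr (- \<beta> j))))"
  proof (intro Bochner_Integration.integral_cong refl)
    fix t
    show "(LINT u|?M. f u t) = (2 * of_real pi * \<i>) ^ CARD('r) * (E0 t * (\<Prod>j\<in>UNIV. (1 - of_real t * x j) powr (- \<beta> j)))"
    proof (cases "t \<in> {0<..<1}")
      case False
      then show ?thesis by (simp add: f_def E0_def)
    next
      case True
      \<comment> \<open>The integral of the product over the product measure splits once each factor
        is integrable.\<close>
      have int: "integrable lborel (\<lambda>v. \<phi> j v * exp (- L j v * of_real (ln t)))" for j
      proof (rule Bochner_Integration.integrable_bound)
        show "integrable lborel (\<lambda>v. norm (\<phi> j v) * exp (- \<sigma> j * ln t))"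
          by (intro integrable_mult_left integrable_norm int\<phi>)
        have "norm (exp (- L j v * of_real (ln t))) \<le> exp (- \<sigma> j * ln t)" for v
          using \<sigma>[of j v] True by (auto intro!: mult_right_mono_neg)
        then have "norm (\<phi> j v * exp (- L j v * of_real (ln t))) \<le> norm (\<phi> j v) * exp (- \<sigma> j * ln t)" for v
          unfolding norm_mult[of "\<phi> j v"] by (intro mult_left_mono) auto
        then show "AE v in lborel. norm (\<phi> j v * exp (- L j v * of_real (ln t))) \<le> norm (norm (\<phi> j v) * exp (- \<sigma> j * ln t))"
          by (intro AE_I2) simp
      qed simp
      have "(LINT u|?M. f u t) = E0 t * (LINT u|?M. (\<Prod>j\<in>UNIV. \<phi> j (u j) * exp (- L j (u j) * of_real (ln t))))"
        unfolding f_def by simp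
      also have "(LINT u|?M. (\<Prod>j\<in>UNIV. \<phi> j (u j) * exp (- L j (u j) * of_real (ln t)))) =
          (\<Prod>j\<in>UNIV. LINT v|lborel. \<phi> j v * exp (- L j v * of_real (ln t)))"
        by (rule P.product_integral_prod[of UNIV "\<lambda>j v. \<phi> j v * exp (- L j v * of_real (ln t))"]) (use int in auto)
      also have "\<dots> = (\<Prod>j\<in>UNIV. 2 * of_real pi * \<i> * (1 - of_real t * x j) powr (- \<beta> j))"
        unfolding \<phi>_def using True x bp by (intro prod.cong refl barnes_integral_scaled) auto
      finally show ?thesis by (simp add: prod.distrib prod_constant power_mult_distrib)
    qed
  qed
  also have "\<dots> = (2 * of_real pi * \<i>) ^ CARD('r) * (LINT t|lborel. E0 t * (\<Prod>j\<in>UNIV. (1 - of_real t * x j) powr (- \<beta> j)))"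
    by (rule integral_mult_right_zero)
  finally show "paths_integral L (mellin_barnes_integrand \<Theta> \<alpha> \<beta> \<gamma> x b d) = (2 * of_real pi * \<i>) ^ CARD('r) *
      ((LINT t|lborel. indicator {0<..<1} t *\<^sub>R ext_beta_integrand \<Theta> b d \<alpha> (\<gamma> - \<alpha>) t *
        (\<Prod>j\<in>UNIV. (1 - of_real t * x j) powr (- \<beta> j))) / Beta \<alpha> (\<gamma> - \<alpha>))"
    unfolding E0_def by simp
qed

theorem theorem3p14:
  fixes \<kappa> :: "nat \<Rightarrow> complex" and R :: real and \<Theta> :: "complex \<Rightarrow> complex"
    and \<alpha> \<gamma> b d :: complex
    and \<beta> x :: "'r::finite \<Rightarrow> complex"
    and L :: "'r \<Rightarrow> real \<Rightarrow> complex"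
  assumes "theta_kernel \<kappa> R \<Theta>"
    and "0 \<le> Re b" and "0 \<le> Re d"
    and "ext_beta_defined \<Theta> b d"
    and "0 < Re \<alpha>" and "0 < Re (\<gamma> - \<alpha>)"
    and "\<And>j. norm (x j) < 1"
    and "\<And>j. - x j \<notin> \<real>\<^sub>\<le>\<^sub>0"
    and "\<And>j. barnes_path (\<beta> j) (L j)"
    and "(\<Sum>j\<in>UNIV. SUP t. Re (L j t)) < Re \<alpha>"
  shows "ext_lauricella_FD_term \<Theta> \<alpha> \<beta> \<gamma> x b d summable_on UNIV \<and>
         paths_integrable L (mellin_barnes_integrand \<Theta> \<alpha> \<beta> \<gamma> x b d) \<and>
         ext_lauricella_FD \<Theta> \<alpha> \<beta> \<gamma> x b d =
           1 / (2 * of_real pi * \<i>) ^ CARD('r) *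
             paths_integral L (mellin_barnes_integrand \<Theta> \<alpha> \<beta> \<gamma> x b d)"
proof -
  have E: "set_integrable lborel {0<..<1} (ext_beta_integrand \<Theta> b d \<alpha> (\<gamma> - \<alpha>))"
    using assms(4,5,6) unfolding ext_beta_defined_def by blast
  \<comment> \<open>The condition on the suprema keeps the lowered first argument in the domain of
    the extended beta function, where its integral exists.\<close>
  have "0 < Re (\<alpha> - of_real (\<Sum>j\<in>UNIV. SUP t. Re (L j t)))"
    using assms(10) by simp
  then have E': "set_integrable lborel {0<..<1}
      (ext_beta_integrand \<Theta> b d (\<alpha> - of_real (\<Sum>j\<in>UNIV. SUP t. Re (L j t))) (\<gamma> - \<alpha>))"
    using assms(4,6) unfolding ext_beta_defined_def by blast
  note F = ext_lauricella_FD_eq_integral[where \<beta>=\<beta>, OF E assms(7)]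
  note MB = mellin_barnes_eq_integral[OF E E' assms(7,8,9)]
  have "(2 * of_real pi * \<i>) ^ CARD('r) \<noteq> (0 :: complex)" by simp
  then show ?thesis
    using F(1) MB(1) unfolding F(2) MB(2) by simp
qed

end
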